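(* Let $p$ be an odd prime and let $G$ be a finite group. The following are equivalent: (a) All sections of $G$ are $p$-stable. (b) $N_G(Q)$ does not involve $Qd(p)$ for any $p$-centric $p$-subgroup $Q$ of $G$.
   Context: A section of $G$ is a group $H/K$ with $K\triangleleft H\le G$; $G$ involves a group $X$ if some section of $G$ is isomorphic to $X$. A finite group $G$ is $p$-stable if for every $p$-subgroup $Q$ of $G$ and every $x \in N_G(Q)$ with $[Q,x,x]=1$ (i.e. $[[a,x],x]=1$ for all $a\in Q$), the coset $xC_G(Q)$ lies in $O_p\big(N_G(Q)/C_G(Q)\big)$. $Qd(p) = V \rtimes SL_2(p)$ is the semidirect product of a two-dimensional vector space $V$ over $\mathbb{F}_p$ with $SL_2(p)$ acting naturally. A $p$-subgroup $Q$ of $G$ is $p$-centric if every $p$-element of $G$ centralising $Q$ is contained in $Q$. *)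

theory Defs
  imports "HOL-Algebra.Group_Action" "HOL-Algebra.Generated_Groups" "HOL-Number_Theory.Residues"
begin

section \<open>Sections and involvement\<close>

text \<open>\<^term>\<open>section_of G H K\<close> says that \<open>H/K\<close> is a section of \<open>G\<close>; the quotient itself is
  \<^term>\<open>G\<lparr>carrier := H\<rparr> Mod K\<close>.\<close>

definition section_of :: "('a, 'b) monoid_scheme \<Rightarrow> 'a set \<Rightarrow> 'a set \<Rightarrow> bool" where
  "section_of G H K \<longleftrightarrow> subgroup H G \<and> K \<lhd> G\<lparr>carrier := H\<rparr>"

definition involves :: "('a, 'b) monoid_scheme \<Rightarrow> ('c, 'd) monoid_scheme \<Rightarrow> bool" where
  "involves G Y \<longleftrightarrow> (\<exists>H K. section_of G H K \<and> (G\<lparr>carrier := H\<rparr> Mod K) \<cong> Y)"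

section \<open>Local subgroups\<close>

definition centralizer :: "('a, 'b) monoid_scheme \<Rightarrow> 'a set \<Rightarrow> 'a set" where
  "centralizer G Q = {x \<in> carrier G. \<forall>a\<in>Q. x \<otimes>\<^bsub>G\<^esub> a = a \<otimes>\<^bsub>G\<^esub> x}"

text \<open>The trivial subgroup is a \<open>p\<close>-subgroup. For \<open>p > 0\<close> the condition forces \<open>Q\<close> to be finite.\<close>

definition p_subgroup :: "nat \<Rightarrow> ('a, 'b) monoid_scheme \<Rightarrow> 'a set \<Rightarrow> bool" where
  "p_subgroup p G Q \<longleftrightarrow> subgroup Q G \<and> (\<exists>n::nat. card Q = p ^ n)"

definition p_element :: "nat \<Rightarrow> ('a, 'b) monoid_scheme \<Rightarrow> 'a \<Rightarrow> bool" where
  "p_element p G x \<longleftrightarrow> x \<in> carrier G \<and> (\<exists>n::nat. group.ord G x = p ^ n)"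

text \<open>\<open>O\<^sub>p(G)\<close>, as the subgroup generated by all normal \<open>p\<close>-subgroups. For finite \<open>G\<close> it is
  the largest normal \<open>p\<close>-subgroup.\<close>

definition p_core :: "nat \<Rightarrow> ('a, 'b) monoid_scheme \<Rightarrow> 'a set" where
  "p_core p G = generate G (\<Union>{N. N \<lhd> G \<and> p_subgroup p G N})"

definition p_centric :: "nat \<Rightarrow> ('a, 'b) monoid_scheme \<Rightarrow> 'a set \<Rightarrow> bool" where
  "p_centric p G Q \<longleftrightarrow>
     p_subgroup p G Q \<and> (\<forall>x. p_element p G x \<and> x \<in> centralizer G Q \<longrightarrow> x \<in> Q)"

section \<open>\<open>p\<close>-stability\<close>

text \<open>The convention is \<open>[x, y] = x\<inverse>y\<inverse>xy\<close>. When \<open>x\<close> normalises \<open>Q\<close>, the condition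
  \<open>[[a, x], x] = 1\<close> for all \<open>a \<in> Q\<close> is the same for the convention \<open>xyx\<inverse>y\<inverse>\<close>.\<close>

definition commutator :: "('a, 'b) monoid_scheme \<Rightarrow> 'a \<Rightarrow> 'a \<Rightarrow> 'a" where
  "commutator G x y = inv\<^bsub>G\<^esub> x \<otimes>\<^bsub>G\<^esub> inv\<^bsub>G\<^esub> y \<otimes>\<^bsub>G\<^esub> x \<otimes>\<^bsub>G\<^esub> y"

text \<open>Cosets of \<open>C\<^sub>G(Q)\<close> in \<open>N\<^sub>G(Q)\<close> are written as right cosets, as in the library's
  quotient; left and right cosets agree because \<open>C\<^sub>G(Q)\<close> is normal in \<open>N\<^sub>G(Q)\<close>.\<close>

definition p_stable :: "nat \<Rightarrow> ('a, 'b) monoid_scheme \<Rightarrow> bool" where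
  "p_stable p G \<longleftrightarrow>
     (\<forall>Q x. p_subgroup p G Q \<and> x \<in> normalizer G Q \<and>
        (\<forall>a\<in>Q. commutator G (commutator G a x) x = \<one>\<^bsub>G\<^esub>)
        \<longrightarrow> centralizer G Q #>\<^bsub>G\<^esub> x
              \<in> p_core p (G\<lparr>carrier := normalizer G Q\<rparr> Mod centralizer G Q))"

section \<open>The group \<open>Qd(p)\<close>\<close>

definition semidirect_product ::
  "('a, 'c) monoid_scheme \<Rightarrow> ('b, 'd) monoid_scheme \<Rightarrow> ('b \<Rightarrow> 'a \<Rightarrow> 'a) \<Rightarrow> ('a \<times> 'b) monoid" where
  "semidirect_product N H \<phi> =
     \<lparr>carrier = carrier N \<times> carrier H,
      monoid.mult = (\<lambda>(n, h) (n', h'). (n \<otimes>\<^bsub>N\<^esub> \<phi> h n', h \<otimes>\<^bsub>H\<^esub> h')),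
      one = (\<one>\<^bsub>N\<^esub>, \<one>\<^bsub>H\<^esub>)\<rparr>"

text \<open>A \<open>2 \<times> 2\<close> matrix is the pair of its rows, and vectors of \<open>R\<^sup>2\<close> are columns.\<close>

definition SL2 :: "('a, 'b) ring_scheme \<Rightarrow> (('a \<times> 'a) \<times> ('a \<times> 'a)) monoid" where
  "SL2 R =
     \<lparr>carrier = {((a, b), (c, d)) | a b c d.
        a \<in> carrier R \<and> b \<in> carrier R \<and> c \<in> carrier R \<and> d \<in> carrier R \<and>
        (a \<otimes>\<^bsub>R\<^esub> d) \<ominus>\<^bsub>R\<^esub> (b \<otimes>\<^bsub>R\<^esub> c) = \<one>\<^bsub>R\<^esub>},
      monoid.mult = (\<lambda>((a, b), (c, d)) ((a', b'), (c', d')).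
        (((a \<otimes>\<^bsub>R\<^esub> a') \<oplus>\<^bsub>R\<^esub> (b \<otimes>\<^bsub>R\<^esub> c'), (a \<otimes>\<^bsub>R\<^esub> b') \<oplus>\<^bsub>R\<^esub> (b \<otimes>\<^bsub>R\<^esub> d')),
         ((c \<otimes>\<^bsub>R\<^esub> a') \<oplus>\<^bsub>R\<^esub> (d \<otimes>\<^bsub>R\<^esub> c'), (c \<otimes>\<^bsub>R\<^esub> b') \<oplus>\<^bsub>R\<^esub> (d \<otimes>\<^bsub>R\<^esub> d')))),
      one = ((\<one>\<^bsub>R\<^esub>, \<zero>\<^bsub>R\<^esub>), (\<zero>\<^bsub>R\<^esub>, \<one>\<^bsub>R\<^esub>))\<rparr>"

definition natural_action ::
  "('a, 'b) ring_scheme \<Rightarrow> ('a \<times> 'a) \<times> ('a \<times> 'a) \<Rightarrow> 'a \<times> 'a \<Rightarrow> 'a \<times> 'a" where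
  "natural_action R = (\<lambda>((a, b), (c, d)) (v, w).
     ((a \<otimes>\<^bsub>R\<^esub> v) \<oplus>\<^bsub>R\<^esub> (b \<otimes>\<^bsub>R\<^esub> w), (c \<otimes>\<^bsub>R\<^esub> v) \<oplus>\<^bsub>R\<^esub> (d \<otimes>\<^bsub>R\<^esub> w)))"

text \<open>\<^term>\<open>residue_ring (int p)\<close> is the field of \<open>p\<close> elements when \<open>p\<close> is prime.\<close>

definition Qd :: "nat \<Rightarrow> ((int \<times> int) \<times> ((int \<times> int) \<times> (int \<times> int))) monoid" where
  "Qd p = (let F = residue_ring (int p)
           in semidirect_product (add_monoid F \<times>\<times> add_monoid F) (SL2 F) (natural_action F))"

end

theory Submission
  imports Defs "HOL-Algebra.Sylow" "HOL-Algebra.Multiplicative_Group"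
begin

text \<open>\<open>Qd(p)\<close> is not \<open>p\<close>-stable, because \<open>O\<^sub>p(SL\<^sub>2(p)) = 1\<close>. Conversely, if a section of \<open>G\<close> is not
  \<open>p\<close>-stable, the Baer--Suzuki theorem gives two conjugate elements \<open>x\<close>, \<open>y\<close> acting quadratically on a
  \<open>p\<close>-subgroup such that some element of \<open>\<langle>x, y\<rangle>\<close> of order prime to \<open>p\<close> acts nontrivially. Coprime
  action passes to an abelian section on which \<open>(x - 1)(y - 1) + (y - 1)(x - 1)\<close> is invertible, and a
  descent on \<open>\<langle>x, y\<rangle>\<close> produces a subgroup inducing \<open>SL\<^sub>2(p)\<close> on a section of order \<open>p\<^sup>2\<close>. Such a section
  lifts from a section of \<open>G\<close> to \<open>G\<close>. Frattini arguments replace its top by a \<open>p\<close>-subgroup, place it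
  in the normaliser of a \<open>p\<close>-centric subgroup, and finally split off \<open>Qd(p)\<close>.\<close>

section \<open>Group actions and Sylow subgroups\<close>

text \<open>What travels through the proof is a pair of integer coordinates modulo \<open>p\<close>
  on a subgroup, together with two elements acting on them by fixed matrices. As no kernel and no
  quotient is mentioned, such data can be pulled back along a quotient map, restricted to a Sylow
  subgroup, or kept while the ambient group shrinks; each change only has to supply new elements
  with the same two matrices. The main obstacle is to find \<open>SL_2(p)\<close> in a group
  generated by two quadratic elements, because the abelian section comes without a field over which
  they would be \<open>2 x 2\<close> matrices. The matrix identities are therefore proved in its
  endomorphism ring from three facts alone: \<open>e\<close> and \<open>f\<close> square to zero and
  \<open>ef + fe\<close> is invertible. Oddness of \<open>p\<close> enters three times: as division
  by 4 in that ring, as the absence of nonzero vectors of the plane fixed by \<open>-1\<close>,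
  which yields the splitting, and as the oddness of \<open>p^n\<close> when a power of an element
  with square \<open>-1\<close> is taken.\<close>

definition conj_by :: "('a, 'b) monoid_scheme \<Rightarrow> 'a \<Rightarrow> 'a \<Rightarrow> 'a" where
  "conj_by G x h = x \<otimes>\<^bsub>G\<^esub> h \<otimes>\<^bsub>G\<^esub> inv\<^bsub>G\<^esub> x"

context group
begin

lemma conj_by_closed [simp, intro]: "x \<in> carrier G \<Longrightarrow> h \<in> carrier G \<Longrightarrow> conj_by G x h \<in> carrier G"
  by (simp add: conj_by_def)

lemma conj_by_one [simp]: "h \<in> carrier G \<Longrightarrow> conj_by G \<one> h = h"
  by (simp add: conj_by_def)

lemma conj_by_one_right [simp]: "x \<in> carrier G \<Longrightarrow> conj_by G x \<one> = \<one>"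
  by (simp add: conj_by_def)

lemma conj_by_mult:
  "x \<in> carrier G \<Longrightarrow> h \<in> carrier G \<Longrightarrow> k \<in> carrier G \<Longrightarrow> conj_by G x (h \<otimes> k) = conj_by G x h \<otimes> conj_by G x k"
  by (simp add: conj_by_def m_assoc inv_solve_left)

lemma conj_by_inv: "x \<in> carrier G \<Longrightarrow> h \<in> carrier G \<Longrightarrow> conj_by G x (inv h) = inv (conj_by G x h)"
  by (simp add: conj_by_def m_assoc inv_mult_group)

lemma conj_by_conj_by:
  "x \<in> carrier G \<Longrightarrow> y \<in> carrier G \<Longrightarrow> h \<in> carrier G \<Longrightarrow> conj_by G x (conj_by G y h) = conj_by G (x \<otimes> y) h"
  by (simp add: conj_by_def m_assoc inv_mult_group)

lemma conj_by_inv_conj_by [simp]: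
  "x \<in> carrier G \<Longrightarrow> h \<in> carrier G \<Longrightarrow> conj_by G (inv x) (conj_by G x h) = h"
  "x \<in> carrier G \<Longrightarrow> h \<in> carrier G \<Longrightarrow> conj_by G x (conj_by G (inv x) h) = h"
  by (simp_all add: conj_by_conj_by)

lemma conj_by_hom: "x \<in> carrier G \<Longrightarrow> conj_by G x \<in> hom G G"
  by (simp add: hom_def conj_by_mult)

lemma group_hom_conj_by: "x \<in> carrier G \<Longrightarrow> group_hom G G (conj_by G x)"
  by (simp add: group_hom_def group_hom_axioms_def conj_by_hom is_group)

lemma inj_on_conj_by: "x \<in> carrier G \<Longrightarrow> inj_on (conj_by G x) (carrier G)"
  by (metis conj_by_inv_conj_by(1) inj_on_inverseI)

lemma subgroup_conj_by_image: "x \<in> carrier G \<Longrightarrow> subgroup H G \<Longrightarrow> subgroup (conj_by G x ` H) G"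
  by (rule group_hom.subgroup_img_is_subgroup[OF group_hom_conj_by])

lemma card_conj_by_image: "x \<in> carrier G \<Longrightarrow> H \<subseteq> carrier G \<Longrightarrow> card (conj_by G x ` H) = card H"
  by (meson card_image inj_on_conj_by inj_on_subset)

lemma conj_by_generate:
  "x \<in> carrier G \<Longrightarrow> D \<subseteq> carrier G \<Longrightarrow> conj_by G x ` generate G D = generate G (conj_by G x ` D)"
  by (rule group_hom.generate_img[OF group_hom_conj_by, symmetric])

lemma conj_by_eq_iff:
  assumes "x \<in> carrier G" "h \<in> carrier G" "k \<in> carrier G"
  shows "conj_by G x h = k \<longleftrightarrow> x \<otimes> h = k \<otimes> x"
  unfolding conj_by_def using assms by (metis inv_solve_right' m_closed)

text \<open>The library's \<open>normalizer\<close> is a stabilizer for the action on subsets,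
  formulated with cosets; this is the bridge to \<open>conj_by\<close>.\<close>

lemma mem_normalizer_iff:
  assumes "H \<subseteq> carrier G"
  shows "x \<in> normalizer G H \<longleftrightarrow> x \<in> carrier G \<and> conj_by G x ` H = H"
proof -
  have "x <# H #> inv x = conj_by G x ` H" if "x \<in> carrier G" for x
    by (auto simp: l_coset_def r_coset_def conj_by_def)
  with assms show ?thesis
    by (auto simp: normalizer_def stabilizer_def)
qed

lemma mem_normalizer_finite_iff:
  assumes "H \<subseteq> carrier G" "finite H"
  shows "x \<in> normalizer G H \<longleftrightarrow> x \<in> carrier G \<and> (\<forall>h\<in>H. conj_by G x h \<in> H)"
proof
  assume "x \<in> normalizer G H"
  with assms show "x \<in> carrier G \<and> (\<forall>h\<in>H. conj_by G x h \<in> H)"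
    by (auto simp: mem_normalizer_iff)
next
  assume *: "x \<in> carrier G \<and> (\<forall>h\<in>H. conj_by G x h \<in> H)"
  have "conj_by G x ` H = H"
    by (rule endo_inj_surj) (use * assms in \<open>auto intro: inj_on_subset[OF inj_on_conj_by]\<close>)
  with * assms show "x \<in> normalizer G H"
    by (simp add: mem_normalizer_iff)
qed

lemma normalizer_subset_carrier: "normalizer G H \<subseteq> carrier G"
  by (auto simp: normalizer_def stabilizer_def)

lemma mem_normalizerD:
  assumes "subgroup H G" "x \<in> normalizer G H"
  shows "x \<in> carrier G" "h \<in> H \<Longrightarrow> conj_by G x h \<in> H"
  using assms by (auto simp: mem_normalizer_iff subgroup.subset)

lemma subgroup_normalizer: "subgroup H G \<Longrightarrow> subgroup (normalizer G H) G"
  by (simp add: normalizer_imp_subgroup subgroup.subset)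

lemma subgroup_subset_normalizer:
  assumes "subgroup H G"
  shows "H \<subseteq> normalizer G H"
proof
  fix x assume "x \<in> H"
  interpret H: subgroup H G by fact
  have "conj_by G x ` H = H"
  proof
    show "conj_by G x ` H \<subseteq> H"
      using \<open>x \<in> H\<close> by (auto simp: conj_by_def)
    show "H \<subseteq> conj_by G x ` H"
    proof
      fix h assume "h \<in> H"
      have "h = conj_by G x (conj_by G (inv x) h)"
        using \<open>x \<in> H\<close> \<open>h \<in> H\<close> by simp
      moreover have "conj_by G (inv x) h \<in> H"
        using \<open>x \<in> H\<close> \<open>h \<in> H\<close> by (simp add: conj_by_def)
      ultimately show "h \<in> conj_by G x ` H" by blast
    qed
  qed
  then show "x \<in> normalizer G H"
    using H.subset \<open>x \<in> H\<close> by (auto simp: mem_normalizer_iff)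
qed

lemma subgroup_conj_closed:
  assumes "subgroup H G" "x \<in> H" "h \<in> H"
  shows "conj_by G x h \<in> H"
  using assms by (simp add: conj_by_def subgroup.m_closed subgroup.m_inv_closed)

lemma subgroup_pow_closed: "subgroup H G \<Longrightarrow> h \<in> H \<Longrightarrow> h [^] (n::nat) \<in> H"
  by (induction n) (auto simp: subgroup.one_closed subgroup.m_closed)

lemma mem_centralizer_iff:
  assumes "Q \<subseteq> carrier G"
  shows "x \<in> centralizer G Q \<longleftrightarrow> x \<in> carrier G \<and> (\<forall>q\<in>Q. conj_by G x q = q)"
  using assms by (auto simp: centralizer_def conj_by_eq_iff subset_iff)

lemma subgroup_centralizer:
  assumes "Q \<subseteq> carrier G"
  shows "subgroup (centralizer G Q) G"
proof (rule subgroupI)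
  show "centralizer G Q \<subseteq> carrier G"
    by (auto simp: centralizer_def)
  have "\<one> \<in> centralizer G Q"
    using assms by (auto simp: mem_centralizer_iff)
  then show "centralizer G Q \<noteq> {}" by blast
next
  fix a assume "a \<in> centralizer G Q"
  then have a: "a \<in> carrier G" "\<forall>q\<in>Q. conj_by G a q = q"
    by (simp_all add: mem_centralizer_iff assms)
  have "conj_by G (inv a) q = q" if "q \<in> Q" for q
    using a that assms conj_by_inv_conj_by(1)[of a q] by (auto simp: subset_iff)
  with a show "inv a \<in> centralizer G Q"
    by (simp add: mem_centralizer_iff assms)
next
  fix a b assume "a \<in> centralizer G Q" "b \<in> centralizer G Q"
  then have a: "a \<in> carrier G" "\<forall>q\<in>Q. conj_by G a q = q"
    and b: "b \<in> carrier G" "\<forall>q\<in>Q. conj_by G b q = q"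
    by (simp_all add: mem_centralizer_iff assms)
  have "conj_by G (a \<otimes> b) q = q" if "q \<in> Q" for q
    using a b that assms conj_by_conj_by[of a b q] by (auto simp: subset_iff)
  with a b show "a \<otimes> b \<in> centralizer G Q"
    by (simp add: mem_centralizer_iff assms)
qed

lemma conj_by_centralizer:
  assumes "Q \<subseteq> carrier G" "n \<in> normalizer G Q" "c \<in> centralizer G Q"
  shows "conj_by G n c \<in> centralizer G Q"
proof -
  have n: "n \<in> carrier G" and c: "c \<in> carrier G" "\<And>q. q \<in> Q \<Longrightarrow> conj_by G c q = q"
    using assms by (auto simp: mem_normalizer_iff mem_centralizer_iff)
  have "conj_by G (conj_by G n c) q = q" if "q \<in> Q" for q
  proof -
    from that obtain q' where q': "q' \<in> Q" "q = conj_by G n q'"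
      using assms by (auto simp: mem_normalizer_iff)
    have "q' \<in> carrier G" using assms q' by auto
    have "conj_by G n c \<otimes> n = n \<otimes> c"
      using n c by (simp add: conj_by_def m_assoc)
    then show ?thesis
      using q' n c \<open>q' \<in> carrier G\<close> by (simp add: conj_by_conj_by) (metis conj_by_conj_by)
  qed
  then show ?thesis
    using assms n c by (simp add: mem_centralizer_iff)
qed

end

text \<open>Actions are homomorphisms into \<open>BijGroup E\<close>, whose members are extensional
  maps; hence the \<open>restrict\<close>. Each map is bijective because the inverse group element
  undoes it.\<close>

lemma group_actionI:
  assumes "group G"
    and cl: "\<And>g x. g \<in> carrier G \<Longrightarrow> x \<in> E \<Longrightarrow> f g x \<in> E"
    and one: "\<And>x. x \<in> E \<Longrightarrow> f \<one>\<^bsub>G\<^esub> x = x"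
    and mult: "\<And>g h x. g \<in> carrier G \<Longrightarrow> h \<in> carrier G \<Longrightarrow> x \<in> E \<Longrightarrow> f (g \<otimes>\<^bsub>G\<^esub> h) x = f g (f h x)"
  shows "group_action G E (\<lambda>g. restrict (f g) E)"
proof -
  interpret group G by fact
  have bij: "restrict (f g) E \<in> Bij E" if g: "g \<in> carrier G" for g
  proof -
    have "bij_betw (f g) E E"
    proof (rule bij_betw_byWitness[where f' = "f (inv\<^bsub>G\<^esub> g)"])
      show "\<forall>a\<in>E. f (inv\<^bsub>G\<^esub> g) (f g a) = a" "\<forall>a\<in>E. f g (f (inv\<^bsub>G\<^esub> g) a) = a"
        using g mult[of "inv\<^bsub>G\<^esub> g" g] mult[of g "inv\<^bsub>G\<^esub> g"] one by auto
    qed (use g cl in auto)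
    then show ?thesis by (simp add: Bij_def)
  qed
  show ?thesis
    unfolding group_action_def group_hom_def group_hom_axioms_def
  proof (intro conjI)
    show "(\<lambda>g. restrict (f g) E) \<in> hom G (BijGroup E)"
      using bij cl by (auto simp: hom_def BijGroup_def compose_def mult intro!: restrict_ext)
  qed (use group_BijGroup is_group in auto)
qed

text \<open>An orbit that does not consist of fixed points has a positive power of \<open>p\<close>
  as its size, by the orbit-stabilizer theorem.\<close>

lemma (in group_action) p_group_fixed_points:
  assumes "prime p" "order G = p ^ n" "finite E"
  shows "[card E = card {x \<in> E. \<forall>g\<in>carrier G. \<phi> g x = x}] (mod p)"
proof -
  let ?F = "{x \<in> E. \<forall>g\<in>carrier G. \<phi> g x = x}"
  let ?C = "{orb \<in> orbits G E \<phi>. \<not> orb \<subseteq> ?F}"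
  interpret G: group G using group_hom group_hom.axioms(1) by auto
  have un: "\<Union>?C = E - ?F"
  proof
    show "\<Union>?C \<subseteq> E - ?F"
    proof
      fix x assume "x \<in> \<Union>?C"
      then obtain y where y: "y \<in> E" "x \<in> orbit G \<phi> y" "\<not> orbit G \<phi> y \<subseteq> ?F"
        by (auto simp: orbits_def)
      have xE: "x \<in> E" using y element_image by (auto simp: orbit_def)
      moreover have "x \<notin> ?F"
      proof
        assume x: "x \<in> ?F"
        have "y \<in> orbit G \<phi> x" using orbit_sym y xE by blast
        then have "y = x" using x by (auto simp: orbit_def)
        have "orbit G \<phi> y \<subseteq> {x}"
          using x \<open>y = x\<close> by (auto simp: orbit_def)
        with y x show False by blast
      qed
      ultimately show "x \<in> E - ?F" by blast
    qed
    show "E - ?F \<subseteq> \<Union>?C"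
    proof
      fix x assume "x \<in> E - ?F"
      then have "x \<in> orbit G \<phi> x" "x \<in> E" "x \<notin> ?F" by (auto simp: orbit_refl)
      then show "x \<in> \<Union>?C" by (auto simp: orbits_def)
    qed
  qed
  have "p dvd card (\<Union>?C)"
  proof (rule dvd_partition)
    show "finite (\<Union>?C)" using un assms by simp
    show "\<forall>c1\<in>?C. \<forall>c2\<in>?C. c1 \<noteq> c2 \<longrightarrow> c1 \<inter> c2 = {}"
      using disjoint_union by blast
    show "\<forall>c\<in>?C. p dvd card c"
    proof
      fix c assume "c \<in> ?C"
      then obtain x where x: "x \<in> E" "c = orbit G \<phi> x" "\<not> c \<subseteq> ?F"
        by (auto simp: orbits_def)
      have "card c dvd p ^ n"
        using orbit_stabilizer_theorem[OF x(1)] assms x by (metis dvd_triv_left)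
      then obtain k where k: "card c = p ^ k"
        using assms(1) divides_primepow_nat by blast
      have "card c \<noteq> 1"
      proof
        assume "card c = 1"
        then have "c = {x}"
          using orbit_refl[OF x(1)] x(2) by (metis card_1_singletonE singletonD)
        then have "\<phi> g x = x" if "g \<in> carrier G" for g
          using x that by (auto simp: orbit_def)
        with x(1,3) \<open>c = {x}\<close> show False by simp
      qed
      with k have "k \<noteq> 0" by (metis power_0)
      with k show "p dvd card c" by simp
    qed
  qed
  moreover have "card E = card ?F + card (E - ?F)"
    using assms(3) by (metis (no_types, lifting) card_Diff_subset card_mono finite_subset le_add_diff_inverse mem_Collect_eq subsetI)
  ultimately show ?thesis
    using un by (simp add: cong_add_lcancel_0_nat cong_0_iff)
qed

section \<open>Fixed-point counting in finite groups: conjugation, growing normalizers,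
  centres\<close>

context group
begin

text \<open>\<open>P\<close> acts on the right cosets of \<open>S\<close>; the inverse turns right
  multiplication into a left action. For \<open>S\<close> of index prime to \<open>p\<close> the
  count gives conjugation into \<open>S\<close>; for \<open>P = S\<close> it makes normalizers
  grow.\<close>

lemma card_rcosets_cong_fixed:
  assumes fin: "finite (carrier G)" and p: "prime p"
    and S: "subgroup S G" and P: "p_subgroup p G P"
  shows "[card (rcosets S) = card {R \<in> rcosets S. \<forall>g\<in>P. R #> inv g = R}] (mod p)"
proof -
  interpret S: subgroup S G by fact
  obtain n where "subgroup P G" and n: "card P = p ^ n"
    using P by (auto simp: p_subgroup_def)
  interpret P: subgroup P G by fact
  let ?P = "G\<lparr>carrier := P\<rparr>"
  let ?f = "\<lambda>g R. R #> inv g"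
  have cl: "R \<subseteq> carrier G" if "R \<in> rcosets S" for R
    using S.rcosets_carrier[OF is_group that] .
  have "group_action ?P (rcosets S) (\<lambda>g. restrict (?f g) (rcosets S))"
  proof (rule group_actionI)
    show "group ?P" using P.subgroup_is_group is_group .
  next
    fix g R assume "g \<in> carrier ?P" "R \<in> rcosets S"
    then show "R #> inv g \<in> rcosets S"
      by (auto simp: RCOSETS_def coset_mult_assoc S.subset)
  next
    fix R assume "R \<in> rcosets S"
    then show "R #> inv \<one>\<^bsub>?P\<^esub> = R" using cl by simp
  next
    fix g h R assume "g \<in> carrier ?P" "h \<in> carrier ?P" "R \<in> rcosets S"
    then show "R #> inv (g \<otimes>\<^bsub>?P\<^esub> h) = R #> inv h #> inv g"
      using cl[of R] by (simp add: coset_mult_assoc inv_mult_group)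
  qed
  then interpret A: group_action ?P "rcosets S" "\<lambda>g. restrict (?f g) (rcosets S)" .
  have "finite (rcosets S)"
    using fin by (simp add: RCOSETS_def)
  then have "[card (rcosets S) = card {R \<in> rcosets S. \<forall>g\<in>carrier ?P. restrict (?f g) (rcosets S) R = R}] (mod p)"
    using A.p_group_fixed_points[OF p, of n] n by (simp add: order_def)
  moreover have "{R \<in> rcosets S. \<forall>g\<in>carrier ?P. restrict (?f g) (rcosets S) R = R}
      = {R \<in> rcosets S. \<forall>g\<in>P. R #> inv g = R}"
    by auto
  ultimately show ?thesis by simp
qed

lemma conj_by_mem_of_fixed_rcoset:
  assumes S: "subgroup S G" and "subgroup P G" and h: "h \<in> carrier G"
    and fixed: "\<forall>g\<in>P. S #> h #> inv g = S #> h" and "g \<in> P"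
  shows "conj_by G h g \<in> S"
proof -
  interpret S: subgroup S G by fact
  interpret P: subgroup P G by fact
  have "S #> h #> g = S #> h"
    using bspec[OF fixed P.m_inv_closed] \<open>g \<in> P\<close> by simp
  then have "S #> (h \<otimes> g) = S #> h"
    using \<open>g \<in> P\<close> h by (simp add: coset_mult_assoc S.subset)
  then have "h \<otimes> g \<in> S #> h"
    using \<open>g \<in> P\<close> h by (metis P.mem_carrier S m_closed rcos_self)
  then show ?thesis
    using S.rcos_module[OF is_group h(1), of "h \<otimes> g"] \<open>g \<in> P\<close> h by (simp add: conj_by_def)
qed

lemma p_subgroup_conj_into:
  assumes fin: "finite (carrier G)" and p: "prime p"
    and S: "subgroup S G" "\<not> p dvd card (rcosets S)"
    and P: "p_subgroup p G P"
  obtains g where "g \<in> carrier G" "conj_by G g ` P \<subseteq> S"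
proof -
  have sub: "subgroup P G" using P by (simp add: p_subgroup_def)
  let ?F = "{R \<in> rcosets S. \<forall>g\<in>P. R #> inv g = R}"
  have "card ?F \<noteq> 0"
    using card_rcosets_cong_fixed[OF fin p S(1) P] S(2) by (metis cong_dvd_iff dvd_0_right)
  then have "?F \<noteq> {}" by (metis card.empty)
  then obtain h where h: "h \<in> carrier G" "\<forall>g\<in>P. S #> h #> inv g = S #> h"
    by (auto simp: RCOSETS_def)
  then have "conj_by G h ` P \<subseteq> S"
    using conj_by_mem_of_fixed_rcoset[OF S(1) sub h] by blast
  with h show ?thesis using that by blast
qed

lemma card_subgroup_dvd:
  assumes "subgroup P G" "subgroup H G" "H \<subseteq> P"
  shows "card H dvd card P"
proof -
  interpret P: group "G\<lparr>carrier := P\<rparr>"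
    using assms subgroup_imp_group by blast
  have "subgroup H (G\<lparr>carrier := P\<rparr>)"
    using assms subgroup_incl by blast
  then show ?thesis
    using P.lagrange[of H] dvd_triv_right[of "card H" "card (rcosets\<^bsub>G\<lparr>carrier := P\<rparr>\<^esub> H)"]
    by (simp add: order_def)
qed

lemma subgroup_pow_card:
  assumes "subgroup H G" "h \<in> H"
  shows "h [^] card H = \<one>"
proof -
  interpret H: group "G\<lparr>carrier := H\<rparr>" by (rule subgroup_imp_group[OF assms(1)])
  show ?thesis using H.pow_order_eq_1[of h] assms(2) by (simp add: order_def nat_pow_consistent[symmetric])
qed

lemma p_subgroup_subset:
  assumes "prime p" "p_subgroup p G P" "subgroup H G" "H \<subseteq> P"
  shows "p_subgroup p G H"
proof -
  obtain n where P: "subgroup P G" "card P = p ^ n"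
    using assms by (auto simp: p_subgroup_def)
  then have "card H dvd p ^ n"
    using card_subgroup_dvd assms by metis
  then show ?thesis
    using assms divides_primepow_nat by (auto simp: p_subgroup_def)
qed

text \<open>\<open>T\<close> acts on its cosets in \<open>P\<close>, whose number is a multiple of
  \<open>p\<close>. The coset \<open>T\<close> is fixed, hence so is another coset
  \<open>T h\<close>, and then \<open>h\<close> normalises \<open>T\<close>.\<close>

lemma normalizers_grow:
  assumes fin: "finite (carrier G)" and p: "prime p"
    and P: "p_subgroup p G P" and T: "subgroup T G" "T \<subset> P"
  obtains g where "g \<in> P - T" "g \<in> normalizer G T"
proof -
  obtain n where subP: "subgroup P G" and n: "card P = p ^ n"
    using P by (auto simp: p_subgroup_def)
  interpret P: subgroup P G by fact
  interpret T: subgroup T G by fact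
  let ?P = "G\<lparr>carrier := P\<rparr>"
  interpret GP: group ?P
    using P.subgroup_is_group is_group .
  have finP: "finite P" using fin P.subset finite_subset by blast
  have TP: "subgroup T ?P"
    using T subP subgroup_incl by blast
  have pT: "p_subgroup p ?P T"
    using p_subgroup_subset[OF p P T(1)] T TP by (auto simp: p_subgroup_def)
  let ?F = "{R \<in> rcosets\<^bsub>?P\<^esub> T. \<forall>g\<in>T. R #>\<^bsub>?P\<^esub> inv\<^bsub>?P\<^esub> g = R}"
  have cong: "[card (rcosets\<^bsub>?P\<^esub> T) = card ?F] (mod p)"
    by (rule GP.card_rcosets_cong_fixed[OF _ p TP pT]) (simp add: finP)
  have "card (rcosets\<^bsub>?P\<^esub> T) * card T = p ^ n"
    using GP.lagrange[OF TP] n by (simp add: order_def)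
  moreover have "card T < card P"
    using T finP psubset_card_mono by blast
  ultimately have "card (rcosets\<^bsub>?P\<^esub> T) \<noteq> 1" "card (rcosets\<^bsub>?P\<^esub> T) dvd p ^ n"
    using n dvd_triv_left[of "card (rcosets\<^bsub>?P\<^esub> T)" "card T"] by auto
  then have "p dvd card (rcosets\<^bsub>?P\<^esub> T)"
    using p divides_primepow_nat by (metis dvd_power neq0_conv power_0)
  with cong have dvd: "p dvd card ?F"
    using cong_dvd_iff by blast
  have TF: "T \<in> ?F"
    using subgroup.subgroup_in_rcosets[OF TP GP.is_group] subgroup.m_inv_closed[OF TP] subgroup.mem_carrier[OF TP]
      GP.coset_join2[OF _ TP] by blast
  have "?F \<noteq> {T}"
    using dvd p by (metis is_singletonI is_singleton_altdef not_prime_unit nat_dvd_1_iff_1 prime_nat_iff)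
  then obtain R where R: "R \<in> ?F" "R \<noteq> T" using TF by blast
  then obtain h where h: "h \<in> P" "R = T #>\<^bsub>?P\<^esub> h"
    by (auto simp: RCOSETS_def)
  have "h \<notin> T"
    using R h GP.coset_join2[OF _ TP, of h] by auto
  have "conj_by ?P h g \<in> T" if "g \<in> T" for g
    using GP.conj_by_mem_of_fixed_rcoset[OF TP TP, of h g] h R that by auto
  moreover have "conj_by ?P h g = conj_by G h g" if "g \<in> T" for g
    using that h subP by (simp add: conj_by_def m_inv_consistent)
  ultimately have "h \<in> normalizer G T"
    using h T finP finite_subset by (subst mem_normalizer_finite_iff) (auto simp: T.subset)
  with h \<open>h \<notin> T\<close> show ?thesis using that by blast
qed

text \<open>Under conjugation the fixed points are the central elements; their number is a multiple
  of \<open>p\<close>, and \<open>1\<close> is among them.\<close>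

lemma p_group_center_nontrivial:
  assumes p: "prime p" and "order G = p ^ n" "carrier G \<noteq> {\<one>}"
  obtains z where "z \<in> carrier G" "z \<noteq> \<one>" "\<And>g. g \<in> carrier G \<Longrightarrow> g \<otimes> z = z \<otimes> g"
proof -
  have "order G \<noteq> 0" using assms by (metis not_prime_0 power_not_zero)
  then have fin: "finite (carrier G)" by (simp add: order_def card_ge_0_finite)
  interpret A: group_action G "carrier G" "\<lambda>g. restrict (conj_by G g) (carrier G)"
    by (rule group_actionI) (auto simp: is_group conj_by_conj_by)
  let ?F = "{x \<in> carrier G. \<forall>g\<in>carrier G. restrict (conj_by G g) (carrier G) x = x}"
  have "[card (carrier G) = card ?F] (mod p)"
    by (rule A.p_group_fixed_points) (use assms fin in auto)
  moreover have "order G \<noteq> 1"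
    using assms(3) order_one_triv_iff by blast
  then have "p dvd card (carrier G)"
    using assms by (metis dvd_power neq0_conv order_def power_0)
  ultimately have dvd: "p dvd card ?F"
    using cong_dvd_iff by blast
  have "\<one> \<in> ?F" by simp
  moreover have "?F \<noteq> {\<one>}"
    using dvd p by (metis is_singletonI is_singleton_altdef not_prime_unit nat_dvd_1_iff_1 prime_nat_iff)
  ultimately obtain z where z: "z \<in> ?F" "z \<noteq> \<one>" by blast
  then have "g \<otimes> z = z \<otimes> g" if "g \<in> carrier G" for g
    using that by (auto simp: conj_by_eq_iff)
  with z show ?thesis using that[of z] by blast
qed

end

text \<open>Relative to a subgroup \<open>N\<close>, yet phrased inside \<open>G\<close>, so that
  conjugation and normalizers are always those of \<open>G\<close>.\<close>

definition sylow_subgroup :: "nat \<Rightarrow> ('a, 'b) monoid_scheme \<Rightarrow> 'a set \<Rightarrow> 'a set \<Rightarrow> bool" where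
  "sylow_subgroup p G N S \<longleftrightarrow> p_subgroup p G S \<and> S \<subseteq> N \<and> \<not> p dvd card N div card S"

section \<open>Sylow subgroups of a subgroup and the Frattini argument\<close>

locale finite_group_prime = group G for G (structure) +
  fixes p :: nat
  assumes finite_carrier: "finite (carrier G)" and prime_p: "prime p"
begin

lemma finite_subgroup: "subgroup H G \<Longrightarrow> finite H"
  using finite_carrier finite_subset subgroup.subset by blast

lemma card_subgroup_pos: "subgroup H G \<Longrightarrow> 0 < card H"
  using finite_subgroup subgroup.one_closed by (fastforce simp: card_gt_0_iff)

lemma mem_normalizer_subgroup_iff:
  "subgroup H G \<Longrightarrow> x \<in> normalizer G H \<longleftrightarrow> x \<in> carrier G \<and> (\<forall>h\<in>H. conj_by G x h \<in> H)"
  by (rule mem_normalizer_finite_iff) (auto simp: finite_subgroup subgroup.subset)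

lemma sylow_subgroup_exists:
  assumes N: "subgroup N G"
  obtains S where "sylow_subgroup p G N S"
proof -
  interpret N: group "G\<lparr>carrier := N\<rparr>"
    using N subgroup_imp_group by blast
  have "card N \<noteq> 0"
    using card_subgroup_pos[OF N] by simp
  then obtain n m where nm: "card N = p ^ n * m" "\<not> p dvd m"
    using prime_p by (metis multiplicity_decompose' not_prime_unit)
  have "\<exists>S. subgroup S (G\<lparr>carrier := N\<rparr>) \<and> card S = p ^ n"
    by (rule sylow_thm[of p _ n m]) (use nm prime_p N finite_subgroup N.is_group in \<open>auto simp: order_def\<close>)
  then obtain S where S: "subgroup S (G\<lparr>carrier := N\<rparr>)" "card S = p ^ n" by blast
  then have "subgroup S G" "S \<subseteq> N"
    using N incl_subgroup subgroup.subset by fastforce+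
  moreover have "card N div card S = m"
    using nm S prime_p by (simp add: prime_gt_0_nat)
  ultimately have "sylow_subgroup p G N S"
    using S nm by (auto simp: sylow_subgroup_def p_subgroup_def)
  then show ?thesis using that by blast
qed

lemma sylow_subgroup_conj_into:
  assumes N: "subgroup N G" and S: "sylow_subgroup p G N S" and P: "p_subgroup p G P" "P \<subseteq> N"
  obtains g where "g \<in> N" "conj_by G g ` P \<subseteq> S"
proof -
  let ?N = "G\<lparr>carrier := N\<rparr>"
  interpret N: group ?N
    using N subgroup_imp_group by blast
  have SN: "subgroup S ?N"
    using S N subgroup_incl by (auto simp: sylow_subgroup_def p_subgroup_def)
  have "0 < card S"
    using S card_subgroup_pos by (auto simp: sylow_subgroup_def p_subgroup_def)
  moreover have "card N = card (rcosets\<^bsub>?N\<^esub> S) * card S"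
    using N.lagrange[OF SN] by (simp add: order_def)
  ultimately have "card (rcosets\<^bsub>?N\<^esub> S) = card N div card S"
    by simp
  moreover have "p_subgroup p ?N P"
    using P N subgroup_incl by (auto simp: p_subgroup_def)
  ultimately obtain g where g: "g \<in> N" "conj_by ?N g ` P \<subseteq> S"
    using N.p_subgroup_conj_into[OF _ prime_p SN] S finite_subgroup[OF N] by (auto simp: sylow_subgroup_def)
  moreover have "conj_by ?N g h = conj_by G g h" if "h \<in> P" for h
    using g N by (simp add: conj_by_def m_inv_consistent)
  ultimately show ?thesis using that[of g] by (metis image_cong)
qed

lemma conj_by_p_subgroup:
  "x \<in> carrier G \<Longrightarrow> p_subgroup p G P \<Longrightarrow> p_subgroup p G (conj_by G x ` P)"
  by (simp add: p_subgroup_def subgroup_conj_by_image card_conj_by_image subgroup.subset)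

lemma p_subgroup_subset_sylow:
  assumes N: "subgroup N G" and P: "p_subgroup p G P" "P \<subseteq> N"
  obtains S where "sylow_subgroup p G N S" "P \<subseteq> S"
proof -
  obtain S where S: "sylow_subgroup p G N S"
    using sylow_subgroup_exists[OF N] .
  obtain g where g: "g \<in> N" "conj_by G g ` P \<subseteq> S"
    using sylow_subgroup_conj_into[OF N S P] .
  have gG: "g \<in> carrier G" and ig: "inv g \<in> N" "inv g \<in> carrier G"
    using g N subgroup.mem_carrier subgroup.m_inv_closed by fastforce+
  have SG: "p_subgroup p G S" "S \<subseteq> carrier G" "S \<subseteq> N"
    using S by (auto simp: sylow_subgroup_def p_subgroup_def subgroup.mem_carrier)
  let ?T = "conj_by G (inv g) ` S"
  have "sylow_subgroup p G N ?T"
    unfolding sylow_subgroup_def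
  proof (intro conjI)
    show "p_subgroup p G ?T" using conj_by_p_subgroup SG ig by blast
    show "?T \<subseteq> N"
      using SG ig N subgroup_conj_closed by blast
    show "\<not> p dvd card N div card ?T"
      using S SG ig by (simp add: card_conj_by_image sylow_subgroup_def)
  qed
  moreover have "P \<subseteq> ?T"
  proof
    fix x assume x: "x \<in> P"
    then have "x \<in> carrier G" using P by (meson p_subgroup_def subgroup.mem_carrier)
    then have "x = conj_by G (inv g) (conj_by G g x)" using gG by simp
    then show "x \<in> ?T" using g x by blast
  qed
  ultimately show ?thesis using that by blast
qed

lemma sylow_subgroup_maximal:
  assumes N: "subgroup N G" and S: "sylow_subgroup p G N S"
    and P: "p_subgroup p G P" "P \<subseteq> N" "S \<subseteq> P"
  shows "P = S"
proof -
  obtain g where g: "g \<in> N" "conj_by G g ` P \<subseteq> S"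
    using sylow_subgroup_conj_into[OF N S P(1,2)] .
  have "g \<in> carrier G" using g N subgroup.mem_carrier by fastforce
  have "finite S" "finite P"
    using S P finite_subgroup by (auto simp: sylow_subgroup_def p_subgroup_def)
  then have "card P \<le> card S"
    using g card_mono card_conj_by_image[OF \<open>g \<in> carrier G\<close>, of P] P
    by (metis p_subgroup_def subgroup.subset)
  then show ?thesis using P \<open>finite P\<close> by (metis card_seteq)
qed

text \<open>Conjugating \<open>S\<close> by \<open>x\<close> gives another \<open>p\<close>-subgroup
  of \<open>N\<close>, and some \<open>n\<close> in \<open>N\<close> carries it back into
  \<open>S\<close>. This is the device for correcting an element within its coset of
  \<open>N\<close>.\<close>

lemma frattini_argument:
  assumes N: "subgroup N G" and S: "sylow_subgroup p G N S" and x: "x \<in> normalizer G N"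
  obtains n where "n \<in> N" "n \<otimes> x \<in> normalizer G S"
proof -
  have xG: "x \<in> carrier G" using x normalizer_subset_carrier by blast
  have SG: "p_subgroup p G S" "subgroup S G" "S \<subseteq> N"
    using S by (auto simp: sylow_subgroup_def p_subgroup_def)
  have "conj_by G x ` S \<subseteq> N"
    using SG mem_normalizerD(2)[OF N x] by blast
  then obtain n where n: "n \<in> N" "conj_by G n ` conj_by G x ` S \<subseteq> S"
    using sylow_subgroup_conj_into[OF N S conj_by_p_subgroup[OF xG SG(1)]] by blast
  have nG: "n \<in> carrier G" using n N subgroup.mem_carrier by fastforce
  have "conj_by G (n \<otimes> x) s \<in> S" if "s \<in> S" for s
  proof -
    have "s \<in> carrier G" using SG that subgroup.mem_carrier by fastforce
    then show ?thesis using n that nG xG by (simp add: conj_by_conj_by[symmetric] image_subset_iff)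
  qed
  then have "n \<otimes> x \<in> normalizer G S"
    using SG nG xG by (simp add: mem_normalizer_subgroup_iff)
  with n show ?thesis using that by blast
qed

lemma normal_p_subgroup_subset_sylow:
  assumes N: "subgroup N G" and S: "sylow_subgroup p G N S"
    and P: "p_subgroup p G P" "P \<subseteq> N" "N \<subseteq> normalizer G P"
  shows "P \<subseteq> S"
proof -
  obtain g where g: "g \<in> N" "conj_by G g ` P \<subseteq> S"
    using sylow_subgroup_conj_into[OF N S P(1,2)] .
  have "conj_by G g ` P = P"
    using g P by (metis mem_normalizer_iff p_subgroup_def subgroup.subset subsetD)
  with g show ?thesis by simp
qed

text \<open>A Sylow subgroup of the normalizer of \<open>P\<close> that contains \<open>J\<close>
  also contains the normal \<open>p\<close>-subgroup \<open>P\<close>; it stands in for the product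
  \<open>PJ\<close>.\<close>

lemma p_subgroup_join:
  assumes "p_subgroup p G P" "p_subgroup p G J" "J \<subseteq> normalizer G P"
  obtains T where "p_subgroup p G T" "P \<subseteq> T" "J \<subseteq> T" "T \<subseteq> normalizer G P"
proof -
  have P: "subgroup P G" using assms by (simp add: p_subgroup_def)
  obtain S where S: "sylow_subgroup p G (normalizer G P) S" "J \<subseteq> S"
    using p_subgroup_subset_sylow[OF subgroup_normalizer[OF P] assms(2,3)] .
  have "P \<subseteq> S"
    by (rule normal_p_subgroup_subset_sylow[OF subgroup_normalizer[OF P] S(1) assms(1)])
      (auto simp: subgroup_subset_normalizer[OF P, THEN subsetD])
  with S show ?thesis using that by (auto simp: sylow_subgroup_def)
qed

end

section \<open>The Baer--Suzuki theorem\<close>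

context finite_group_prime
begin

text \<open>Let \<open>T\<close> be the part of \<open>P\<close> normalising
  \<open>generate G D\<close>. If \<open>T\<close> met \<open>Cl\<close> only in \<open>D\<close>,
  an element of \<open>P\<close> outside \<open>T\<close> that normalises \<open>T\<close> would
  preserve \<open>D\<close>, hence normalise \<open>generate G D\<close> and lie in
  \<open>T\<close>.\<close>

lemma conj_closed_set_normalizer_grows:
  assumes Cl: "Cl \<subseteq> carrier G" "\<And>g c. g \<in> carrier G \<Longrightarrow> c \<in> Cl \<Longrightarrow> conj_by G g c \<in> Cl"
    and P: "p_subgroup p G P" and D: "D \<subset> P \<inter> Cl"
  obtains c where "c \<in> P \<inter> Cl - D" "c \<in> normalizer G (generate G D)"
proof -
  have subP: "subgroup P G" using P by (simp add: p_subgroup_def)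
  have DG: "D \<subseteq> carrier G" using Cl D by blast
  have subD: "subgroup (generate G D) G" using generate_is_subgroup[OF DG] .
  define T where "T = P \<inter> normalizer G (generate G D)"
  have subT: "subgroup T G"
    unfolding T_def by (rule subgroups_Inter_pair[OF subP subgroup_normalizer[OF subD]])
  have DT: "D \<subseteq> T"
    using D subgroup_subset_normalizer[OF subD] generate.incl[of _ D G] by (auto simp: T_def)
  show ?thesis
  proof (cases "T \<inter> Cl \<subseteq> D")
    case False
    then show ?thesis using that by (auto simp: T_def)
  next
    case True
    with DT D have "T \<subset> P" by (auto simp: T_def)
    then obtain g where g: "g \<in> P - T" "g \<in> normalizer G T"
      using normalizers_grow[OF finite_carrier prime_p P subT] by blast
    have gG: "g \<in> carrier G" using g normalizer_subset_carrier by blast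
    have "conj_by G g ` D \<subseteq> D"
      using True DT D gG Cl(2) mem_normalizerD(2)[OF subT g(2)] by blast
    then have "conj_by G g ` generate G D \<subseteq> generate G D"
      by (simp add: conj_by_generate[OF gG DG] mono_generate)
    then have "g \<in> normalizer G (generate G D)"
      using gG subD by (auto simp: mem_normalizer_subgroup_iff)
    with g show ?thesis by (auto simp: T_def)
  qed
qed

text \<open>The argument of Alperin and Lyons: among the Sylow subgroups \<open>P\<close>, \<open>P'\<close> with different traces on
  the class \<open>Cl\<close>, take a pair whose traces have the largest intersection \<open>D\<close>. Normalizers grow, so each
  trace contains a further element normalising \<open>generate G D\<close>, and the \<open>p\<close>-group generated by these two
  elements and \<open>D\<close> links \<open>P\<close> to \<open>P'\<close>.\<close>

theorem baer_suzuki: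
  assumes Cl: "Cl \<subseteq> carrier G" "\<And>g c. g \<in> carrier G \<Longrightarrow> c \<in> Cl \<Longrightarrow> conj_by G g c \<in> Cl"
    and pairs: "\<And>a b. a \<in> Cl \<Longrightarrow> b \<in> Cl \<Longrightarrow> p_subgroup p G (generate G {a, b})"
  shows "p_subgroup p G (generate G Cl)"
proof (rule ccontr)
  assume neg: "\<not> p_subgroup p G (generate G Cl)"
  let ?syl = "sylow_subgroup p G (carrier G)"
  have sylD: "p_subgroup p G P" "subgroup P G" "P \<subseteq> carrier G" if "?syl P" for P
    using that by (auto simp: sylow_subgroup_def p_subgroup_def)
  have fin: "finite (P \<inter> Cl)" for P
    using finite_subset[OF Cl(1) finite_carrier] by blast
  \<comment> \<open>By symmetry all traces have the same size, so two different ones both contain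
    their intersection properly.\<close>
  have card_le: "card (P \<inter> Cl) \<le> card (P' \<inter> Cl)" if syl: "?syl P" "?syl P'" for P P'
  proof -
    obtain g where g: "g \<in> carrier G" "conj_by G g ` P \<subseteq> P'"
      using sylow_subgroup_conj_into[OF subgroup_self syl(2) sylD(1)[OF syl(1)] sylD(3)[OF syl(1)]] .
    then have "conj_by G g ` (P \<inter> Cl) \<subseteq> P' \<inter> Cl"
      using Cl by blast
    then show ?thesis
      using card_mono[OF fin] card_conj_by_image[OF g(1), of "P \<inter> Cl"] Cl by (metis le_infI2)
  qed
  define Q where "Q = (\<lambda>(P, P'). ?syl P \<and> ?syl P' \<and> P \<inter> Cl \<noteq> P' \<inter> Cl)"
  \<comment> \<open>If all traces agreed, a single Sylow subgroup would contain \<open>Cl\<close>,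
    since each element of \<open>Cl\<close> lies in some Sylow subgroup.\<close>
  have ex: "\<exists>z. Q z"
  proof (rule ccontr)
    assume "\<not> ?thesis"
    then have no: "\<not> Q (P, P')" for P P' by blast
    have all: "P \<inter> Cl = P' \<inter> Cl" if "?syl P" "?syl P'" for P P'
      using that no[of P P'] by (simp add: Q_def)
    obtain P where P: "?syl P" using sylow_subgroup_exists[OF subgroup_self] .
    have "Cl \<subseteq> P"
    proof
      fix c assume c: "c \<in> Cl"
      then have "p_subgroup p G (generate G {c, c})" by (intro pairs)
      moreover from this have "generate G {c, c} \<subseteq> carrier G"
        by (simp add: p_subgroup_def subgroup.subset)
      ultimately obtain S where S: "?syl S" "generate G {c, c} \<subseteq> S"
        using p_subgroup_subset_sylow[OF subgroup_self] by blast
      then have "c \<in> S \<inter> Cl" using c generate.incl[of c "{c, c}" G] by auto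
      with all[OF S(1) P] show "c \<in> P" by blast
    qed
    then have "p_subgroup p G (generate G Cl)"
      using p_subgroup_subset[OF prime_p sylD(1)[OF P]] generate_is_subgroup[OF Cl(1)]
        generate_subgroup_incl sylD(2)[OF P] by blast
    with neg show False by simp
  qed
  let ?f = "\<lambda>(P, P'). card (P \<inter> P' \<inter> Cl)"
  have "\<exists>z. Q z \<and> (\<forall>w. Q w \<longrightarrow> ?f w \<le> ?f z)"
  proof (rule ex_has_greatest_nat)
    show "Q (SOME z. Q z)" using ex by (rule someI_ex)
    show "\<forall>w. Q w \<longrightarrow> ?f w < Suc (card Cl)"
      using card_mono[OF finite_subset[OF Cl(1) finite_carrier]] by (auto simp: less_Suc_eq_le)
  qed
  then obtain w where w: "Q w" "\<And>v. Q v \<Longrightarrow> ?f v \<le> ?f w" by blast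
  obtain P P' where ww: "w = (P, P')" by (cases w)
  have PP: "?syl P" "?syl P'" "P \<inter> Cl \<noteq> P' \<inter> Cl"
    using w(1) unfolding ww Q_def by blast+
  have max: "card (R \<inter> R' \<inter> Cl) \<le> card (P \<inter> P' \<inter> Cl)"
    if "?syl R" "?syl R'" "R \<inter> Cl \<noteq> R' \<inter> Cl" for R R'
    using w(2)[of "(R, R')"] that unfolding ww by (simp add: Q_def)
  define D where "D = P \<inter> P' \<inter> Cl"
  have D1: "D \<subset> P \<inter> Cl" and D2: "D \<subset> P' \<inter> Cl"
    using card_seteq[OF fin _ card_le[OF PP(2,1)]] card_seteq[OF fin _ card_le[OF PP(1,2)]] PP(3)
    by (auto simp: D_def)
  obtain c where c: "c \<in> P \<inter> Cl - D" "c \<in> normalizer G (generate G D)"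
    using conj_closed_set_normalizer_grows[OF Cl sylD(1)[OF PP(1)] D1] .
  obtain c' where c': "c' \<in> P' \<inter> Cl - D" "c' \<in> normalizer G (generate G D)"
    using conj_closed_set_normalizer_grows[OF Cl sylD(1)[OF PP(2)] D2] .
  have DG: "D \<subseteq> carrier G" using Cl D_def by blast
  have subD: "subgroup (generate G D) G" using generate_is_subgroup[OF DG] .
  have "generate G D \<subseteq> P"
    by (rule generate_subgroup_incl[OF _ sylD(2)[OF PP(1)]]) (auto simp: D_def)
  then have pD: "p_subgroup p G (generate G D)"
    using p_subgroup_subset[OF prime_p sylD(1)[OF PP(1)] subD] by blast
  have norm: "generate G {c, c'} \<subseteq> normalizer G (generate G D)"
    by (rule generate_subgroup_incl[OF _ subgroup_normalizer[OF subD]]) (use c c' in simp)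
  have "p_subgroup p G (generate G {c, c'})" using pairs c c' by blast
  from p_subgroup_join[OF pD this norm]
  obtain T where T: "p_subgroup p G T" "generate G D \<subseteq> T" "generate G {c, c'} \<subseteq> T" .
  have "T \<subseteq> carrier G" using T(1) by (simp add: p_subgroup_def subgroup.subset)
  from p_subgroup_subset_sylow[OF subgroup_self T(1) this]
  obtain R where R: "?syl R" "T \<subseteq> R" .
  have incl: "D \<subseteq> R" "c \<in> R" "c' \<in> R"
    using T R generate.incl[of _ D G] generate.incl[of c "{c, c'}" G] generate.incl[of c' "{c, c'}" G] by auto
  \<comment> \<open>\<open>P\<close> and \<open>R\<close> share \<open>D\<close> and also
    \<open>c\<close>, more than the maximum allows for different traces. The same argument with
    \<open>c'\<close> applies to \<open>P'\<close> and \<open>R\<close>.\<close>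
  have "P \<inter> Cl = R \<inter> Cl"
  proof (rule ccontr)
    assume "P \<inter> Cl \<noteq> R \<inter> Cl"
    then have "card (P \<inter> R \<inter> Cl) \<le> card D" using max[OF PP(1) R(1)] by (simp add: D_def)
    moreover have "insert c D \<subseteq> P \<inter> R \<inter> Cl" using incl c by (auto simp: D_def)
    then have "card (insert c D) \<le> card (P \<inter> R \<inter> Cl)"
      by (intro card_mono) (use fin in \<open>auto simp: Int_assoc\<close>)
    ultimately show False using c fin[of "P \<inter> P'"] by (auto simp: D_def)
  qed
  moreover have "P' \<inter> Cl = R \<inter> Cl"
  proof (rule ccontr)
    assume "P' \<inter> Cl \<noteq> R \<inter> Cl"
    then have "card (P' \<inter> R \<inter> Cl) \<le> card D" using max[OF PP(2) R(1)] by (simp add: D_def)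
    moreover have "insert c' D \<subseteq> P' \<inter> R \<inter> Cl" using incl c' by (auto simp: D_def)
    then have "card (insert c' D) \<le> card (P' \<inter> R \<inter> Cl)"
      by (intro card_mono) (use fin in \<open>auto simp: Int_assoc\<close>)
    ultimately show False using c' fin[of "P \<inter> P'"] by (auto simp: D_def)
  qed
  ultimately show False using PP(3) by simp
qed

text \<open>Cauchy's theorem: the library's Sylow theorem yields a subgroup for every prime power
  dividing the order, here with exponent 1.\<close>

lemma exists_prime_order_element:
  assumes N: "subgroup N G" and r: "prime r" "r dvd card N"
  obtains h where "h \<in> N" "h \<noteq> \<one>" "h [^] r = \<one>"
proof -
  interpret N: group "G\<lparr>carrier := N\<rparr>"
    using N subgroup_imp_group by blast
  obtain m where "card N = r ^ 1 * m" using r by auto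
  then have "\<exists>S. subgroup S (G\<lparr>carrier := N\<rparr>) \<and> card S = r ^ 1"
    by (intro sylow_thm[of r _ 1 m]) (use r N finite_subgroup N.is_group in \<open>auto simp: order_def\<close>)
  then obtain S where S: "subgroup S (G\<lparr>carrier := N\<rparr>)" "card S = r" by auto
  then have SG: "subgroup S G" "S \<subseteq> N"
    using N incl_subgroup subgroup.subset by fastforce+
  have "S \<noteq> {\<one>}" using S r by (auto simp: prime_gt_Suc_0_nat)
  then obtain h where h: "h \<in> S" "h \<noteq> \<one>" using SG subgroup.one_closed by blast
  have "h [^] r = \<one>" using subgroup_pow_card[OF SG(1) h(1)] S(2) by simp
  with h SG show ?thesis using that by blast
qed

lemma not_p_subgroup_obtains_p'_element:
  assumes N: "subgroup N G" and "\<not> p_subgroup p G N"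
  obtains h r where "h \<in> N" "h \<noteq> \<one>" "h [^] (r::nat) = \<one>" "coprime r p"
proof -
  have "\<exists>r. prime r \<and> r dvd card N \<and> r \<noteq> p"
  proof (rule ccontr)
    assume *: "\<not> ?thesis"
    obtain n m where nm: "card N = p ^ n * m" "\<not> p dvd m"
      using prime_p card_subgroup_pos[OF N] by (metis multiplicity_decompose' not_prime_unit neq0_conv)
    have "m = 1"
    proof (rule ccontr)
      assume "m \<noteq> 1"
      then obtain r where "prime r" "r dvd m" using prime_factor_nat by blast
      moreover from this have "r dvd card N" using nm by simp
      ultimately show False using nm * by blast
    qed
    with nm N assms(2) show False by (auto simp: p_subgroup_def)
  qed
  then obtain r where r: "prime r" "r dvd card N" "r \<noteq> p" by blast
  then show ?thesis
    using exists_prime_order_element[OF N r(1,2)] that primes_coprime prime_p by metis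
qed

text \<open>Every normal \<open>p\<close>-subgroup lies in every Sylow subgroup. This bound is what
  shows that elements of the generated subgroup \<open>p_core\<close> have \<open>p\<close>-power
  order.\<close>

lemma p_core_subset_sylow:
  assumes "sylow_subgroup p G (carrier G) S"
  shows "p_core p G \<subseteq> S"
proof -
  have "N \<subseteq> S" if "N \<lhd> G" "p_subgroup p G N" for N
  proof (rule normal_p_subgroup_subset_sylow[OF subgroup_self assms that(2)])
    show "N \<subseteq> carrier G" using that by (simp add: p_subgroup_def subgroup.subset)
    show "carrier G \<subseteq> normalizer G N"
      using normal_invE[OF that(1)] by (auto simp: mem_normalizer_subgroup_iff conj_by_def)
  qed
  then show ?thesis
    unfolding p_core_def
    by (intro generate_subgroup_incl) (use assms in \<open>auto simp: sylow_subgroup_def p_subgroup_def\<close>)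
qed

lemma mem_p_core_pow_eq_one:
  assumes "x \<in> p_core p G"
  obtains n where "x [^] (p ^ n) = \<one>"
proof -
  obtain S where S: "sylow_subgroup p G (carrier G) S"
    using sylow_subgroup_exists[OF subgroup_self] .
  then obtain n where n: "subgroup S G" "card S = p ^ n"
    by (auto simp: sylow_subgroup_def p_subgroup_def)
  have xS: "x \<in> S" using p_core_subset_sylow[OF S] assms by blast
  then show ?thesis using that[of n] subgroup_pow_card[OF n(1) xS] n(2) by simp
qed

text \<open>If any two conjugates of \<open>x\<close> generated a \<open>p\<close>-group, the
  Baer-Suzuki theorem would make the normal closure of \<open>x\<close> a normal
  \<open>p\<close>-subgroup, contained in the \<open>p\<close>-core.\<close>

lemma not_mem_p_core_obtains:
  assumes x: "x \<in> carrier G" "x \<notin> p_core p G"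
  obtains g g' h r where "g \<in> carrier G" "g' \<in> carrier G" "h \<in> generate G {conj_by G g x, conj_by G g' x}"
    "h \<noteq> \<one>" "h [^] (r::nat) = \<one>" "coprime r p"
proof -
  let ?Cl = "{conj_by G g x | g. g \<in> carrier G}"
  have Cl: "?Cl \<subseteq> carrier G" "\<And>g c. g \<in> carrier G \<Longrightarrow> c \<in> ?Cl \<Longrightarrow> conj_by G g c \<in> ?Cl"
    using x by (auto simp: conj_by_conj_by)
  have "\<not> p_subgroup p G (generate G ?Cl)"
  proof
    assume *: "p_subgroup p G (generate G ?Cl)"
    have "generate G ?Cl \<lhd> G"
      by (rule normal_generateI[OF Cl(1)]) (use Cl(2) in \<open>simp add: conj_by_def\<close>)
    moreover have "x \<in> ?Cl" using x by (auto intro!: exI[of _ \<one>])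
    then have "x \<in> generate G ?Cl" by (rule generate.incl)
    ultimately have "x \<in> p_core p G"
      using * unfolding p_core_def by (intro generate.incl) blast
    with x show False by simp
  qed
  then obtain a b where ab: "a \<in> ?Cl" "b \<in> ?Cl" "\<not> p_subgroup p G (generate G {a, b})"
    using baer_suzuki[OF Cl] by blast
  have "subgroup (generate G {a, b}) G"
    using ab Cl(1) by (intro generate_is_subgroup) blast
  from not_p_subgroup_obtains_p'_element[OF this ab(3)]
  obtain h and r :: nat where "h \<in> generate G {a, b}" "h \<noteq> \<one>" "h [^] r = \<one>" "coprime r p" .
  moreover obtain g g' where "a = conj_by G g x" "b = conj_by G g' x" "g \<in> carrier G" "g' \<in> carrier G"
    using ab by auto
  ultimately show ?thesis using that by blast
qed

end

section \<open>Square-zero pairs in a ring\<close>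

text \<open>The model is \<open>2 \<times> 2\<close> matrices over a field, with \<open>e\<close> strictly upper and \<open>f\<close> strictly lower
  triangular; \<open>z = ef + fe\<close> is then the scalar given by the product of their nonzero entries, and
  \<open>u\<close> is its inverse.\<close>

locale square_zero_pair = ring R for R (structure) +
  fixes e f z u
  assumes closed [simp]: "e \<in> carrier R" "f \<in> carrier R" "z \<in> carrier R" "u \<in> carrier R"
    and ee: "e \<otimes> e = \<zero>" and ff: "f \<otimes> f = \<zero>" and fe: "f \<otimes> e = z \<oplus> \<ominus> (e \<otimes> f)"
    and uz: "u \<otimes> z = \<one>" and zu: "z \<otimes> u = \<one>"
begin

text \<open>Both \<open>e z\<close> and \<open>z e\<close> equal \<open>e f e\<close> because
  \<open>e e = 0\<close>, and likewise for \<open>f\<close>. The inverse \<open>u\<close> of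
  \<open>z\<close> inherits the commutation.\<close>

lemma commute:
  "e \<otimes> z = z \<otimes> e" "f \<otimes> z = z \<otimes> f" "e \<otimes> u = u \<otimes> e" "f \<otimes> u = u \<otimes> f"
proof -
  have z: "z = e \<otimes> f \<oplus> f \<otimes> e"
    by (simp add: fe) (metis a_comm a_lcomm add.inv_closed closed m_closed r_neg r_zero)
  show 1: "e \<otimes> z = z \<otimes> e"
    by (simp add: z l_distr r_distr m_assoc ee) (simp add: ee flip: m_assoc)
  show 2: "f \<otimes> z = z \<otimes> f"
    by (simp add: z l_distr r_distr m_assoc ff) (simp add: ff flip: m_assoc)
  have "t \<otimes> u = u \<otimes> t" if t: "t \<in> carrier R" "t \<otimes> z = z \<otimes> t" for t
  proof -
    have "t \<otimes> u = u \<otimes> (z \<otimes> t) \<otimes> u"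
      using t by (simp add: m_assoc[symmetric] uz)
    also have "\<dots> = u \<otimes> t \<otimes> (z \<otimes> u)"
      by (simp only: t(2)[symmetric]) (use t(1) in \<open>simp add: m_assoc\<close>)
    finally show ?thesis using t by (simp add: zu)
  qed
  with 1 2 show "e \<otimes> u = u \<otimes> e" "f \<otimes> u = u \<otimes> f" by auto
qed

lemma commute_left:
  assumes "t \<in> carrier R"
  shows "e \<otimes> (z \<otimes> t) = z \<otimes> (e \<otimes> t)" "f \<otimes> (z \<otimes> t) = z \<otimes> (f \<otimes> t)"
    "e \<otimes> (u \<otimes> t) = u \<otimes> (e \<otimes> t)" "f \<otimes> (u \<otimes> t) = u \<otimes> (f \<otimes> t)"
    "e \<otimes> (e \<otimes> t) = \<zero>" "f \<otimes> (f \<otimes> t) = \<zero>" "f \<otimes> (e \<otimes> t) = z \<otimes> t \<oplus> \<ominus> (e \<otimes> (f \<otimes> t))"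
    "u \<otimes> (z \<otimes> t) = t" "z \<otimes> (u \<otimes> t) = t"
  using assms commute by (simp_all add: m_assoc[symmetric] ee ff fe l_distr l_minus uz zu)

text \<open>Moving \<open>z\<close> and \<open>u\<close> to the left and replacing
  \<open>f e\<close> by \<open>z - e f\<close> leaves only words in \<open>z\<close> and
  \<open>u\<close> followed by \<open>1\<close>, \<open>e\<close>, \<open>f\<close> or
  \<open>e f\<close>, so the identities below can be checked by expansion.\<close>

lemmas normal_form = m_assoc commute commute_left ee ff fe uz zu l_distr r_distr l_minus r_minus
  minus_eq minus_add

text \<open>In the matrix model this element is \<open>diag(1, -1)\<close>, which inverts both transvections.\<close>

lemma reflection:
  fixes d defines "d \<equiv> u \<otimes> (e \<otimes> f \<ominus> f \<otimes> e)"
  shows "d \<in> carrier R" "d \<otimes> d = \<one>" "d \<otimes> (\<one> \<oplus> e) = (\<one> \<ominus> e) \<otimes> d" "d \<otimes> (\<one> \<oplus> f) = (\<one> \<ominus> f) \<otimes> d"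
proof -
  show "d \<in> carrier R" by (simp add: d_def)
  show "d \<otimes> d = \<one>" by (simp add: d_def normal_form, insert closed, algebra)
  show "d \<otimes> (\<one> \<oplus> e) = (\<one> \<ominus> e) \<otimes> d" by (simp add: d_def normal_form, insert closed, algebra)
  show "d \<otimes> (\<one> \<oplus> f) = (\<one> \<ominus> f) \<otimes> d" by (simp add: d_def normal_form, insert closed, algebra)
qed

text \<open>This is \<open>x f x^-1\<close> for \<open>x = 1 + e\<close>, since \<open>1 - e\<close>
  is the inverse of \<open>1 + e\<close>; hence \<open>1 + conj_pair\<close> is the conjugate of
  \<open>1 + f\<close> by \<open>x\<close>.\<close>

definition conj_pair :: 'a where "conj_pair = (\<one> \<oplus> e) \<otimes> f \<otimes> (\<one> \<ominus> e)"

lemma conj_pair_eq: "conj_pair = f \<oplus> e \<otimes> f \<oplus> e \<otimes> f \<ominus> z \<ominus> z \<otimes> e"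
  by (simp add: conj_pair_def normal_form, insert closed, algebra)

lemma conj_pair_closed [simp]: "conj_pair \<in> carrier R"
  by (simp add: conj_pair_eq)

text \<open>The new value \<open>-z^2\<close> is again invertible, so \<open>1 + f\<close> and its
  conjugate form a transvection pair inside the group generated by the old pair, to which minimality
  can be applied.\<close>

lemma square_zero_pair_conj_pair:
  "square_zero_pair R f conj_pair (\<ominus> (z \<otimes> z)) (\<ominus> (u \<otimes> u))"
proof
  show "conj_pair \<otimes> conj_pair = \<zero>"
    by (simp only: conj_pair_eq, simp add: normal_form, insert closed, algebra)
  show "conj_pair \<otimes> f = \<ominus> (z \<otimes> z) \<oplus> \<ominus> (f \<otimes> conj_pair)"
    by (simp only: conj_pair_eq, simp add: normal_form, insert closed, algebra)
qed (simp_all add: ff normal_form)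

text \<open>Both reflections invert \<open>1 + f\<close>, so their product commutes with it. In the
  matrix model only scalar multiples of elements \<open>1 + c f\<close> do so, which explains the
  shape of the result.\<close>

lemma reflection_mult_reflection:
  "\<ominus> (u \<otimes> u) \<otimes> (f \<otimes> conj_pair \<ominus> conj_pair \<otimes> f) \<otimes> (u \<otimes> (e \<otimes> f \<ominus> f \<otimes> e)) = \<ominus> (\<one> \<oplus> (u \<otimes> f \<oplus> u \<otimes> f))"
  by (simp only: conj_pair_eq, simp add: normal_form, insert closed, algebra)

text \<open>Put \<open>x = 1 + e\<close> and \<open>t = 1 - u f\<close>. In the matrix model, scaled
  so that \<open>e = E12\<close>, the product \<open>x t x\<close> is the Weyl element
  \<open>(0 1; -1 0)\<close>; the identity is the braid relation \<open>x t x = t x t\<close>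
  multiplied by \<open>x\<close>.\<close>

lemma weyl_element:
  "(\<one> \<oplus> e) \<otimes> (\<one> \<ominus> u \<otimes> f) \<otimes> (\<one> \<oplus> e) \<otimes> (\<one> \<oplus> e)
     = (\<one> \<ominus> u \<otimes> f) \<otimes> ((\<one> \<oplus> e) \<otimes> (\<one> \<ominus> u \<otimes> f) \<otimes> (\<one> \<oplus> e))"
  by (simp add: normal_form, insert closed, algebra)

text \<open>The value \<open>-1\<close> is that of \<open>E12\<close> and \<open>-E21\<close>, whose
  transvections are the standard generators \<open>(1 1; 0 1)\<close> and
  \<open>(1 0; -1 1)\<close>.\<close>

lemma scaled_pair:
  "e \<otimes> \<ominus> (u \<otimes> f) \<oplus> \<ominus> (u \<otimes> f) \<otimes> e = \<ominus> \<one>"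
  "\<ominus> (u \<otimes> f) \<otimes> \<ominus> (u \<otimes> f) = \<zero>"
  by (simp add: normal_form, insert closed, algebra) (simp add: normal_form)

end

lemma (in group) mem_normalizer_generateI:
  assumes "D \<subseteq> carrier G" "finite (generate G D)" "x \<in> carrier G"
    and "\<And>d. d \<in> D \<Longrightarrow> conj_by G x d \<in> generate G D"
  shows "x \<in> normalizer G (generate G D)"
proof -
  have "conj_by G x ` generate G D \<subseteq> generate G D"
    unfolding conj_by_generate[OF assms(3,1)]
    by (rule generate_subgroup_incl[OF _ generate_is_subgroup[OF assms(1)]]) (use assms in auto)
  then show ?thesis
    using assms generate_incl[OF assms(1)] by (subst mem_normalizer_finite_iff) auto
qed

context ring
begin

lemma one_plus_square_zero_pow:
  assumes "v \<in> carrier R" "v \<otimes> v = \<zero>"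
  shows "(\<one> \<oplus> v) [^] (k::nat) = \<one> \<oplus> [k] \<cdot> v"
proof (induction k)
  case (Suc k)
  have "[k] \<cdot> v \<otimes> v = \<zero>"
    using assms by (simp add: add_pow_ldistr)
  with Suc assms show ?case
    by (simp add: l_distr r_distr a_ac)
qed simp

definition transvection_pair :: "'a \<Rightarrow> 'a \<Rightarrow> bool" where
  "transvection_pair x y \<longleftrightarrow> (\<exists>e f z u. square_zero_pair R e f z u \<and> x = \<one> \<oplus> e \<and> y = \<one> \<oplus> f)"

text \<open>This replaces Dickson's theorem on groups generated by two transvections: for a pair
  \<open>x = 1 + e\<close>, \<open>y = 1 + f\<close> generating a group \<open>L\<close> of least order, with \<open>ef + fe\<close>
  invertible, the pair \<open>y\<close>, \<open>xyx\<inverse>\<close> also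
  generates \<open>L\<close>. Hence the reflections of both pairs normalise \<open>L\<close>, and so does their product
  \<open>-(1 + 2uf)\<close>, an even power of which is \<open>1 - uf\<close> because the exponent \<open>m\<close> is odd. Then
  \<open>w = x(1 - uf)x\<close> normalises \<open>L\<close> as well and conjugates \<open>x\<close> to \<open>1 - uf\<close>, so \<open>1 - uf\<close> lies in \<open>L\<close>.\<close>

theorem exists_sl2_pair:
  fixes m :: nat
  assumes M: "subgroup M (units_of R)" "finite M"
    and m: "odd m" "\<And>a. a \<in> carrier R \<Longrightarrow> [m] \<cdot> a = \<zero>"
    and "x0 \<in> M" "y0 \<in> M" "transvection_pair x0 y0"
  obtains e f where "\<one> \<oplus> e \<in> M" "\<one> \<oplus> f \<in> M" "e \<in> carrier R" "f \<in> carrier R"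
    "e \<otimes> e = \<zero>" "f \<otimes> f = \<zero>" "e \<otimes> f \<oplus> f \<otimes> e = \<ominus> \<one>"
proof -
  let ?U = "units_of R"
  interpret U: group ?U by (rule units_group)
  let ?P = "\<lambda>(x, y). x \<in> M \<and> y \<in> M \<and> transvection_pair x y"
  let ?c = "\<lambda>(x, y). card (generate ?U {x, y})"
  have "\<exists>w. ?P w \<and> (\<forall>v. ?P v \<longrightarrow> ?c w \<le> ?c v)"
    by (rule ex_has_least_nat[of ?P "(x0, y0)"]) (use assms in simp)
  then obtain w where w: "?P w" "\<And>v. ?P v \<Longrightarrow> ?c w \<le> ?c v" by blast
  obtain x y where ww: "w = (x, y)" by (cases w)
  have xM: "x \<in> M" and yM: "y \<in> M" and xy: "transvection_pair x y"
    using w(1) by (simp_all add: ww)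
  have least: "card (generate ?U {x, y}) \<le> card (generate ?U {x', y'})"
    if "x' \<in> M" "y' \<in> M" "transvection_pair x' y'" for x' y'
    using w(2)[of "(x', y')"] that by (simp add: ww)
  from xy obtain e f z u where sq: "square_zero_pair R e f z u" and x: "x = \<one> \<oplus> e" and y: "y = \<one> \<oplus> f"
    by (auto simp: transvection_pair_def)
  interpret square_zero_pair R e f z u by fact
  define y1 where "y1 = \<one> \<oplus> conj_pair"
  interpret C: square_zero_pair R f conj_pair "\<ominus> (z \<otimes> z)" "\<ominus> (u \<otimes> u)"
    by (rule square_zero_pair_conj_pair)
  let ?L = "generate ?U {x, y}"
  have xyU: "x \<in> Units R" "y \<in> Units R"
    using xM yM subgroup.subset[OF M(1)] by (auto simp: units_of_carrier)
  have LM: "?L \<subseteq> M"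
    by (rule U.generate_subgroup_incl[OF _ M(1)]) (use xM yM in simp)
  have subL: "subgroup ?L ?U"
    by (rule U.generate_is_subgroup) (use xyU in \<open>simp add: units_of_carrier\<close>)
  have finL: "finite ?L" using LM M(2) finite_subset by blast
  have xyL: "x \<in> ?L" "y \<in> ?L" by (auto intro: generate.incl)
  have inv: "inv\<^bsub>?U\<^esub> (\<one> \<oplus> t) = \<one> \<ominus> t" if "t \<in> carrier R" "t \<otimes> t = \<zero>" "\<one> \<oplus> t \<in> Units R" for t
  proof -
    have *: "(\<one> \<ominus> t) \<otimes> (\<one> \<oplus> t) = \<one>" "(\<one> \<oplus> t) \<otimes> (\<one> \<ominus> t) = \<one>"
      using that by (simp_all add: minus_eq l_distr r_distr l_minus r_minus a_assoc l_neg r_neg minus_zero)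
    then have "\<one> \<ominus> t \<in> Units R" using that by (auto simp: Units_def)
    with * that show ?thesis
      by (intro U.inv_equality) (simp_all add: units_of_carrier units_of_mult units_of_one)
  qed
  have conj: "conj_by ?U d t = k" if "d \<in> Units R" "t \<in> Units R" "k \<in> Units R" "d \<otimes> t = k \<otimes> d" for d t k
    using that U.conj_by_eq_iff[of d t k] by (simp add: units_of_carrier units_of_mult)
  have y1: "y1 = conj_by ?U x y"
  proof -
    have "x \<otimes> (\<one> \<ominus> e) = \<one>"
      using U.r_inv[of x] xyU inv[of e] by (simp add: x ee units_of_carrier units_of_mult units_of_one)
    then have "x \<otimes> y \<otimes> (\<one> \<ominus> e) = y1"
      by (simp add: y1_def y conj_pair_def r_distr l_distr x[symmetric] del: Units_closed) (simp add: x r_distr l_distr)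
    then show ?thesis
      using inv[of e] xyU by (simp add: conj_by_def units_of_mult x ee)
  qed
  have y1L: "y1 \<in> ?L"
    unfolding y1 by (rule U.subgroup_conj_closed[OF subL xyL])
  have y1U: "y1 \<in> Units R"
    using y1L subgroup.subset[OF subL] by (auto simp: units_of_carrier)
  have L1: "generate ?U {y, y1} = ?L"
  proof (rule card_seteq[OF finL])
    show "generate ?U {y, y1} \<subseteq> ?L"
      by (rule U.generate_subgroup_incl[OF _ subL]) (use xyL y1L in simp)
    show "card ?L \<le> card (generate ?U {y, y1})"
      by (rule least) (use yM y1L LM C.square_zero_pair_axioms y in \<open>auto simp: transvection_pair_def y1_def\<close>)
  qed
  define d where "d = u \<otimes> (e \<otimes> f \<ominus> f \<otimes> e)"
  define d1 where "d1 = \<ominus> (u \<otimes> u) \<otimes> (f \<otimes> conj_pair \<ominus> conj_pair \<otimes> f)"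
  note d = reflection[folded d_def] and d1 = C.reflection[folded d1_def]
  have dU: "d \<in> Units R" "d1 \<in> Units R" using d d1 by (auto simp: Units_def)
  have invL: "\<one> \<ominus> t \<in> ?L" if "\<one> \<oplus> t \<in> ?L" "t \<in> carrier R" "t \<otimes> t = \<zero>" for t
    using inv[of t] that subgroup.m_inv_closed[OF subL that(1)] subgroup.mem_carrier[OF subL that(1)]
    by (simp add: units_of_carrier)
  have LU: "t \<in> Units R" if "t \<in> ?L" for t
    using subgroup.mem_carrier[OF subL that] by (simp add: units_of_carrier)
  have eL: "\<one> \<ominus> e \<in> ?L" and fL: "\<one> \<ominus> f \<in> ?L" and cL: "\<one> \<ominus> conj_pair \<in> ?L"
    using invL[of e] invL[of f] invL[of conj_pair] xyL y1L
    by (simp_all only: x[symmetric] y[symmetric] y1_def[symmetric] ee ff C.ff closed C.closed simp_thms True_implies_equals)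
  have dN: "d \<in> normalizer ?U ?L"
  proof (rule U.mem_normalizer_generateI)
    fix t assume t: "t \<in> {x, y}"
    have "conj_by ?U d x = \<one> \<ominus> e" "conj_by ?U d y = \<one> \<ominus> f"
      by (rule conj[OF dU(1) xyU(1) LU[OF eL] d(3)[folded x]] conj[OF dU(1) xyU(2) LU[OF fL] d(4)[folded y]])+
    with t eL fL show "conj_by ?U d t \<in> ?L" by auto
  qed (use xyU finL dU in \<open>auto simp: units_of_carrier\<close>)
  have "d1 \<in> normalizer ?U (generate ?U {y, y1})"
  proof (rule U.mem_normalizer_generateI)
    fix t assume t: "t \<in> {y, y1}"
    have "conj_by ?U d1 y = \<one> \<ominus> f" "conj_by ?U d1 y1 = \<one> \<ominus> conj_pair"
      by (rule conj[OF dU(2) xyU(2) LU[OF fL] d1(3)[folded y]]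
          conj[OF dU(2) y1U LU[OF cL] d1(4)[folded y1_def]])+
    with t fL cL show "conj_by ?U d1 t \<in> generate ?U {y, y1}" by (auto simp: L1)
  qed (use xyU y1U finL dU L1 in \<open>auto simp: units_of_carrier\<close>)
  then have d1N: "d1 \<in> normalizer ?U ?L" by (simp add: L1)
  have subN: "subgroup (normalizer ?U ?L) ?U" by (rule U.subgroup_normalizer[OF subL])
  define n where "n = u \<otimes> f \<oplus> u \<otimes> f"
  have nn: "n \<in> carrier R" "n \<otimes> n = \<zero>"
    using commute commute_left ff by (simp_all add: n_def l_distr r_distr m_assoc)
  have d1d: "d1 \<otimes> d = \<ominus> (\<one> \<oplus> n)"
    using reflection_mult_reflection by (simp add: d_def d1_def n_def)
  have "d1 \<otimes> d \<in> normalizer ?U ?L"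
    using subgroup.m_closed[OF subN d1N dN] by (simp add: units_of_mult)
  \<comment> \<open>Squaring removes the sign of \<open>-(1 + n)\<close>, and \<open>n + n\<close>
    equals \<open>4v\<close> for \<open>v = u f\<close>.\<close>
  then have "(d1 \<otimes> d) \<otimes> (d1 \<otimes> d) \<in> normalizer ?U ?L"
    using subgroup.m_closed[OF subN] by (simp add: units_of_mult)
  moreover have "(d1 \<otimes> d) \<otimes> (d1 \<otimes> d) = \<one> \<oplus> (n \<oplus> n)"
    using nn by (simp add: d1d l_minus r_minus l_distr r_distr minus_add a_ac)
  ultimately have sN: "\<one> \<oplus> (n \<oplus> n) \<in> normalizer ?U ?L" by simp
  \<comment> \<open>This is the division by 4: \<open>m\<close> annihilates the additive group and
    \<open>m^2 = 4k + 1\<close>, so \<open>4k\<close> acts as \<open>-1\<close> and the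
    \<open>k\<close>-th power of \<open>1 + 4v\<close> is \<open>1 - v\<close>.\<close>
  obtain i where i: "m = 2 * i + 1" using m(1) oddE by blast
  define k where "k = i * i + i"
  have mk: "m * m = 4 * k + 1" by (simp add: i k_def algebra_simps)
  define v where "v = u \<otimes> f"
  have v: "v \<in> carrier R" by (simp add: v_def)
  have n4: "n \<oplus> n = [(4::nat)] \<cdot> v"
    by (simp add: n_def v_def numeral_eq_Suc a_ac)
  have "[k] \<cdot> (n \<oplus> n) \<oplus> v = [(4 * k + 1)] \<cdot> v"
    using v by (simp add: n4 add.nat_pow_pow mult.commute)
  also have "\<dots> = \<zero>"
    unfolding mk[symmetric] using v m(2)[of "[m] \<cdot> v"] by (simp add: add.nat_pow_pow)
  finally have kv: "[k] \<cdot> (n \<oplus> n) = \<ominus> v"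
    using minus_equality[of "[k] \<cdot> (n \<oplus> n)" v] v nn by simp
  have "(\<one> \<oplus> (n \<oplus> n)) [^] k = \<one> \<ominus> v"
    using one_plus_square_zero_pow[of "n \<oplus> n" k] nn kv v by (simp add: l_distr r_distr minus_eq)
  moreover have "(\<one> \<oplus> (n \<oplus> n)) [^]\<^bsub>?U\<^esub> k \<in> normalizer ?U ?L"
    by (rule U.subgroup_pow_closed[OF subN sN])
  moreover have "\<one> \<oplus> (n \<oplus> n) \<in> Units R"
    using subgroup.mem_carrier[OF subN sN] by (simp add: units_of_carrier)
  ultimately have tN: "\<one> \<ominus> v \<in> normalizer ?U ?L"
    by (metis units_of_pow)
  have xN: "x \<in> normalizer ?U ?L"
    using U.subgroup_subset_normalizer[OF subL] xyL by blast
  have wN: "x \<otimes> (\<one> \<ominus> v) \<otimes> x \<in> normalizer ?U ?L"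
    using subgroup.m_closed[OF subN subgroup.m_closed[OF subN xN tN] xN] by (simp add: units_of_mult)
  have NU: "t \<in> Units R" if "t \<in> normalizer ?U ?L" for t
    using subgroup.mem_carrier[OF subN that] by (simp add: units_of_carrier)
  have "conj_by ?U (x \<otimes> (\<one> \<ominus> v) \<otimes> x) x = \<one> \<ominus> v"
    using weyl_element NU[OF wN] NU[OF tN] xyU by (intro conj) (simp_all add: x v_def)
  then have "\<one> \<ominus> v \<in> ?L"
    using U.mem_normalizerD(2)[OF subL wN xyL(1)] by simp
  then have "\<one> \<oplus> \<ominus> (u \<otimes> f) \<in> M" using LM by (auto simp: v_def minus_eq)
  then show ?thesis
    using that[of e "\<ominus> (u \<otimes> f)"] scaled_pair ee xM by (simp add: x)
qed

end

section \<open>Endomorphisms of an abelian group and planes\<close>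

definition endo_ring :: "('a, 'b) monoid_scheme \<Rightarrow> ('a \<Rightarrow> 'a) ring" where
  "endo_ring A = \<lparr>carrier = hom A A \<inter> extensional (carrier A),
     monoid.mult = compose (carrier A),
     one = (\<lambda>a\<in>carrier A. a),
     zero = (\<lambda>a\<in>carrier A. \<one>\<^bsub>A\<^esub>),
     add = (\<lambda>f g. \<lambda>a\<in>carrier A. f a \<otimes>\<^bsub>A\<^esub> g a)\<rparr>"

lemma endo_ring_simps:
  "a \<in> carrier A \<Longrightarrow> (f \<otimes>\<^bsub>endo_ring A\<^esub> g) a = f (g a)"
  "a \<in> carrier A \<Longrightarrow> (f \<oplus>\<^bsub>endo_ring A\<^esub> g) a = f a \<otimes>\<^bsub>A\<^esub> g a"
  "a \<in> carrier A \<Longrightarrow> \<one>\<^bsub>endo_ring A\<^esub> a = a"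
  "a \<in> carrier A \<Longrightarrow> \<zero>\<^bsub>endo_ring A\<^esub> a = \<one>\<^bsub>A\<^esub>"
  by (simp_all add: endo_ring_def compose_def)

lemma mem_endo_ring:
  "f \<in> carrier (endo_ring A) \<longleftrightarrow> f \<in> hom A A \<and> f \<in> extensional (carrier A)"
  by (simp add: endo_ring_def)

lemma endo_ring_eqI:
  assumes "f \<in> carrier (endo_ring A)" "g \<in> carrier (endo_ring A)"
    and "\<And>a. a \<in> carrier A \<Longrightarrow> f a = g a"
  shows "f = g"
  using assms by (auto simp: mem_endo_ring intro: extensionalityI)

context comm_group
begin

lemma endo_ring_closed:
  assumes "f \<in> carrier (endo_ring G)" "g \<in> carrier (endo_ring G)"
  shows "f \<otimes>\<^bsub>endo_ring G\<^esub> g \<in> carrier (endo_ring G)"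
    "f \<oplus>\<^bsub>endo_ring G\<^esub> g \<in> carrier (endo_ring G)"
  using assms by (auto simp: endo_ring_def hom_def compose_def m_ac Pi_iff)

lemma endo_ring_one_zero:
  "\<one>\<^bsub>endo_ring G\<^esub> \<in> carrier (endo_ring G)" "\<zero>\<^bsub>endo_ring G\<^esub> \<in> carrier (endo_ring G)"
  by (auto simp: endo_ring_def hom_def)

lemma endo_ring_neg:
  "f \<in> carrier (endo_ring G) \<Longrightarrow> (\<lambda>a\<in>carrier G. inv (f a)) \<in> carrier (endo_ring G)"
  by (auto simp: endo_ring_def hom_def Pi_iff inv_mult m_ac)

lemma endo_ring_apply_closed:
  "f \<in> carrier (endo_ring G) \<Longrightarrow> a \<in> carrier G \<Longrightarrow> f a \<in> carrier G"
  by (auto simp: endo_ring_def hom_def)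

lemma endo_ring_apply_mult:
  "f \<in> carrier (endo_ring G) \<Longrightarrow> a \<in> carrier G \<Longrightarrow> b \<in> carrier G \<Longrightarrow> f (a \<otimes> b) = f a \<otimes> f b"
  by (auto simp: endo_ring_def hom_def)

lemma endo_ring_apply_one:
  "f \<in> carrier (endo_ring G) \<Longrightarrow> f \<one> = \<one>"
  by (metis endo_ring_apply_closed endo_ring_apply_mult l_one one_closed r_cancel_one')

lemma endo_ring_apply_inv:
  assumes "f \<in> carrier (endo_ring G)" "a \<in> carrier G"
  shows "f (inv a) = inv (f a)"
proof -
  have "f (inv a) \<otimes> f a = \<one>"
    using assms endo_ring_apply_mult[of f "inv a" a] by (simp add: endo_ring_apply_one)
  then show ?thesis
    using assms endo_ring_apply_closed[of f] by (simp add: inv_equality)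
qed

lemma ring_endo_ring: "ring (endo_ring G)"
proof (intro ringI abelian_groupI monoidI; (rule endo_ring_eqI[where A = G])?)
  fix f assume f: "f \<in> carrier (endo_ring G)"
  show "\<exists>g\<in>carrier (endo_ring G). g \<oplus>\<^bsub>endo_ring G\<^esub> f = \<zero>\<^bsub>endo_ring G\<^esub>"
  proof (intro bexI[of _ "\<lambda>a\<in>carrier G. inv (f a)"] endo_ring_eqI)
    fix a assume "a \<in> carrier G"
    then show "((\<lambda>a\<in>carrier G. inv (f a)) \<oplus>\<^bsub>endo_ring G\<^esub> f) a = \<zero>\<^bsub>endo_ring G\<^esub> a"
      using f by (simp add: endo_ring_simps endo_ring_apply_closed)
  qed (use f in \<open>simp_all add: endo_ring_closed endo_ring_one_zero endo_ring_neg\<close>)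
qed (simp_all add: endo_ring_closed endo_ring_one_zero endo_ring_simps endo_ring_apply_closed
    endo_ring_apply_mult m_ac)

lemma endo_ring_a_inv_apply:
  assumes "f \<in> carrier (endo_ring G)" "a \<in> carrier G"
  shows "(\<ominus>\<^bsub>endo_ring G\<^esub> f) a = inv (f a)"
proof -
  interpret E: ring "endo_ring G" by (rule ring_endo_ring)
  have "(\<ominus>\<^bsub>endo_ring G\<^esub> f \<oplus>\<^bsub>endo_ring G\<^esub> f) a = \<one>"
    using assms by (simp add: E.l_neg endo_ring_simps)
  then have "(\<ominus>\<^bsub>endo_ring G\<^esub> f) a \<otimes> f a = \<one>"
    using assms by (simp add: endo_ring_simps)
  then show ?thesis
    using assms endo_ring_apply_closed by (metis E.a_inv_closed inv_equality)
qed

lemma endo_ring_add_pow_apply: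
  assumes "f \<in> carrier (endo_ring G)" "a \<in> carrier G"
  shows "([(k::nat)] \<cdot>\<^bsub>endo_ring G\<^esub> f) a = f a [^] k"
proof -
  interpret E: ring "endo_ring G" by (rule ring_endo_ring)
  show ?thesis
    using assms by (induction k) (simp_all add: endo_ring_simps)
qed

lemma endo_ring_bij_unit:
  assumes f: "f \<in> carrier (endo_ring G)" and bij: "bij_betw f (carrier G) (carrier G)"
  shows "f \<in> Units (endo_ring G)"
proof -
  interpret E: ring "endo_ring G" by (rule ring_endo_ring)
  let ?g = "\<lambda>a\<in>carrier G. inv_into (carrier G) f a"
  have "f \<in> iso G G" using f bij by (simp add: iso_def mem_endo_ring)
  then have "inv_into (carrier G) f \<in> hom G G"
    using iso_set_sym by (auto simp: iso_def)
  then have g: "?g \<in> carrier (endo_ring G)"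
    by (auto simp: mem_endo_ring hom_def)
  have "?g \<otimes>\<^bsub>endo_ring G\<^esub> f = \<one>\<^bsub>endo_ring G\<^esub>" "f \<otimes>\<^bsub>endo_ring G\<^esub> ?g = \<one>\<^bsub>endo_ring G\<^esub>"
    using bij f g
    by (auto intro!: endo_ring_eqI
        simp: endo_ring_closed endo_ring_one_zero endo_ring_simps bij_betw_inv_into_left bij_betw_inv_into_right
          endo_ring_apply_closed)
  with f g show ?thesis by (auto simp: Units_def)
qed

end

text \<open>Coordinates \<open>(\<alpha>, \<beta>)\<close> are integers representing residues modulo \<open>p\<close>, so that they define a
  homomorphism from \<open>R\<close> onto the plane over the field with \<open>p\<close> elements; its kernel is not mentioned.
  A matrix acts on the column \<open>(\<alpha>, \<beta>)\<close>. The two matrices in \<open>sl2_section\<close> generate \<open>SL\<^sub>2(p)\<close>, so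
  that \<open>N\<^sub>G(R)\<close> induces at least \<open>SL\<^sub>2(p)\<close> on the plane.\<close>

definition plane_coords :: "nat \<Rightarrow> ('a, 'b) monoid_scheme \<Rightarrow> 'a set \<Rightarrow> ('a \<Rightarrow> int) \<Rightarrow> ('a \<Rightarrow> int) \<Rightarrow> bool" where
  "plane_coords p G R \<alpha> \<beta> \<longleftrightarrow> subgroup R G \<and>
     (\<forall>r\<in>R. \<forall>s\<in>R. [\<alpha> (r \<otimes>\<^bsub>G\<^esub> s) = \<alpha> r + \<alpha> s] (mod int p) \<and> [\<beta> (r \<otimes>\<^bsub>G\<^esub> s) = \<beta> r + \<beta> s] (mod int p)) \<and>
     (\<exists>r\<in>R. [\<alpha> r = 1] (mod int p) \<and> [\<beta> r = 0] (mod int p)) \<and>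
     (\<exists>r\<in>R. [\<alpha> r = 0] (mod int p) \<and> [\<beta> r = 1] (mod int p))"

definition acts_as ::
  "nat \<Rightarrow> ('a, 'b) monoid_scheme \<Rightarrow> 'a set \<Rightarrow> ('a \<Rightarrow> int) \<Rightarrow> ('a \<Rightarrow> int) \<Rightarrow> 'a \<Rightarrow> int \<Rightarrow> int \<Rightarrow> int \<Rightarrow> int \<Rightarrow> bool" where
  "acts_as p G R \<alpha> \<beta> m a b c d \<longleftrightarrow> m \<in> normalizer G R \<and>
     (\<forall>r\<in>R. [\<alpha> (conj_by G m r) = a * \<alpha> r + b * \<beta> r] (mod int p) \<and>
            [\<beta> (conj_by G m r) = c * \<alpha> r + d * \<beta> r] (mod int p))"

definition sl2_section :: "nat \<Rightarrow> ('a, 'b) monoid_scheme \<Rightarrow> 'a set \<Rightarrow> bool" where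
  "sl2_section p G R \<longleftrightarrow> (\<exists>\<alpha> \<beta> x y. plane_coords p G R \<alpha> \<beta> \<and>
     acts_as p G R \<alpha> \<beta> x 1 1 0 1 \<and> acts_as p G R \<alpha> \<beta> y 1 0 (- 1) 1)"

context finite_group_prime
begin

lemma conj_by_int_pow:
  "x \<in> carrier G \<Longrightarrow> h \<in> carrier G \<Longrightarrow> conj_by G x (h [^] (i::int)) = conj_by G x h [^] i"
  using group_hom.hom_int_pow[OF group_hom_conj_by] by blast

lemma commute_int_pow:
  assumes "a \<in> carrier G" "b \<in> carrier G" "a \<otimes> b = b \<otimes> a"
  shows "a [^] (i::int) \<otimes> b [^] (j::int) = b [^] j \<otimes> a [^] i"
proof -
  have "conj_by G b a = a" using assms conj_by_eq_iff[of b a a] by simp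
  then have "conj_by G b (a [^] i) = a [^] i"
    using assms by (simp add: conj_by_int_pow)
  then have "a [^] i \<otimes> b = b \<otimes> a [^] i"
    using assms conj_by_eq_iff[of b "a [^] i" "a [^] i"] by simp
  then have "conj_by G (a [^] i) b = b"
    using assms conj_by_eq_iff[of "a [^] i" b b] by simp
  then have "conj_by G (a [^] i) (b [^] j) = b [^] j"
    using assms by (simp add: conj_by_int_pow)
  then show ?thesis
    using assms conj_by_eq_iff[of "a [^] i" "b [^] j" "b [^] j"] by simp
qed

text \<open>Independence of \<open>a\<close> and \<open>b\<close> comes from the action: conjugating
  a relation \<open>a^i b^j = 1\<close> by \<open>x\<close> and comparing leaves
  \<open>a^j = 1\<close>, so \<open>p\<close> divides \<open>j\<close> and then \<open>i\<close>.
  The coordinates are the exponents.\<close>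

lemma sl2_section_of_basis:
  assumes a: "a \<in> carrier G" and b: "b \<in> carrier G" and ab: "a \<noteq> \<one>" "a [^] p = \<one>" "b [^] p = \<one>" "a \<otimes> b = b \<otimes> a"
    and x: "x \<in> carrier G" "conj_by G x a = a" "conj_by G x b = a \<otimes> b"
    and y: "y \<in> carrier G" "conj_by G y a = a \<otimes> inv b" "conj_by G y b = b"
  obtains R where "sl2_section p G R"
proof -
  define w where "w = (\<lambda>(i::int) (j::int). a [^] i \<otimes> b [^] j)"
  define R where "R = {w i j | i j. True}"
  have wc [simp]: "w i j \<in> carrier G" for i j by (simp add: w_def a b)
  have comm: "a [^] (i::int) \<otimes> b [^] (j::int) = b [^] j \<otimes> a [^] i" for i j
    using commute_int_pow a b ab by blast
  have mult: "w i j \<otimes> w k l = w (i + k) (j + l)" for i j k l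
  proof -
    have "w i j \<otimes> w k l = a [^] i \<otimes> (b [^] j \<otimes> a [^] k) \<otimes> b [^] l"
      by (simp add: w_def a b m_assoc)
    also have "\<dots> = a [^] i \<otimes> (a [^] k \<otimes> b [^] j) \<otimes> b [^] l"
      by (simp only: comm)
    also have "\<dots> = w (i + k) (j + l)"
      by (simp add: w_def a b m_assoc int_pow_mult)
    finally show ?thesis .
  qed
  have w0: "w 0 0 = \<one>" by (simp add: w_def)
  have winv: "inv (w i j) = w (- i) (- j)" for i j
    by (rule inv_equality) (simp_all add: mult w0)
  have subR: "subgroup R G"
    by (rule subgroupI) (force simp: R_def winv mult)+
  have wpow: "w i j [^] (k::int) = w (i * k) (j * k)" for i j k
  proof -
    have "w i j [^] k = (a [^] i) [^] k \<otimes> (b [^] j) [^] k"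
      unfolding w_def by (rule int_pow_mult_distrib) (simp_all add: a b comm)
    then show ?thesis by (simp add: w_def int_pow_pow a b)
  qed
  have a_w: "a = w 1 0" and b_w: "b = w 0 1" by (simp_all add: w_def a b)
  have conj_w: "conj_by G g (w i j) = conj_by G g a [^] i \<otimes> conj_by G g b [^] j" if "g \<in> carrier G" for g i j
    using that by (simp add: w_def a b conj_by_mult conj_by_int_pow)
  have xw: "conj_by G x (w i j) = w (i + j) j" for i j
  proof -
    have "conj_by G x (w i j) = w 1 0 [^] i \<otimes> w 1 1 [^] j"
      using x by (simp add: conj_w) (simp add: a_w b_w mult)
    then show ?thesis by (simp add: wpow mult)
  qed
  have yw: "conj_by G y (w i j) = w i (j - i)" for i j
  proof -
    have "conj_by G y (w i j) = w 1 (- 1) [^] i \<otimes> w 0 1 [^] j"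
      using y by (simp add: conj_w) (simp add: a_w b_w mult winv)
    then show ?thesis by (simp add: wpow mult)
  qed
  have "ord a = p"
    using pow_eq_id[of a p] ord_eq_1[of a] a ab prime_p by (metis prime_nat_iff)
  then have a_id: "a [^] (i::int) = \<one> \<longleftrightarrow> int p dvd i" for i
    using int_pow_eq_id[of a i] a by simp
  have b_id: "b [^] (i::int) = \<one>" if "int p dvd i" for i
    using that b ab by (auto simp: int_pow_pow[symmetric] int_pow_int elim!: dvdE)
  have indep: "[i = k] (mod int p) \<and> [j = l] (mod int p)" if eq: "w i j = w k l" for i j k l
  proof -
    have e: "w (i - k) (j - l) = \<one>"
      using eq mult[of i j "- k" "- l"] winv[of k l, symmetric] by simp
    then have "w (i - k + (j - l)) (j - l) = \<one>"
      using xw[of "i - k" "j - l"] x by simp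
    then have "w (j - l) 0 = \<one>"
      using mult[of "i - k + (j - l)" "j - l" "- (i - k)" "- (j - l)"] winv[of "i - k" "j - l"] e by simp
    then have "int p dvd j - l" using a_id by (simp add: w_def a)
    moreover from this e have "a [^] (i - k) = \<one>" by (simp add: w_def b_id a)
    ultimately show ?thesis using a_id by (simp add: cong_iff_dvd_diff)
  qed
  \<comment> \<open>Exponents are chosen arbitrarily; by \<open>indep\<close> they are unique modulo
    \<open>p\<close>, which is all that \<open>plane_coords\<close> asks for.\<close>
  define rep where "rep = (\<lambda>r. SOME ij. r = w (fst ij) (snd ij))"
  have rep: "w (fst (rep r)) (snd (rep r)) = r" if "r \<in> R" for r
  proof -
    from that obtain i j where "r = w i j" by (auto simp: R_def)
    then have "r = w (fst (i, j)) (snd (i, j))" by simp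
    then show ?thesis
      unfolding rep_def using someI[of "\<lambda>ij. r = w (fst ij) (snd ij)" "(i, j)"] by simp
  qed
  have rep_w: "[fst (rep (w i j)) = i] (mod int p)" "[snd (rep (w i j)) = j] (mod int p)" for i j
    using indep[OF rep[of "w i j"]] by (auto simp: R_def)
  let ?\<alpha> = "\<lambda>r. fst (rep r)" and ?\<beta> = "\<lambda>r. snd (rep r)"
  have "plane_coords p G R ?\<alpha> ?\<beta>"
    unfolding plane_coords_def
  proof (intro conjI ballI)
    fix r s assume "r \<in> R" "s \<in> R"
    then have rs: "r \<otimes> s = w (?\<alpha> r + ?\<alpha> s) (?\<beta> r + ?\<beta> s)"
      using mult[of "?\<alpha> r" "?\<beta> r" "?\<alpha> s" "?\<beta> s"] by (simp add: rep)
    show "[?\<alpha> (r \<otimes> s) = ?\<alpha> r + ?\<alpha> s] (mod int p)" "[?\<beta> (r \<otimes> s) = ?\<beta> r + ?\<beta> s] (mod int p)"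
      unfolding rs by (rule rep_w)+
  next
    show "\<exists>r\<in>R. [?\<alpha> r = 1] (mod int p) \<and> [?\<beta> r = 0] (mod int p)"
      by (rule bexI[of _ "w 1 0"]) (use rep_w[of 1 0] in \<open>auto simp: R_def\<close>)
    show "\<exists>r\<in>R. [?\<alpha> r = 0] (mod int p) \<and> [?\<beta> r = 1] (mod int p)"
      by (rule bexI[of _ "w 0 1"]) (use rep_w[of 0 1] in \<open>auto simp: R_def\<close>)
  qed (rule subR)
  moreover have norm: "g \<in> normalizer G R" if "g \<in> carrier G" "\<And>i j. conj_by G g (w i j) \<in> R" for g
    using that subR by (auto simp: mem_normalizer_subgroup_iff R_def)
  have "acts_as p G R ?\<alpha> ?\<beta> x 1 1 0 1"
    unfolding acts_as_def
  proof (intro conjI ballI)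
    fix r assume "r \<in> R"
    then have r: "conj_by G x r = w (?\<alpha> r + ?\<beta> r) (?\<beta> r)"
      using xw[of "?\<alpha> r" "?\<beta> r"] by (simp add: rep)
    show "[?\<alpha> (conj_by G x r) = 1 * ?\<alpha> r + 1 * ?\<beta> r] (mod int p)"
      "[?\<beta> (conj_by G x r) = 0 * ?\<alpha> r + 1 * ?\<beta> r] (mod int p)"
      unfolding r using rep_w[of "?\<alpha> r + ?\<beta> r" "?\<beta> r"] by simp_all
  qed (rule norm, use x xw in \<open>auto simp: R_def\<close>)
  moreover have "acts_as p G R ?\<alpha> ?\<beta> y 1 0 (- 1) 1"
    unfolding acts_as_def
  proof (intro conjI ballI)
    fix r assume "r \<in> R"
    then have r: "conj_by G y r = w (?\<alpha> r) (?\<beta> r - ?\<alpha> r)"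
      using yw[of "?\<alpha> r" "?\<beta> r"] by (simp add: rep)
    show "[?\<alpha> (conj_by G y r) = 1 * ?\<alpha> r + 0 * ?\<beta> r] (mod int p)"
      "[?\<beta> (conj_by G y r) = - 1 * ?\<alpha> r + 1 * ?\<beta> r] (mod int p)"
      unfolding r using rep_w[of "?\<alpha> r" "?\<beta> r - ?\<alpha> r"] by simp_all
  qed (rule norm, use y yw in \<open>auto simp: R_def\<close>)
  ultimately show ?thesis using that by (auto simp: sl2_section_def)
qed

end

section \<open>Quadratic action on an abelian subgroup\<close>

context group
begin

lemma subgroup_mult_inv_closed:
  "subgroup H G \<Longrightarrow> a \<in> H \<Longrightarrow> b \<in> H \<Longrightarrow> a \<otimes> inv b \<in> H"
  by (simp add: subgroup.m_closed subgroup.m_inv_closed)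

text \<open>As \<open>h\<close> fixes \<open>w\<close>, the power \<open>h^k\<close> sends
  \<open>a\<close> to \<open>w^k a\<close>. For \<open>k = r\<close> this gives
  \<open>w^r = 1\<close>, while the order of \<open>w\<close> is a power of \<open>p\<close>. This
  computation stands in for the theory of coprime action.\<close>

lemma coprime_action_fixes:
  assumes carr: "h \<in> carrier G" "a \<in> carrier G" "w \<in> carrier G"
    and act: "conj_by G h w = w" "conj_by G h a = w \<otimes> a" "conj_by G (h [^] (r::nat)) a = a"
    and ord: "w [^] (p ^ n) = \<one>" "coprime r p"
  shows "w = \<one>"
proof -
  have w: "conj_by G (h [^] k) w = w" for k :: nat
    by (induction k) (use carr act in \<open>simp_all add: conj_by_conj_by[symmetric]\<close>)
  have "conj_by G (h [^] k) a = w [^] k \<otimes> a" for k :: nat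
  proof (induction k)
    case (Suc k)
    have "conj_by G (h [^] Suc k) a = conj_by G (h [^] k) (w \<otimes> a)"
      using carr act by (simp add: conj_by_conj_by[symmetric])
    also have "\<dots> = w \<otimes> w [^] k \<otimes> a"
      using carr Suc w by (simp add: conj_by_mult m_assoc)
    finally show ?case using carr nat_pow_Suc2[of w k] by simp
  qed (use carr in simp)
  from this[of r] have "w [^] r = \<one>"
    using act carr by (metis l_cancel_one' nat_pow_closed r_cancel_one r_cancel_one')
  then have "ord w dvd r" "ord w dvd p ^ n"
    using ord carr by (simp_all add: pow_eq_id)
  then have "ord w = 1"
    using coprime_common_divisor[of r "p ^ n" "ord w"] ord(2) by simp
  then show ?thesis using carr ord_eq_1 by blast
qed

end

locale abelian_p_subgroup = finite_group_prime +
  fixes V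
  assumes p_subgroup_V: "p_subgroup p G V"
    and commute_V: "\<And>a b. a \<in> V \<Longrightarrow> b \<in> V \<Longrightarrow> a \<otimes> b = b \<otimes> a"
begin

abbreviation "A \<equiv> G\<lparr>carrier := V\<rparr>"
abbreviation "E \<equiv> endo_ring A"

lemma subgroup_V: "subgroup V G"
  using p_subgroup_V by (simp add: p_subgroup_def)

lemma V_carrier [simp]: "a \<in> V \<Longrightarrow> a \<in> carrier G"
  using subgroup_V subgroup.mem_carrier by metis

lemma V_closed [simp]: "a \<in> V \<Longrightarrow> b \<in> V \<Longrightarrow> a \<otimes> b \<in> V" "a \<in> V \<Longrightarrow> inv a \<in> V" "\<one> \<in> V"
  using subgroup_V by (simp_all add: subgroup.m_closed subgroup.m_inv_closed subgroup.one_closed)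

lemma comm_group_A: "comm_group A"
  using subgroup_imp_group[OF subgroup_V] commute_V
  by (intro group.group_comm_groupI) auto

sublocale A: comm_group A
  by (rule comm_group_A)

sublocale E: ring E
  by (rule A.ring_endo_ring)

lemma inv_A: "a \<in> V \<Longrightarrow> inv\<^bsub>A\<^esub> a = inv a"
  by (simp add: m_inv_consistent subgroup_V)

lemma norm_V:
  assumes "g \<in> normalizer G V"
  shows "g \<in> carrier G" "a \<in> V \<Longrightarrow> conj_by G g a \<in> V"
  using mem_normalizerD[OF subgroup_V assms] by auto

definition act :: "'a \<Rightarrow> 'a \<Rightarrow> 'a" where "act g = restrict (conj_by G g) V"

lemma act_apply [simp]: "a \<in> V \<Longrightarrow> act g a = conj_by G g a"
  by (simp add: act_def)

lemma act_closed: "g \<in> normalizer G V \<Longrightarrow> act g \<in> carrier E"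
  by (auto simp: mem_endo_ring hom_def act_def conj_by_mult norm_V)

lemma act_mult: "g \<in> normalizer G V \<Longrightarrow> g' \<in> normalizer G V \<Longrightarrow> act (g \<otimes> g') = act g \<otimes>\<^bsub>E\<^esub> act g'"
  by (rule endo_ring_eqI[of _ A])
    (auto simp: act_closed subgroup.m_closed[OF subgroup_normalizer[OF subgroup_V]] endo_ring_simps
      norm_V conj_by_conj_by)

lemma act_one: "act \<one> = \<one>\<^bsub>E\<^esub>"
  by (rule endo_ring_eqI[of _ A])
    (auto simp: act_closed subgroup.one_closed[OF subgroup_normalizer[OF subgroup_V]] endo_ring_simps)

lemma act_unit:
  assumes "g \<in> normalizer G V"
  shows "act g \<in> Units E"
proof -
  have g': "inv g \<in> normalizer G V" "g \<in> carrier G"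
    using assms subgroup.m_inv_closed[OF subgroup_normalizer[OF subgroup_V]] norm_V by auto
  then have "act g \<otimes>\<^bsub>E\<^esub> act (inv g) = \<one>\<^bsub>E\<^esub>" "act (inv g) \<otimes>\<^bsub>E\<^esub> act g = \<one>\<^bsub>E\<^esub>"
    using assms by (simp_all add: act_mult[symmetric] act_one)
  then show ?thesis
    using act_closed assms g' by (auto simp: Units_def)
qed

lemma subgroup_act_image:
  assumes "subgroup L G" "L \<subseteq> normalizer G V"
  shows "subgroup (act ` L) (units_of E)"
proof -
  interpret L: group "G\<lparr>carrier := L\<rparr>" by (rule subgroup_imp_group[OF assms(1)])
  have "group_hom (G\<lparr>carrier := L\<rparr>) (units_of E) act"
    using assms(2) E.units_group L.is_group act_unit act_mult
    by (auto simp: group_hom_def group_hom_axioms_def hom_def units_of_carrier units_of_mult subset_iff)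
  from group_hom.img_is_subgroup[OF this] show ?thesis by simp
qed

text \<open>Plays the role of \<open>e\<close> and \<open>f\<close> in
  \<open>square_zero_pair\<close>: for a quadratic \<open>g\<close> it squares to zero.\<close>

definition dif :: "'a \<Rightarrow> 'a \<Rightarrow> 'a" where "dif g = act g \<ominus>\<^bsub>E\<^esub> \<one>\<^bsub>E\<^esub>"

lemma dif_closed: "g \<in> normalizer G V \<Longrightarrow> dif g \<in> carrier E"
  by (simp add: dif_def act_closed)

lemma dif_apply: "g \<in> normalizer G V \<Longrightarrow> a \<in> V \<Longrightarrow> dif g a = conj_by G g a \<otimes> inv a"
  by (simp add: dif_def a_minus_def endo_ring_simps A.endo_ring_a_inv_apply inv_A)

lemma act_eq: "g \<in> normalizer G V \<Longrightarrow> act g = \<one>\<^bsub>E\<^esub> \<oplus>\<^bsub>E\<^esub> dif g"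
  using act_closed[of g] E.add.m_lcomm[of "\<one>\<^bsub>E\<^esub>" "act g" "\<ominus>\<^bsub>E\<^esub> \<one>\<^bsub>E\<^esub>"]
  by (simp add: dif_def E.minus_eq E.r_neg)

lemma dif_in_V: "g \<in> normalizer G V \<Longrightarrow> a \<in> V \<Longrightarrow> dif g a \<in> V"
  by (simp add: dif_apply norm_V)

lemma dif_mult: "g \<in> normalizer G V \<Longrightarrow> a \<in> V \<Longrightarrow> b \<in> V \<Longrightarrow> dif g (a \<otimes> b) = dif g a \<otimes> dif g b"
  using A.endo_ring_apply_mult[OF dif_closed, of g a b] by simp

lemma dif_inv: "g \<in> normalizer G V \<Longrightarrow> a \<in> V \<Longrightarrow> dif g (inv a) = inv (dif g a)"
  using A.endo_ring_apply_inv[OF dif_closed, of g a] by (simp add: inv_A dif_in_V)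

lemma dif_one: "g \<in> normalizer G V \<Longrightarrow> dif g \<one> = \<one>"
  using A.endo_ring_apply_one[OF dif_closed, of g] by simp

lemma conj_by_eq_dif: "g \<in> normalizer G V \<Longrightarrow> a \<in> V \<Longrightarrow> conj_by G g a = dif g a \<otimes> a"
  by (simp add: dif_apply m_assoc norm_V)

definition quadratic :: "'a \<Rightarrow> bool" where
  "quadratic g \<longleftrightarrow> g \<in> normalizer G V \<and> (\<forall>a\<in>V. dif g (dif g a) = \<one>)"

lemma quadratic_dif_sq:
  assumes "quadratic g"
  shows "dif g \<otimes>\<^bsub>E\<^esub> dif g = \<zero>\<^bsub>E\<^esub>"
  using assms
  by (intro endo_ring_eqI[of _ A]) (auto simp: quadratic_def endo_ring_simps dif_closed)

text \<open>An element \<open>a\<close> of order \<open>p\<close> killed by \<open>e\<close> spans, together with \<open>-f(a)\<close>, a natural module for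
  the group generated by \<open>1 + e\<close> and \<open>1 + f\<close>, since \<open>ef + fe = -1\<close>.\<close>

lemma sl2_section_of_surjective:
  assumes "odd p" and x: "quadratic x" and y: "quadratic y"
    and surj: "\<And>a. a \<in> V \<Longrightarrow> \<exists>b\<in>V. a = dif x (dif y b) \<otimes> dif y (dif x b)"
    and "V \<noteq> {\<one>}"
  obtains R where "sl2_section p G R"
proof -
  have xN: "x \<in> normalizer G V" and yN: "y \<in> normalizer G V"
    using x y by (auto simp: quadratic_def)
  let ?L = "generate G {x, y}"
  have xyG: "{x, y} \<subseteq> carrier G" using xN yN norm_V by auto
  have subL: "subgroup ?L G" by (rule generate_is_subgroup[OF xyG])
  have LN: "?L \<subseteq> normalizer G V"
    by (rule generate_subgroup_incl[OF _ subgroup_normalizer[OF subgroup_V]]) (use xN yN in simp)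
  define e where "e = dif x"
  define f where "f = dif y"
  define z where "z = e \<otimes>\<^bsub>E\<^esub> f \<oplus>\<^bsub>E\<^esub> f \<otimes>\<^bsub>E\<^esub> e"
  have ef: "e \<in> carrier E" "f \<in> carrier E" using xN yN by (simp_all add: e_def f_def dif_closed)
  have zE: "z \<in> carrier E" using ef by (simp add: z_def)
  have finV: "finite V" using finite_subgroup subgroup_V by blast
  have zV: "z ` V = V"
  proof
    show "z ` V \<subseteq> V" using A.endo_ring_apply_closed[OF zE] by auto
    show "V \<subseteq> z ` V"
    proof
      fix a assume "a \<in> V"
      then obtain b where b: "b \<in> V" "a = dif x (dif y b) \<otimes> dif y (dif x b)" using surj by blast
      then have "a = z b"
        using xN yN by (simp add: z_def e_def f_def endo_ring_simps dif_in_V)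
      with b show "a \<in> z ` V" by blast
    qed
  qed
  then have "bij_betw z V V"
    using finV by (simp add: bij_betw_def eq_card_imp_inj_on)
  then have "z \<in> Units E"
    using A.endo_ring_bij_unit[OF zE] by simp
  then obtain u where u: "u \<in> carrier E" "u \<otimes>\<^bsub>E\<^esub> z = \<one>\<^bsub>E\<^esub>" "z \<otimes>\<^bsub>E\<^esub> u = \<one>\<^bsub>E\<^esub>"
    by (auto simp: Units_def)
  have "square_zero_pair E e f z u"
  proof
    show "f \<otimes>\<^bsub>E\<^esub> e = z \<oplus>\<^bsub>E\<^esub> \<ominus>\<^bsub>E\<^esub> (e \<otimes>\<^bsub>E\<^esub> f)"
      using ef E.a_comm[of z "\<ominus>\<^bsub>E\<^esub> (e \<otimes>\<^bsub>E\<^esub> f)"] zE by (simp add: z_def E.r_neg1)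
  qed (use ef zE u x y in \<open>simp_all add: e_def f_def quadratic_dif_sq\<close>)
  then have pair: "E.transvection_pair (act x) (act y)"
    using act_eq xN yN by (auto simp: E.transvection_pair_def e_def f_def)
  \<comment> \<open>\<open>card V\<close> is a power of the odd prime \<open>p\<close> and
    annihilates the ring, so it serves as the odd exponent \<open>m\<close>.\<close>
  have cardV: "odd (card V)"
    using p_subgroup_V \<open>odd p\<close> by (auto simp: p_subgroup_def)
  have exponent: "[card V] \<cdot>\<^bsub>E\<^esub> g = \<zero>\<^bsub>E\<^esub>" if g: "g \<in> carrier E" for g
  proof (rule endo_ring_eqI[of _ A])
    fix a assume a: "a \<in> carrier A"
    have "g a \<in> carrier A" using A.endo_ring_apply_closed[OF g a] .
    then have "g a [^]\<^bsub>A\<^esub> card V = \<one>"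
      using A.pow_order_eq_1[of "g a"] by (simp add: order_def)
    then show "([card V] \<cdot>\<^bsub>E\<^esub> g) a = \<zero>\<^bsub>E\<^esub> a"
      using a g by (simp add: A.endo_ring_add_pow_apply endo_ring_simps)
  qed (use g in simp_all)
  obtain e' f' where ef': "\<one>\<^bsub>E\<^esub> \<oplus>\<^bsub>E\<^esub> e' \<in> act ` ?L" "\<one>\<^bsub>E\<^esub> \<oplus>\<^bsub>E\<^esub> f' \<in> act ` ?L"
    "e' \<in> carrier E" "f' \<in> carrier E" "e' \<otimes>\<^bsub>E\<^esub> e' = \<zero>\<^bsub>E\<^esub>" "f' \<otimes>\<^bsub>E\<^esub> f' = \<zero>\<^bsub>E\<^esub>"
    "e' \<otimes>\<^bsub>E\<^esub> f' \<oplus>\<^bsub>E\<^esub> f' \<otimes>\<^bsub>E\<^esub> e' = \<ominus>\<^bsub>E\<^esub> \<one>\<^bsub>E\<^esub>"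
  proof (rule E.exists_sl2_pair[OF subgroup_act_image[OF subL LN] _ cardV exponent _ _ pair])
    show "finite (act ` ?L)" using finite_subgroup[OF subL] by simp
    show "act x \<in> act ` ?L" "act y \<in> act ` ?L" by (auto intro: generate.incl)
  qed
  then obtain x' y' where x': "x' \<in> ?L" "\<one>\<^bsub>E\<^esub> \<oplus>\<^bsub>E\<^esub> e' = act x'" and y': "y' \<in> ?L" "\<one>\<^bsub>E\<^esub> \<oplus>\<^bsub>E\<^esub> f' = act y'"
    by auto
  have cl: "e' a \<in> V" "f' a \<in> V" if "a \<in> V" for a
    using that A.endo_ring_apply_closed[OF ef'(3)] A.endo_ring_apply_closed[OF ef'(4)] by auto
  have conj: "conj_by G x' a = a \<otimes> e' a" "conj_by G y' a = a \<otimes> f' a" if "a \<in> V" for a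
    using fun_cong[OF x'(2), of a] fun_cong[OF y'(2), of a] that by (simp_all add: endo_ring_simps)
  have sq: "e' (e' a) = \<one>" "f' (f' a) = \<one>" if "a \<in> V" for a
    using fun_cong[OF ef'(5), of a] fun_cong[OF ef'(6), of a] that by (simp_all add: endo_ring_simps)
  have anti: "e' (f' a) \<otimes> f' (e' a) = inv a" if "a \<in> V" for a
    using fun_cong[OF ef'(7), of a] that
    by (simp add: endo_ring_simps A.endo_ring_a_inv_apply inv_A)
  \<comment> \<open>If \<open>e'\<close> vanished, \<open>e'f' + f'e' = -1\<close> would make
    \<open>V\<close> trivial. A nontrivial value of \<open>e'\<close> is killed by \<open>e'\<close>
    in turn.\<close>
  have "\<exists>a\<in>V. e' a \<noteq> \<one>"
  proof (rule ccontr)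
    assume "\<not> ?thesis"
    then have triv: "e' a = \<one>" if "a \<in> V" for a using that by blast
    have "a = \<one>" if "a \<in> V" for a
    proof -
      have "f' \<one> = \<one>" using A.endo_ring_apply_one[OF ef'(4)] by simp
      then have "inv a = \<one>" using anti[OF that] that by (simp add: triv cl)
      then show ?thesis using that by simp
    qed
    with \<open>V \<noteq> {\<one>}\<close> show False using V_closed(3) by blast
  qed
  then obtain c where c: "c \<in> V" "c \<noteq> \<one>" "e' c = \<one>"
    using cl sq by blast
  obtain n where n: "card V = p ^ n" using p_subgroup_V by (auto simp: p_subgroup_def)
  have "c [^] (p ^ n) = \<one>"
    using subgroup_pow_card[OF subgroup_V c(1)] n by simp
  \<comment> \<open>\<open>V\<close> is not assumed to be elementary abelian; the last nontrivial
    \<open>p\<close>-power of \<open>c\<close> has order \<open>p\<close> and is still killed by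
    \<open>e'\<close>.\<close>
  then have "\<exists>k. c [^] (p ^ k) \<noteq> \<one> \<and> c [^] (p ^ Suc k) = \<one>"
  proof (induction n)
    case (Suc n)
    then show ?case by (cases "c [^] (p ^ n) = \<one>") auto
  qed (use c in simp)
  then obtain k where k: "c [^] (p ^ k) \<noteq> \<one>" "c [^] (p ^ Suc k) = \<one>" by blast
  define a where "a = c [^] (p ^ k)"
  define b where "b = inv (f' a)"
  have aV: "a \<in> V" unfolding a_def by (rule subgroup_pow_closed[OF subgroup_V c(1)])
  have bV: "b \<in> V" using aV cl by (simp add: b_def)
  have hom_pow: "g (t [^] (j::nat)) = g t [^] j" if "g \<in> carrier E" "t \<in> V" for g t j
    using that A.endo_ring_apply_one[of g] A.endo_ring_apply_mult[of g] subgroup_pow_closed[OF subgroup_V]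
    by (induction j) (simp_all)
  have a: "a \<noteq> \<one>" "a [^] p = \<one>" "e' a = \<one>"
    using k c hom_pow[OF ef'(3)] by (simp_all add: a_def nat_pow_pow mult.commute)
  have b: "b [^] p = \<one>"
    using hom_pow[OF ef'(4) aV, of p] a aV cl A.endo_ring_apply_one[OF ef'(4)]
    by (simp add: b_def nat_pow_inv)
  have ef_a: "e' (f' a) = inv a"
    using anti[OF aV] a A.endo_ring_apply_one[OF ef'(4)] aV cl by simp
  have e'b: "e' b = a"
    using A.endo_ring_apply_inv[OF ef'(3), of "f' a"] aV cl ef_a by (simp add: b_def inv_A)
  have f'b: "f' b = \<one>"
    using A.endo_ring_apply_inv[OF ef'(4), of "f' a"] aV cl sq by (simp add: b_def inv_A)
  show ?thesis
  proof (rule sl2_section_of_basis[of a b x' y'])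
    show "x' \<in> carrier G" "y' \<in> carrier G" using x' y' generate_in_carrier[OF xyG] by auto
    show "conj_by G x' a = a" using conj aV a by simp
    show "conj_by G x' b = a \<otimes> b" using conj bV e'b aV commute_V by simp
    show "conj_by G y' a = a \<otimes> inv b" using conj aV cl by (simp add: b_def)
    show "conj_by G y' b = b" using conj bV f'b by simp
  qed (use aV bV a b commute_V that in auto)
qed

text \<open>Additively \<open>(x - 1)V + (y - 1)V\<close>; it contains the commutators of
  \<open>V\<close> with the whole group generated by \<open>x\<close> and \<open>y\<close>.\<close>

definition dif_span :: "'a \<Rightarrow> 'a \<Rightarrow> 'a set" where
  "dif_span x y = {dif x a \<otimes> dif y b | a b. a \<in> V \<and> b \<in> V}"

lemma dif_spanI: "a \<in> V \<Longrightarrow> b \<in> V \<Longrightarrow> dif x a \<otimes> dif y b \<in> dif_span x y"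
  by (auto simp: dif_span_def)

lemma dif_span_subset:
  "x \<in> normalizer G V \<Longrightarrow> y \<in> normalizer G V \<Longrightarrow> dif_span x y \<subseteq> V"
  by (auto simp: dif_span_def dif_in_V)

lemma dif_span_commute:
  assumes "x \<in> normalizer G V" "y \<in> normalizer G V"
  shows "dif_span x y = dif_span y x"
  using assms commute_V by (auto simp: dif_span_def) (metis dif_in_V)+

lemma m_left_comm_V: "a \<in> V \<Longrightarrow> b \<in> V \<Longrightarrow> c \<in> V \<Longrightarrow> a \<otimes> (b \<otimes> c) = b \<otimes> (a \<otimes> c)"
  using commute_V[of a b] by (simp add: m_assoc[symmetric])

lemma subgroup_dif_span:
  assumes x: "x \<in> normalizer G V" and y: "y \<in> normalizer G V"
  shows "subgroup (dif_span x y) G"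
proof (rule subgroupI)
  show "dif_span x y \<subseteq> carrier G" using dif_span_subset[OF x y] by auto
  show "dif_span x y \<noteq> {}" using dif_spanI[of \<one> \<one> x y] by auto
next
  fix s assume "s \<in> dif_span x y"
  then obtain a b where s: "a \<in> V" "b \<in> V" "s = dif x a \<otimes> dif y b" by (auto simp: dif_span_def)
  then have "inv s = dif x (inv a) \<otimes> dif y (inv b)"
    using x y commute_V by (simp add: dif_inv dif_in_V inv_mult_group)
  then show "inv s \<in> dif_span x y" using s by (simp add: dif_spanI)
next
  fix s t assume "s \<in> dif_span x y" "t \<in> dif_span x y"
  then obtain a b c d where st: "a \<in> V" "b \<in> V" "s = dif x a \<otimes> dif y b"
    "c \<in> V" "d \<in> V" "t = dif x c \<otimes> dif y d" by (auto simp: dif_span_def)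
  then have "s \<otimes> t = dif x (a \<otimes> c) \<otimes> dif y (b \<otimes> d)"
    using x y m_left_comm_V[of "dif y b" "dif x c"] by (simp add: dif_mult dif_in_V m_assoc)
  then show "s \<otimes> t \<in> dif_span x y" using st by (simp add: dif_spanI)
qed

lemma dif_span_normalized:
  assumes x: "quadratic x" and y: "quadratic y"
  shows "x \<in> normalizer G (dif_span x y)"
proof -
  have N: "x \<in> normalizer G V" "y \<in> normalizer G V" using x y by (auto simp: quadratic_def)
  have "conj_by G x s \<in> dif_span x y" if "s \<in> dif_span x y" for s
  proof -
    from that obtain a b where s: "a \<in> V" "b \<in> V" "s = dif x a \<otimes> dif y b" by (auto simp: dif_span_def)
    have "conj_by G x s = dif x (dif x a) \<otimes> dif x (dif y b) \<otimes> (dif x a \<otimes> dif y b)"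
      using N s by (simp add: conj_by_eq_dif dif_in_V dif_mult)
    also have "\<dots> = dif x (dif y b \<otimes> a) \<otimes> dif y b"
      using x N s by (simp add: quadratic_def dif_in_V dif_mult m_assoc)
    finally show ?thesis using N s by (simp add: dif_spanI dif_in_V)
  qed
  then show ?thesis
    using subgroup_dif_span[OF N] N norm_V by (simp add: mem_normalizer_subgroup_iff)
qed

text \<open>\<open>x\<close> and \<open>y\<close> normalise the span and act trivially on
  \<open>V\<close> modulo it; the elements of \<open>normalizer G V\<close> with both properties
  form a subgroup \<open>T\<close>.\<close>

lemma dif_span_generate:
  assumes x: "quadratic x" and y: "quadratic y" and g: "g \<in> generate G {x, y}" and a: "a \<in> V"
  shows "conj_by G g a \<otimes> inv a \<in> dif_span x y"
proof -
  let ?I = "dif_span x y"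
  have N: "x \<in> normalizer G V" "y \<in> normalizer G V" using x y by (auto simp: quadratic_def)
  have NI: "x \<in> normalizer G ?I" "y \<in> normalizer G ?I"
    using dif_span_normalized[OF x y] dif_span_normalized[OF y x] dif_span_commute N by auto
  note subI = subgroup_dif_span[OF N]
  define T where "T = {g \<in> normalizer G V \<inter> normalizer G ?I. \<forall>a\<in>V. conj_by G g a \<otimes> inv a \<in> ?I}"
  note subNN = subgroups_Inter_pair[OF subgroup_normalizer[OF subgroup_V] subgroup_normalizer[OF subI]]
  have NN: "g \<in> carrier G" "\<And>a. a \<in> V \<Longrightarrow> conj_by G g a \<in> V" "\<And>a. a \<in> ?I \<Longrightarrow> conj_by G g a \<in> ?I"
    if "g \<in> normalizer G V \<inter> normalizer G ?I" for g
    using that norm_V mem_normalizerD(2)[OF subI] by auto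
  have "subgroup T G"
  proof (rule subgroupI)
    show "T \<subseteq> carrier G" using NN by (auto simp: T_def)
    have "\<one> \<in> T"
      using subgroup.one_closed[OF subNN] subgroup.one_closed[OF subI] by (auto simp: T_def)
    then show "T \<noteq> {}" by blast
  next
    fix g assume g: "g \<in> T"
    then have gN: "g \<in> normalizer G V \<inter> normalizer G ?I" by (simp add: T_def)
    have giN: "inv g \<in> normalizer G V \<inter> normalizer G ?I"
      using subgroup.m_inv_closed[OF subNN gN] .
    have "conj_by G (inv g) a \<otimes> inv a \<in> ?I" if a: "a \<in> V" for a
    proof -
      let ?s = "conj_by G g a \<otimes> inv a"
      have s: "?s \<in> ?I" using g a by (simp add: T_def)
      have "conj_by G (inv g) (inv ?s) = conj_by G (inv g) a \<otimes> inv a"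
        using a NN(1,2)[OF gN] by (simp add: inv_mult_group conj_by_mult conj_by_inv)
      moreover have "conj_by G (inv g) (inv ?s) \<in> ?I"
        using NN(3)[OF giN subgroup.m_inv_closed[OF subI s]] .
      ultimately show ?thesis by simp
    qed
    with giN show "inv g \<in> T" by (simp add: T_def)
  next
    fix g h assume gh: "g \<in> T" "h \<in> T"
    then have gN: "g \<in> normalizer G V \<inter> normalizer G ?I" and hN: "h \<in> normalizer G V \<inter> normalizer G ?I"
      by (simp_all add: T_def)
    have "conj_by G (g \<otimes> h) a \<otimes> inv a \<in> ?I" if a: "a \<in> V" for a
    proof -
      let ?s = "conj_by G h a \<otimes> inv a"
      have s: "?s \<in> ?I" "conj_by G g a \<otimes> inv a \<in> ?I" using gh a by (simp_all add: T_def)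
      have "conj_by G (g \<otimes> h) a \<otimes> inv a = conj_by G g ?s \<otimes> (conj_by G g a \<otimes> inv a)"
        using a NN(1,2)[OF gN] NN(1,2)[OF hN]
        by (simp add: conj_by_mult conj_by_inv conj_by_conj_by m_assoc) (simp add: m_assoc[symmetric])
      then show ?thesis
        using subgroup.m_closed[OF subI NN(3)[OF gN s(1)] s(2)] by simp
    qed
    with subgroup.m_closed[OF subNN gN hN] show "g \<otimes> h \<in> T" by (simp add: T_def)
  qed
  moreover have "{x, y} \<subseteq> T"
    using N NI dif_spanI[of _ \<one> x y] dif_spanI[of \<one> _ x y]
    by (auto simp: T_def dif_apply[symmetric] dif_one dif_in_V)
  ultimately have "generate G {x, y} \<subseteq> T"
    by (intro generate_subgroup_incl)
  with g a show ?thesis by (auto simp: T_def)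
qed

text \<open>Write \<open>e\<close>, \<open>f\<close> for \<open>x - 1\<close>, \<open>y - 1\<close>.
  Substituting \<open>V = eV + fV\<close> into itself twice and using \<open>ee = ff = 0\<close>
  gives \<open>a = efe u1 + fef v2\<close>, which is \<open>(ef + fe)(e u1 + f v2)\<close>.\<close>

lemma surjective_of_dif_span_eq:
  assumes x: "quadratic x" and y: "quadratic y" and span: "dif_span x y = V" and a: "a \<in> V"
  shows "\<exists>b\<in>V. a = dif x (dif y b) \<otimes> dif y (dif x b)"
proof -
  have N: "x \<in> normalizer G V" "y \<in> normalizer G V" using x y by (auto simp: quadratic_def)
  have ex: "\<exists>b\<in>V. \<exists>c\<in>V. s = dif x b \<otimes> dif y c" if "s \<in> V" for s
  proof -
    from that have "s \<in> dif_span x y" using span by simp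
    then show ?thesis by (auto simp: dif_span_def)
  qed
  have sq: "dif x (dif x s) = \<one>" "dif y (dif y s) = \<one>" if "s \<in> V" for s
    using x y that by (auto simp: quadratic_def)
  obtain s t where st: "s \<in> V" "t \<in> V" "a = dif x s \<otimes> dif y t" using ex a by blast
  obtain s1 s2 where s: "s1 \<in> V" "s2 \<in> V" "s = dif x s1 \<otimes> dif y s2" using ex st by blast
  obtain t1 t2 where t: "t1 \<in> V" "t2 \<in> V" "t = dif x t1 \<otimes> dif y t2" using ex st by blast
  obtain u1 u2 where u: "u1 \<in> V" "u2 \<in> V" "s2 = dif x u1 \<otimes> dif y u2" using ex s by blast
  obtain v1 v2 where v: "v1 \<in> V" "v2 \<in> V" "t1 = dif x v1 \<otimes> dif y v2" using ex t by blast
  let ?c = "dif x u1 \<otimes> dif y v2"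
  note simps = N dif_mult dif_in_V sq dif_one s(1,2) t(1,2) u(1,2) v(1,2)
  have "a = dif x (dif y (dif x u1)) \<otimes> dif y (dif x (dif y v2))"
    unfolding st(3) s(3) t(3) u(3) v(3) by (simp add: simps)
  also have "\<dots> = dif x (dif y ?c) \<otimes> dif y (dif x ?c)"
    by (simp add: simps)
  finally show ?thesis
    by (intro bexI[of _ ?c]) (simp_all add: simps)
qed

end

context finite_group_prime
begin

text \<open>In a smallest invariant subgroup \<open>W\<close> on which \<open>h\<close> acts
  nontrivially, the span is all of \<open>W\<close>: on a smaller span \<open>h\<close> is trivial
  by minimality, modulo the span it is trivial anyway, and coprimality would make it trivial on
  \<open>W\<close>.\<close>

lemma sl2_section_of_quadratic_pair:
  assumes "odd p" and V: "p_subgroup p G V" and comm: "\<And>a b. a \<in> V \<Longrightarrow> b \<in> V \<Longrightarrow> a \<otimes> b = b \<otimes> a"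
    and xN: "x \<in> normalizer G V" and yN: "y \<in> normalizer G V"
    and qx: "\<And>a. a \<in> V \<Longrightarrow> conj_by G x (conj_by G x a \<otimes> inv a) = conj_by G x a \<otimes> inv a"
    and qy: "\<And>a. a \<in> V \<Longrightarrow> conj_by G y (conj_by G y a \<otimes> inv a) = conj_by G y a \<otimes> inv a"
    and h: "h \<in> generate G {x, y}" "\<And>a. a \<in> V \<Longrightarrow> conj_by G (h [^] (r::nat)) a = a" "coprime r p"
    and nontriv: "\<exists>a\<in>V. conj_by G h a \<noteq> a"
  obtains R where "sl2_section p G R"
proof -
  let ?P = "\<lambda>W. subgroup W G \<and> W \<subseteq> V \<and> x \<in> normalizer G W \<and> y \<in> normalizer G W \<and> (\<exists>a\<in>W. conj_by G h a \<noteq> a)"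
  have "?P V" using V xN yN nontriv by (simp add: p_subgroup_def)
  then have "\<exists>W. ?P W \<and> (\<forall>W'. ?P W' \<longrightarrow> card W \<le> card W')"
    by (rule ex_has_least_nat)
  then obtain W where W: "?P W" and min: "\<And>W'. ?P W' \<Longrightarrow> card W \<le> card W'" by blast
  have "p_subgroup p G W" using p_subgroup_subset[OF prime_p V] W by blast
  then interpret W: abelian_p_subgroup G p W
    using W comm by unfold_locales auto
  have N: "x \<in> normalizer G W" "y \<in> normalizer G W" using W by auto
  have q: "W.quadratic x" "W.quadratic y"
    unfolding W.quadratic_def using N W qx qy
    by (auto simp: W.dif_apply W.dif_in_V r_inv W.norm_V subset_iff)
  have xyG: "{x, y} \<subseteq> carrier G" using N W.norm_V by auto
  have LN: "generate G {x, y} \<subseteq> normalizer G W"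
    by (rule generate_subgroup_incl[OF _ subgroup_normalizer[OF W.subgroup_V]]) (use N in simp)
  have "W.dif_span x y = W"
  proof (rule ccontr)
    assume neq: "W.dif_span x y \<noteq> W"
    let ?I = "W.dif_span x y"
    have IW: "?I \<subset> W" using neq W.dif_span_subset[OF N] by blast
    then have "card ?I < card W"
      using finite_subgroup[OF W.subgroup_V] by (rule psubset_card_mono[rotated])
    then have "\<not> ?P ?I" using min[of ?I] by linarith
    moreover have "x \<in> normalizer G ?I" "y \<in> normalizer G ?I"
      using W.dif_span_normalized[OF q] W.dif_span_normalized[OF q(2,1)] W.dif_span_commute[OF N] by auto
    ultimately have triv: "conj_by G h a = a" if "a \<in> ?I" for a
      using that W.subgroup_dif_span[OF N] IW W by blast
    obtain a where a: "a \<in> W" "conj_by G h a \<noteq> a" using W by blast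
    let ?w = "conj_by G h a \<otimes> inv a"
    have hG: "h \<in> carrier G" using generate_in_carrier[OF xyG h(1)] .
    have wI: "?w \<in> ?I" using W.dif_span_generate[OF q h(1) a(1)] .
    then have wW: "?w \<in> W" using IW by blast
    obtain n where n: "card W = p ^ n" using W.p_subgroup_V by (auto simp: p_subgroup_def)
    have "?w [^] (p ^ n) = \<one>"
      using subgroup_pow_card[OF W.subgroup_V wW] n by simp
    then have "?w = \<one>"
      using coprime_action_fixes[OF hG _ _ triv[OF wI], of a r] a wW h W hG
      by (auto simp: m_assoc)
    then have "conj_by G h a = a"
      using a hG by (metis W.V_carrier conj_by_closed inv_closed inv_equality inv_inv)
    with a show False by simp
  qed
  then have "\<exists>b\<in>W. a = W.dif x (W.dif y b) \<otimes> W.dif y (W.dif x b)" if "a \<in> W" for a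
    using W.surjective_of_dif_span_eq[OF q _ that] by blast
  moreover have "W \<noteq> {\<one>}"
    using W generate_in_carrier[OF xyG h(1)] by auto
  ultimately show ?thesis
    using W.sl2_section_of_surjective[OF \<open>odd p\<close> q] that by blast
qed

end

section \<open>Failure of stability yields a plane\<close>

lemma (in group_hom) hom_conj_by:
  "x \<in> carrier G \<Longrightarrow> y \<in> carrier G \<Longrightarrow> h (conj_by G x y) = conj_by H (h x) (h y)"
  by (simp add: conj_by_def)

lemma (in group) conj_by_restrict:
  "subgroup H G \<Longrightarrow> x \<in> H \<Longrightarrow> conj_by (G\<lparr>carrier := H\<rparr>) x y = conj_by G x y"
  by (simp add: conj_by_def m_inv_consistent)

lemma (in group) restrict_hom_simps:
  assumes H: "subgroup H G" and hom: "group_hom (G\<lparr>carrier := H\<rparr>) Y \<pi>" and g: "g \<in> H"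
  shows "g' \<in> H \<Longrightarrow> \<pi> (g \<otimes> g') = \<pi> g \<otimes>\<^bsub>Y\<^esub> \<pi> g'"
    and "\<pi> (inv g) = inv\<^bsub>Y\<^esub> \<pi> g"
    and "g' \<in> H \<Longrightarrow> \<pi> (conj_by G g g') = conj_by Y (\<pi> g) (\<pi> g')"
    and "\<pi> (g [^] (k::nat)) = \<pi> g [^]\<^bsub>Y\<^esub> k"
proof -
  interpret \<pi>: group_hom "G\<lparr>carrier := H\<rparr>" Y \<pi> by (rule hom)
  show "g' \<in> H \<Longrightarrow> \<pi> (g \<otimes> g') = \<pi> g \<otimes>\<^bsub>Y\<^esub> \<pi> g'"
    using \<pi>.hom_mult[of g g'] g by simp
  show "\<pi> (inv g) = inv\<^bsub>Y\<^esub> \<pi> g"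
    using \<pi>.hom_inv[of g] g by (simp add: m_inv_consistent[OF H])
  show "g' \<in> H \<Longrightarrow> \<pi> (conj_by G g g') = conj_by Y (\<pi> g) (\<pi> g')"
    using \<pi>.hom_conj_by[of g g'] g by (simp add: conj_by_restrict[OF H])
  show "\<pi> (g [^] (k::nat)) = \<pi> g [^]\<^bsub>Y\<^esub> k"
    using \<pi>.hom_nat_pow[of g k] g by (simp add: nat_pow_consistent[symmetric])
qed

lemma (in group_hom) p_subgroup_image:
  assumes "prime p" "p_subgroup p G P"
  shows "p_subgroup p H (h ` P)"
proof -
  obtain n where P: "subgroup P G" "card P = p ^ n" using assms by (auto simp: p_subgroup_def)
  have sub: "subgroup (h ` P) H" using P by (simp add: subgroup_img_is_subgroup)
  interpret P: group "G\<lparr>carrier := P\<rparr>" by (rule G.subgroup_imp_group[OF P(1)])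
  interpret hP: group "H\<lparr>carrier := h ` P\<rparr>" by (rule H.subgroup_imp_group[OF sub])
  interpret f: group_hom "G\<lparr>carrier := P\<rparr>" "H\<lparr>carrier := h ` P\<rparr>" h
    using subgroup.mem_carrier[OF P(1)] by unfold_locales (auto simp: hom_def)
  let ?K = "kernel (G\<lparr>carrier := P\<rparr>) (H\<lparr>carrier := h ` P\<rparr>) h"
  have "card (carrier ((G\<lparr>carrier := P\<rparr>) Mod ?K)) = card (h ` P)"
    using iso_same_card[OF f.FactGroup_iso] by simp
  then have "card (h ` P) * card ?K = p ^ n"
    using P.lagrange[OF f.subgroup_kernel] P by (simp add: FactGroup_def order_def)
  then have "card (h ` P) dvd p ^ n" by (metis dvd_triv_left)
  then show ?thesis
    using assms(1) sub divides_primepow_nat by (auto simp: p_subgroup_def)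
qed

text \<open>Coordinates and acting elements are pulled back along \<pi>. The kernel merely acquires
  coordinates 0 modulo \<open>p\<close>, so no quotient of the preimage has to be formed.\<close>

lemma (in finite_group_prime) sl2_section_lift:
  assumes H: "subgroup H G" and hom: "group_hom (G\<lparr>carrier := H\<rparr>) Y \<pi>" and surj: "\<pi> ` H = carrier Y"
    and sec: "sl2_section p Y R"
  shows "sl2_section p G {g \<in> H. \<pi> g \<in> R}"
proof -
  interpret \<pi>: group_hom "G\<lparr>carrier := H\<rparr>" Y \<pi> by (rule hom)
  let ?R = "{g \<in> H. \<pi> g \<in> R}"
  obtain \<alpha> \<beta> x y where pc: "plane_coords p Y R \<alpha> \<beta>"
    and x: "acts_as p Y R \<alpha> \<beta> x 1 1 0 1" and y: "acts_as p Y R \<alpha> \<beta> y 1 0 (- 1) 1"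
    using sec by (auto simp: sl2_section_def)
  have subR: "subgroup R Y" using pc by (simp add: plane_coords_def)
  have HG: "g \<in> H \<Longrightarrow> g \<in> carrier G" for g using subgroup.mem_carrier[OF H] .
  note \<pi>m = restrict_hom_simps(1)[OF H hom] and \<pi>i = restrict_hom_simps(2)[OF H hom]
    and \<pi>c = restrict_hom_simps(3)[OF H hom]
  have subR': "subgroup ?R G"
  proof (rule subgroupI)
    show "?R \<noteq> {}"
      using \<pi>.hom_one subgroup.one_closed[OF H] subgroup.one_closed[OF subR] by auto
  qed (use HG H subR in \<open>auto simp: \<pi>m \<pi>i subgroup.m_closed subgroup.m_inv_closed\<close>)
  have pc': "plane_coords p G ?R (\<alpha> \<circ> \<pi>) (\<beta> \<circ> \<pi>)"
    unfolding plane_coords_def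
  proof (intro conjI)
    have lift: "\<exists>r\<in>?R. Q (\<pi> r)" if ex: "\<exists>r\<in>R. Q r" for Q
    proof -
      obtain r where r: "r \<in> R" "Q r" using ex by blast
      then obtain g where "g \<in> H" "r = \<pi> g" using surj subgroup.mem_carrier[OF subR] by (metis image_iff)
      with r show ?thesis by auto
    qed
    show "\<exists>r\<in>?R. [(\<alpha> \<circ> \<pi>) r = 1] (mod int p) \<and> [(\<beta> \<circ> \<pi>) r = 0] (mod int p)"
      "\<exists>r\<in>?R. [(\<alpha> \<circ> \<pi>) r = 0] (mod int p) \<and> [(\<beta> \<circ> \<pi>) r = 1] (mod int p)"
      using pc unfolding plane_coords_def comp_def by (intro lift; blast)+
  qed (use subR' pc in \<open>auto simp: plane_coords_def \<pi>m\<close>)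
  have lift: "\<exists>g. acts_as p G ?R (\<alpha> \<circ> \<pi>) (\<beta> \<circ> \<pi>) g a b c d" if g: "acts_as p Y R \<alpha> \<beta> m a b c d" for m a b c d
  proof -
    have m: "m \<in> normalizer Y R" using g by (simp add: acts_as_def)
    then have mY: "m \<in> carrier Y" "\<And>r. r \<in> R \<Longrightarrow> conj_by Y m r \<in> R"
      using \<pi>.H.mem_normalizerD[OF subR] by auto
    then obtain k where k: "k \<in> H" "m = \<pi> k" using surj by (metis image_iff)
    have "k \<in> normalizer G ?R"
      using k mY HG subgroup_conj_closed[OF H] subR' by (auto simp: mem_normalizer_subgroup_iff \<pi>c)
    then have "acts_as p G ?R (\<alpha> \<circ> \<pi>) (\<beta> \<circ> \<pi>) k a b c d"
      using g k by (auto simp: acts_as_def \<pi>c)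
    then show ?thesis by blast
  qed
  from lift[OF x] lift[OF y] pc' show ?thesis unfolding sl2_section_def by blast
qed

context finite_group_prime
begin

lemma group_hom_Mod:
  assumes "subgroup H G" "K \<lhd> G\<lparr>carrier := H\<rparr>"
  shows "group_hom (G\<lparr>carrier := H\<rparr>) (G\<lparr>carrier := H\<rparr> Mod K) (\<lambda>g. K #> g)"
    and "(\<lambda>g. K #> g) ` H = carrier (G\<lparr>carrier := H\<rparr> Mod K)"
    and "finite_group_prime (G\<lparr>carrier := H\<rparr> Mod K) p"
    and "g \<in> H \<Longrightarrow> K #> g = \<one>\<^bsub>G\<lparr>carrier := H\<rparr> Mod K\<^esub> \<longleftrightarrow> g \<in> K"
proof -
  interpret K: normal K "G\<lparr>carrier := H\<rparr>" by fact
  interpret Q: group "G\<lparr>carrier := H\<rparr> Mod K" by (rule K.factorgroup_is_group)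
  show "group_hom (G\<lparr>carrier := H\<rparr>) (G\<lparr>carrier := H\<rparr> Mod K) (\<lambda>g. K #> g)"
    using K.r_coset_hom_Mod by unfold_locales simp
  show im: "(\<lambda>g. K #> g) ` H = carrier (G\<lparr>carrier := H\<rparr> Mod K)"
    by (simp add: carrier_FactGroup)
  show "finite_group_prime (G\<lparr>carrier := H\<rparr> Mod K) p"
    using finite_subgroup[OF assms(1)] prime_p by unfold_locales (simp_all add: im[symmetric])
  have "subgroup K G" using incl_subgroup[OF assms(1) K.subgroup_axioms] .
  then show "K #> g = \<one>\<^bsub>G\<lparr>carrier := H\<rparr> Mod K\<^esub> \<longleftrightarrow> g \<in> K" if "g \<in> H"
    using that subgroup.mem_carrier[OF assms(1) that] coset_join1[of K g] coset_join2[of g K]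
    by auto
qed

lemma normal_restrictI:
  assumes "subgroup H G" "subgroup K G" "K \<subseteq> H" "H \<subseteq> normalizer G K"
  shows "K \<lhd> G\<lparr>carrier := H\<rparr>"
proof -
  interpret H: group "G\<lparr>carrier := H\<rparr>" by (rule subgroup_imp_group[OF assms(1)])
  show ?thesis
  proof (rule H.normal_invI)
    show "subgroup K (G\<lparr>carrier := H\<rparr>)" using assms by (simp add: subgroup_incl)
    fix x k assume x: "x \<in> carrier (G\<lparr>carrier := H\<rparr>)" and k: "k \<in> K"
    then have "conj_by G x k \<in> K"
      using mem_normalizerD(2)[OF assms(2)] assms by auto
    then show "x \<otimes>\<^bsub>G\<lparr>carrier := H\<rparr>\<^esub> k \<otimes>\<^bsub>G\<lparr>carrier := H\<rparr>\<^esub> inv\<^bsub>G\<lparr>carrier := H\<rparr>\<^esub> x \<in> K"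
      using x assms by (simp add: conj_by_def m_inv_consistent)
  qed
qed

text \<open>If \<open>K\<close> is a largest invariant subgroup of \<open>Q\<close> such that \<open>h\<close> acts nontrivially on \<open>Q/K\<close>, then \<open>h\<close>
  acts nontrivially on the centre of \<open>Q/K\<close>: otherwise it would be trivial both on the centre and
  on the quotient by it, hence on \<open>Q/K\<close> by coprimality.\<close>

lemma sl2_section_of_quadratic_pair_nonabelian:
  assumes "odd p" and Q: "p_subgroup p G Q"
    and xN: "x \<in> normalizer G Q" and yN: "y \<in> normalizer G Q"
    and qx: "\<And>a. a \<in> Q \<Longrightarrow> conj_by G x (inv a \<otimes> conj_by G x a) = inv a \<otimes> conj_by G x a"
    and qy: "\<And>a. a \<in> Q \<Longrightarrow> conj_by G y (inv a \<otimes> conj_by G y a) = inv a \<otimes> conj_by G y a"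
    and h: "h \<in> generate G {x, y}" "\<And>a. a \<in> Q \<Longrightarrow> conj_by G (h [^] (r::nat)) a = a" "coprime r p"
    and nontriv: "\<exists>a\<in>Q. conj_by G h a \<noteq> a"
  obtains R where "sl2_section p G R"
proof -
  have subQ: "subgroup Q G" using Q by (simp add: p_subgroup_def)
  have QG: "q \<in> Q \<Longrightarrow> q \<in> carrier G" for q using subgroup.mem_carrier[OF subQ] .
  have xyG: "{x, y} \<subseteq> carrier G" using xN yN normalizer_subset_carrier by blast
  have hG: "h \<in> carrier G" using generate_in_carrier[OF xyG h(1)] .
  let ?P = "\<lambda>K. subgroup K G \<and> K \<subseteq> Q \<and> Q \<subseteq> normalizer G K \<and> x \<in> normalizer G K \<and> y \<in> normalizer G K
    \<and> (\<exists>q\<in>Q. conj_by G h q \<otimes> inv q \<notin> K)"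
  have "?P {\<one>}"
  proof (intro conjI)
    show "\<exists>q\<in>Q. conj_by G h q \<otimes> inv q \<notin> {\<one>}"
      using nontriv hG QG by (metis conj_by_closed inv_closed inv_equality inv_inv singletonD)
  qed (use triv_subgroup subgroup.one_closed[OF subQ] QG xyG in \<open>auto simp: mem_normalizer_subgroup_iff\<close>)
  moreover have "\<forall>K. ?P K \<longrightarrow> card K < Suc (card Q)"
    using finite_subgroup[OF subQ] by (auto intro!: card_mono simp: less_Suc_eq_le)
  ultimately have "\<exists>K. ?P K \<and> (\<forall>K'. ?P K' \<longrightarrow> card K' \<le> card K)"
    by (rule ex_has_greatest_nat)
  then obtain K where K: "?P K" and max: "\<And>K'. ?P K' \<Longrightarrow> card K' \<le> card K" by blast
  \<comment> \<open>Everything normalising both \<open>Q\<close> and \<open>K\<close>: in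
    \<open>H/K\<close> the centre of \<open>Q/K\<close> becomes a \<open>p\<close>-subgroup
    normalised by the images of \<open>x\<close> and \<open>y\<close>.\<close>
  define H where "H = normalizer G Q \<inter> normalizer G K"
  have subK: "subgroup K G" using K by blast
  have subH: "subgroup H G"
    unfolding H_def by (intro subgroups_Inter_pair subgroup_normalizer subQ subK)
  have QH: "Q \<subseteq> H" and xyH: "x \<in> H" "y \<in> H"
    using K xN yN subgroup_subset_normalizer[OF subQ] by (auto simp: H_def)
  have KH: "K \<lhd> G\<lparr>carrier := H\<rparr>"
    by (rule normal_restrictI[OF subH subK]) (use K QH in \<open>auto simp: H_def\<close>)
  have hgen: "generate G {x, y} \<subseteq> H"
    by (rule generate_subgroup_incl[OF _ subH]) (use xyH in simp)
  then have hH: "h \<in> H" using h by blast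
  have HG: "g \<in> H \<Longrightarrow> g \<in> carrier G" for g using subgroup.mem_carrier[OF subH] .
  have HQ: "conj_by G g q \<in> Q" if "g \<in> H" "q \<in> Q" for g q
    using that mem_normalizerD(2)[OF subQ] by (auto simp: H_def)
  let ?Y = "G\<lparr>carrier := H\<rparr> Mod K"
  let ?\<pi> = "\<lambda>g. K #> g"
  interpret Y: finite_group_prime ?Y p by (rule group_hom_Mod(3)[OF subH KH])
  interpret \<pi>: group_hom "G\<lparr>carrier := H\<rparr>" ?Y ?\<pi> by (rule group_hom_Mod(1)[OF subH KH])
  define \<pi> where "\<pi> = ?\<pi>"
  have surj: "\<pi> ` H = carrier ?Y" unfolding \<pi>_def by (rule group_hom_Mod(2)[OF subH KH])
  have \<pi>Y [simp]: "\<pi> g \<in> carrier ?Y" if "g \<in> H" for g using that surj by blast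
  note hom\<pi> = group_hom_Mod(1)[OF subH KH, folded \<pi>_def]
  note \<pi>m = restrict_hom_simps(1)[OF subH hom\<pi>] and \<pi>i = restrict_hom_simps(2)[OF subH hom\<pi>]
    and \<pi>c = restrict_hom_simps(3)[OF subH hom\<pi>] and \<pi>p = restrict_hom_simps(4)[OF subH hom\<pi>]
  have \<pi>1: "\<pi> g = \<one>\<^bsub>?Y\<^esub> \<longleftrightarrow> g \<in> K" if "g \<in> H" for g
    using group_hom_Mod(4)[OF subH KH that] by (simp add: \<pi>_def)
  have Hcl: "g \<otimes> g' \<in> H" "inv g \<in> H" "conj_by G g g' \<in> H" if "g \<in> H" "g' \<in> H" for g g'
    using that subH by (simp_all add: subgroup.m_closed subgroup.m_inv_closed subgroup_conj_closed)
  have Qcl: "q \<otimes> q' \<in> Q" "inv q \<in> Q" if "q \<in> Q" "q' \<in> Q" for q q'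
    using that subQ by (simp_all add: subgroup.m_closed subgroup.m_inv_closed)
  have QH': "q \<in> H" if "q \<in> Q" for q using that QH by blast
  let ?Qb = "\<pi> ` Q"
  have "p_subgroup p (G\<lparr>carrier := H\<rparr>) Q"
    using Q subQ QH subH by (simp add: p_subgroup_def subgroup_incl)
  then have pQb: "p_subgroup p ?Y ?Qb"
    unfolding \<pi>_def by (rule \<pi>.p_subgroup_image[OF prime_p])
  then have subQb: "subgroup ?Qb ?Y" by (simp add: p_subgroup_def)
  define V where "V = {v \<in> ?Qb. \<forall>q\<in>?Qb. v \<otimes>\<^bsub>?Y\<^esub> q = q \<otimes>\<^bsub>?Y\<^esub> v}"
  have V_alt: "V = ?Qb \<inter> centralizer ?Y ?Qb"
    using subgroup.mem_carrier[OF subQb] by (auto simp: V_def centralizer_def)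
  have subV: "subgroup V ?Y"
    unfolding V_alt by (intro Y.subgroups_Inter_pair subQb Y.subgroup_centralizer subgroup.subset[OF subQb])
  have pV: "p_subgroup p ?Y V"
    by (rule Y.p_subgroup_subset[OF prime_p pQb subV]) (auto simp: V_def)
  have Qb_norm: "conj_by ?Y (\<pi> g) q \<in> ?Qb" if "g \<in> H" "q \<in> ?Qb" for g q
    using that HQ QH' by (auto simp: \<pi>c[symmetric])
  have VN: "\<pi> g \<in> normalizer ?Y V" if g: "g \<in> H" for g
  proof -
    have "\<pi> g \<in> normalizer ?Y ?Qb"
      using g Qb_norm subQb by (auto simp: Y.mem_normalizer_subgroup_iff)
    then have "conj_by ?Y (\<pi> g) v \<in> V" if "v \<in> V" for v
      using that Y.conj_by_centralizer[OF subgroup.subset[OF subQb], of "\<pi> g" v] Qb_norm[OF g]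
      by (auto simp: V_alt)
    then show ?thesis using g subV by (simp add: Y.mem_normalizer_subgroup_iff)
  qed
  have Vcomm: "a \<otimes>\<^bsub>?Y\<^esub> b = b \<otimes>\<^bsub>?Y\<^esub> a" if "a \<in> V" "b \<in> V" for a b
    using that by (auto simp: V_def)
  \<comment> \<open>The hypothesis has the inverse on the left, the result for abelian
    \<open>V\<close> has it on the right; inside the centre \<open>V\<close> the two orders
    agree.\<close>
  have quad: "conj_by ?Y (\<pi> g) (conj_by ?Y (\<pi> g) v \<otimes>\<^bsub>?Y\<^esub> inv\<^bsub>?Y\<^esub> v) = conj_by ?Y (\<pi> g) v \<otimes>\<^bsub>?Y\<^esub> inv\<^bsub>?Y\<^esub> v"
    if g: "g \<in> H" and qg: "\<And>a. a \<in> Q \<Longrightarrow> conj_by G g (inv a \<otimes> conj_by G g a) = inv a \<otimes> conj_by G g a"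
      and v: "v \<in> V" for g v
  proof -
    obtain a where a: "a \<in> Q" "v = \<pi> a" using v by (auto simp: V_def)
    have "conj_by ?Y (\<pi> g) v \<otimes>\<^bsub>?Y\<^esub> inv\<^bsub>?Y\<^esub> v = inv\<^bsub>?Y\<^esub> v \<otimes>\<^bsub>?Y\<^esub> conj_by ?Y (\<pi> g) v"
      using Vcomm[of "conj_by ?Y (\<pi> g) v" "inv\<^bsub>?Y\<^esub> v"] v subgroup.m_inv_closed[OF subV v]
        Y.mem_normalizerD(2)[OF subV VN[OF g] v] by blast
    also have "\<dots> = \<pi> (inv a \<otimes> conj_by G g a)"
      using a g QH' Hcl by (simp add: \<pi>m \<pi>i \<pi>c)
    finally have eq: "conj_by ?Y (\<pi> g) v \<otimes>\<^bsub>?Y\<^esub> inv\<^bsub>?Y\<^esub> v = \<pi> (inv a \<otimes> conj_by G g a)" .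
    show ?thesis
      unfolding eq using qg[OF a(1)] g a QH' Hcl by (simp add: \<pi>c[symmetric])
  qed
  have h': "\<pi> h \<in> generate ?Y {\<pi> x, \<pi> y}"
  proof -
    have "generate ?Y (?\<pi> ` {x, y}) = ?\<pi> ` generate (G\<lparr>carrier := H\<rparr>) {x, y}"
      by (rule \<pi>.generate_img) (use xyH in simp)
    moreover have "generate (G\<lparr>carrier := H\<rparr>) {x, y} = generate G {x, y}"
      by (rule generate_consistent[OF _ subH]) (use xyH in simp)
    ultimately show ?thesis using h by (auto simp: \<pi>_def)
  qed
  have hpow: "conj_by ?Y (\<pi> h [^]\<^bsub>?Y\<^esub> r) q = q" if "q \<in> ?Qb" for q
    using that h(2) hH QH' subgroup_pow_closed[OF subH hH] by (auto simp: \<pi>p[symmetric] \<pi>c[symmetric])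
  have hpowV: "conj_by ?Y (\<pi> h [^]\<^bsub>?Y\<^esub> r) v = v" if "v \<in> V" for v
    using that hpow by (simp add: V_def)
  have "\<exists>v\<in>V. conj_by ?Y (\<pi> h) v \<noteq> v"
  proof (rule ccontr)
    assume "\<not> ?thesis"
    then have trivV: "conj_by ?Y (\<pi> h) v = v" if "v \<in> V" for v using that by blast
    \<comment> \<open>The preimage in \<open>Q\<close> of the centre of \<open>Q/K\<close>. It
      exceeds \<open>K\<close> because a nontrivial \<open>p\<close>-group has a nontrivial centre,
      so maximality of \<open>K\<close> makes \<open>h\<close> trivial on
      \<open>Q/A\<close>.\<close>
    define A where "A = {q \<in> Q. \<pi> q \<in> V}"
    have K1: "\<pi> k = \<one>\<^bsub>?Y\<^esub>" if "k \<in> K" for k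
      using that \<pi>1[of k] K QH by blast
    have subA: "subgroup A G"
    proof (rule subgroupI)
      show "A \<noteq> {}"
        using subgroup.one_closed[OF subQ] subgroup.one_closed[OF subK] K1 subgroup.one_closed[OF subV]
        by (auto simp: A_def)
    qed (use QG QH' Qcl subV in \<open>auto simp del: mult_FactGroup simp: A_def \<pi>m \<pi>i subgroup.m_closed subgroup.m_inv_closed\<close>)
    have KA: "K \<subseteq> A"
      using K K1 subgroup.one_closed[OF subV] by (auto simp: A_def)
    have AN: "g \<in> normalizer G A" if g: "g \<in> H" for g
    proof -
      have "conj_by G g a \<in> A" if "a \<in> A" for a
        using that g HQ QH' Y.mem_normalizerD(2)[OF subV VN[OF g]]
        by (auto simp: A_def \<pi>c)
      then show ?thesis using g HG subA by (simp add: mem_normalizer_subgroup_iff)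
    qed
    have "K \<noteq> A"
    proof
      assume KA': "K = A"
      obtain n where n: "card ?Qb = p ^ n" using pQb by (auto simp: p_subgroup_def)
      interpret Qb: group "?Y\<lparr>carrier := ?Qb\<rparr>" by (rule Y.subgroup_imp_group[OF subQb])
      obtain q where q: "q \<in> Q" "conj_by G h q \<otimes> inv q \<notin> K" using K by blast
      then have "conj_by G h q \<otimes> inv q \<in> Q" using HQ[OF hH] Qcl by blast
      then have "\<pi> (conj_by G h q \<otimes> inv q) \<in> ?Qb" "\<pi> (conj_by G h q \<otimes> inv q) \<noteq> \<one>\<^bsub>?Y\<^esub>"
        using q(2) QH' \<pi>1 by blast+
      then have "carrier (?Y\<lparr>carrier := ?Qb\<rparr>) \<noteq> {\<one>\<^bsub>?Y\<lparr>carrier := ?Qb\<rparr>\<^esub>}"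
        by auto
      then obtain z where z: "z \<in> ?Qb" "z \<noteq> \<one>\<^bsub>?Y\<^esub>" "\<And>q. q \<in> ?Qb \<Longrightarrow> q \<otimes>\<^bsub>?Y\<^esub> z = z \<otimes>\<^bsub>?Y\<^esub> q"
        using Qb.p_group_center_nontrivial[OF prime_p, of n] n by (auto simp: order_def)
      then have "z \<in> V" by (auto simp: V_def)
      moreover obtain q where "q \<in> Q" "z = \<pi> q" using z by blast
      ultimately have "q \<in> K" using KA' by (auto simp: A_def)
      then show False using K1 \<open>z = \<pi> q\<close> z by simp
    qed
    then have "card K < card A"
      using KA finite_subgroup[OF subA] by (simp add: psubset_card_mono psubset_eq)
    then have "\<not> ?P A" using max[of A] by linarith
    then have inA: "conj_by G h q \<otimes> inv q \<in> A" if "q \<in> Q" for q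
      using that subA AN QH xyH by (auto simp: A_def)
    obtain q where q: "q \<in> Q" "conj_by G h q \<otimes> inv q \<notin> K" using K by blast
    let ?w = "\<pi> (conj_by G h q \<otimes> inv q)"
    have wV: "?w \<in> V" using inA[OF q(1)] by (simp add: A_def)
    have wQ: "conj_by G h q \<otimes> inv q \<in> Q" using HQ[OF hH q(1)] Qcl q(1) by blast
    obtain n where n: "card ?Qb = p ^ n" using pQb by (auto simp: p_subgroup_def)
    have "?w [^]\<^bsub>?Y\<^esub> (p ^ n) = \<one>\<^bsub>?Y\<^esub>"
      using Y.subgroup_pow_card[OF subQb, of ?w] wQ n by simp
    moreover have "conj_by ?Y (\<pi> h) (\<pi> q) = ?w \<otimes>\<^bsub>?Y\<^esub> \<pi> q"
    proof -
      have "conj_by G h q = conj_by G h q \<otimes> inv q \<otimes> q"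
        using hG QG[OF q(1)] by (simp add: m_assoc)
      then show ?thesis
        using \<pi>m[OF QH'[OF wQ] QH'[OF q(1)]] hH QH' q(1) by (simp add: \<pi>c[symmetric])
    qed
    ultimately have "?w = \<one>\<^bsub>?Y\<^esub>"
      using Y.coprime_action_fixes[OF \<pi>Y[OF hH] \<pi>Y[OF QH'[OF q(1)]] \<pi>Y[OF QH'[OF wQ]] trivV[OF wV] _ hpow _ h(3)] q(1)
      by blast
    then show False using q(2) \<pi>1 QH'[OF wQ] by blast
  qed
  from Y.sl2_section_of_quadratic_pair[OF \<open>odd p\<close> pV Vcomm VN[OF xyH(1)] VN[OF xyH(2)]
      quad[OF xyH(1) qx] quad[OF xyH(2) qy] h' hpowV h(3) this]
  obtain R where "sl2_section p ?Y R" .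
  from sl2_section_lift[OF subH group_hom_Mod(1)[OF subH KH] group_hom_Mod(2)[OF subH KH] this]
  show ?thesis using that by blast
qed

text \<open>Baer-Suzuki is applied in \<open>N_G(Q)/C_G(Q)\<close>. A nontrivial element of order
  prime to \<open>p\<close> there lifts to \<open>h\<close> outside \<open>C_G(Q)\<close> with some
  power \<open>h^r\<close> inside, which is a coprime nontrivial action on \<open>Q\<close>.\<close>

lemma sl2_section_of_not_p_stable:
  assumes "odd p" and "\<not> p_stable p G"
  obtains R where "sl2_section p G R"
proof -
  obtain Q x where Q: "p_subgroup p G Q" and x: "x \<in> normalizer G Q"
    and comm: "\<And>a. a \<in> Q \<Longrightarrow> commutator G (commutator G a x) x = \<one>"
    and notin: "centralizer G Q #> x \<notin> p_core p (G\<lparr>carrier := normalizer G Q\<rparr> Mod centralizer G Q)"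
    using assms(2) by (auto simp: p_stable_def)
  have subQ: "subgroup Q G" using Q by (simp add: p_subgroup_def)
  have QG: "q \<in> Q \<Longrightarrow> q \<in> carrier G" for q using subgroup.mem_carrier[OF subQ] .
  define N where "N = normalizer G Q"
  define C where "C = centralizer G Q"
  have subN: "subgroup N G" unfolding N_def by (rule subgroup_normalizer[OF subQ])
  have subC: "subgroup C G" unfolding C_def by (rule subgroup_centralizer[OF subgroup.subset[OF subQ]])
  have CN: "C \<subseteq> N"
    using subQ by (auto simp: C_def N_def mem_centralizer_iff subgroup.subset mem_normalizer_subgroup_iff)
  have NC: "N \<subseteq> normalizer G C"
    using subC conj_by_centralizer[OF subgroup.subset[OF subQ]] subgroup.mem_carrier[OF subN]
    by (auto simp: C_def N_def mem_normalizer_subgroup_iff)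
  have norm: "C \<lhd> G\<lparr>carrier := N\<rparr>" by (rule normal_restrictI[OF subN subC CN NC])
  let ?Y = "G\<lparr>carrier := N\<rparr> Mod C"
  define \<pi> where "\<pi> = (\<lambda>g. C #> g)"
  interpret Y: finite_group_prime ?Y p by (rule group_hom_Mod(3)[OF subN norm])
  interpret \<pi>: group_hom "G\<lparr>carrier := N\<rparr>" ?Y \<pi>
    unfolding \<pi>_def by (rule group_hom_Mod(1)[OF subN norm])
  have surj: "\<pi> ` N = carrier ?Y" unfolding \<pi>_def by (rule group_hom_Mod(2)[OF subN norm])
  have \<pi>1: "\<pi> g = \<one>\<^bsub>?Y\<^esub> \<longleftrightarrow> g \<in> C" if "g \<in> N" for g
    using group_hom_Mod(4)[OF subN norm that] by (simp add: \<pi>_def)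
  note \<pi>c = restrict_hom_simps(3)[OF subN \<pi>.group_hom_axioms]
    and \<pi>p = restrict_hom_simps(4)[OF subN \<pi>.group_hom_axioms]
  have xN: "x \<in> N" using x by (simp add: N_def)
  have "\<pi> x \<in> carrier ?Y" using surj xN by blast
  moreover have "\<pi> x \<notin> p_core p ?Y" using notin by (simp add: \<pi>_def N_def C_def)
  ultimately obtain g g' h' and r :: nat where gg': "g \<in> carrier ?Y" "g' \<in> carrier ?Y"
    and h': "h' \<in> generate ?Y {conj_by ?Y g (\<pi> x), conj_by ?Y g' (\<pi> x)}" "h' \<noteq> \<one>\<^bsub>?Y\<^esub>"
      "h' [^]\<^bsub>?Y\<^esub> r = \<one>\<^bsub>?Y\<^esub>" "coprime r p"
    by (rule Y.not_mem_p_core_obtains)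
  obtain k k' where k: "k \<in> N" "k' \<in> N" "g = \<pi> k" "g' = \<pi> k'"
    using gg' surj by (metis image_iff)
  let ?x = "conj_by G k x" and ?y = "conj_by G k' x"
  have xyN: "?x \<in> N" "?y \<in> N" using k xN subgroup_conj_closed[OF subN] by auto
  have "generate ?Y (\<pi> ` {?x, ?y}) = \<pi> ` generate (G\<lparr>carrier := N\<rparr>) {?x, ?y}"
    by (rule \<pi>.generate_img) (use xyN in simp)
  moreover have "generate (G\<lparr>carrier := N\<rparr>) {?x, ?y} = generate G {?x, ?y}"
    by (rule generate_consistent[OF _ subN]) (use xyN in simp)
  ultimately have "h' \<in> \<pi> ` generate G {?x, ?y}"
    using h'(1) k xN by (simp add: \<pi>c)
  then obtain h where h: "h \<in> generate G {?x, ?y}" "h' = \<pi> h" by blast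
  have "generate G {?x, ?y} \<subseteq> N"
    by (rule generate_subgroup_incl[OF _ subN]) (use xyN in simp)
  then have hN: "h \<in> N" using h by blast
  have hr: "h [^] r \<in> C"
    using h'(3) h(2) hN \<pi>1[of "h [^] r"] subgroup_pow_closed[OF subN hN] by (simp add: \<pi>p)
  have Cfix: "c \<in> C \<longleftrightarrow> c \<in> carrier G \<and> (\<forall>a\<in>Q. conj_by G c a = a)" for c
    unfolding C_def by (rule mem_centralizer_iff[OF subgroup.subset[OF subQ]])
  have "h \<notin> C" using h'(2) h(2) \<pi>1[OF hN] by simp
  then have nontriv: "\<exists>a\<in>Q. conj_by G h a \<noteq> a"
    using Cfix subgroup.mem_carrier[OF subN hN] by blast
  have NQ: "conj_by G n a \<in> Q" if "n \<in> N" "a \<in> Q" for n a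
    using that mem_normalizerD(2)[OF subQ] by (simp add: N_def)
  have NG: "n \<in> carrier G" if "n \<in> N" for n using subgroup.mem_carrier[OF subN that] .
  \<comment> \<open>In the convention of \<open>commutator\<close>, \<open>[x a x^-1, x]\<close> is
    the inverse of \<open>a^-1 (x a x^-1)\<close>. The double commutator condition for
    \<open>x a x^-1\<close> therefore says that \<open>x\<close> commutes with this element.\<close>
  have quad: "conj_by G x (inv a \<otimes> conj_by G x a) = inv a \<otimes> conj_by G x a" if a: "a \<in> Q" for a
  proof -
    have xG: "x \<in> carrier G" and aG: "a \<in> carrier G" using NG[OF xN] QG[OF a] by auto
    have cm: "commutator G b x = inv b \<otimes> conj_by G (inv x) b" if "b \<in> carrier G" for b
      using that xG by (simp add: commutator_def conj_by_def m_assoc)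
    define b where "b = commutator G (conj_by G x a) x"
    have b: "b = inv (conj_by G x a) \<otimes> a" "b \<in> carrier G"
      using xG aG by (simp_all add: b_def cm)
    have "inv b \<otimes> conj_by G (inv x) b = \<one>"
      using comm[OF NQ[OF xN a]] b xG by (simp add: b_def[symmetric] cm)
    then have "conj_by G (inv x) b = b"
      using b xG by (metis conj_by_closed inv_closed inv_equality inv_inv)
    then have "conj_by G x b = b"
      using conj_by_inv_conj_by(2)[OF xG b(2)] by simp
    then have "conj_by G x (inv b) = inv b"
      using xG b by (simp add: conj_by_inv)
    moreover have "inv b = inv a \<otimes> conj_by G x a"
      using xG aG by (simp add: b inv_mult_group)
    ultimately show ?thesis by simp
  qed
  have quad': "conj_by G (conj_by G n x) (inv a \<otimes> conj_by G (conj_by G n x) a) = inv a \<otimes> conj_by G (conj_by G n x) a"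
    if n: "n \<in> N" and a: "a \<in> Q" for n a
  proof -
    have nG: "n \<in> carrier G" and xG: "x \<in> carrier G" using NG n xN by auto
    define c where "c = conj_by G (inv n) a"
    have c: "c \<in> Q" unfolding c_def using NQ[OF subgroup.m_inv_closed[OF subN n] a] .
    have a_eq: "a = conj_by G n c" using nG QG[OF a] by (simp add: c_def)
    have cc: "conj_by G (conj_by G n x) (conj_by G n s) = conj_by G n (conj_by G x s)" if "s \<in> carrier G" for s
      using that nG xG by (simp add: conj_by_def m_assoc inv_mult_group) (simp add: m_assoc[symmetric])
    have "inv a \<otimes> conj_by G (conj_by G n x) a = conj_by G n (inv c \<otimes> conj_by G x c)"
      using nG xG QG[OF c] by (simp add: a_eq cc conj_by_mult conj_by_inv)
    then show ?thesis
      using quad[OF c] nG xG QG[OF c] by (simp add: cc)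
  qed
  from sl2_section_of_quadratic_pair_nonabelian[OF \<open>odd p\<close> Q xyN[unfolded N_def] quad'[OF k(1)] quad'[OF k(2)]
      h(1) _ h'(4) nontriv] hr Cfix
  show ?thesis using that by blast
qed

end

section \<open>Localising a plane\<close>

text \<open>Only the first coordinate appears; \<open>plane_coords_swap\<close> transfers the rules
  to the second. Conjugation within \<open>R\<close> has no effect because the coordinates take
  values in an abelian group.\<close>

lemma (in group) coords_simps:
  assumes pc: "plane_coords p G R \<alpha> \<beta>"
  shows "r \<in> R \<Longrightarrow> s \<in> R \<Longrightarrow> [\<alpha> (r \<otimes> s) = \<alpha> r + \<alpha> s] (mod int p)"
    and "[\<alpha> \<one> = 0] (mod int p)"
    and "r \<in> R \<Longrightarrow> [\<alpha> (inv r) = - \<alpha> r] (mod int p)"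
    and "r \<in> R \<Longrightarrow> [\<alpha> (r [^] (k::nat)) = int k * \<alpha> r] (mod int p)"
    and "n \<in> R \<Longrightarrow> r \<in> R \<Longrightarrow> [\<alpha> (conj_by G n r) = \<alpha> r] (mod int p)"
proof -
  have sub: "subgroup R G" using pc by (simp add: plane_coords_def)
  interpret R: subgroup R G by (rule sub)
  show add: "r \<in> R \<Longrightarrow> s \<in> R \<Longrightarrow> [\<alpha> (r \<otimes> s) = \<alpha> r + \<alpha> s] (mod int p)" for r s
    using pc by (simp add: plane_coords_def)
  show one: "[\<alpha> \<one> = 0] (mod int p)"
    using add[of \<one> \<one>] by (simp add: cong_iff_dvd_diff)
  show inv: "r \<in> R \<Longrightarrow> [\<alpha> (inv r) = - \<alpha> r] (mod int p)" for r
  proof -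
    assume r: "r \<in> R"
    have "[\<alpha> r + \<alpha> (inv r) = \<alpha> \<one>] (mod int p)"
      using add[of r "inv r"] r by (simp add: cong_sym)
    from cong_trans[OF this one] show "[\<alpha> (inv r) = - \<alpha> r] (mod int p)"
      by (simp add: cong_iff_dvd_diff add.commute)
  qed
  show "r \<in> R \<Longrightarrow> [\<alpha> (r [^] (k::nat)) = int k * \<alpha> r] (mod int p)"
  proof (induction k)
    case (Suc k)
    have "[\<alpha> (r [^] k \<otimes> r) = \<alpha> (r [^] k) + \<alpha> r] (mod int p)"
      using add Suc.prems subgroup_pow_closed[OF sub] by blast
    also have "[\<alpha> (r [^] k) + \<alpha> r = int k * \<alpha> r + \<alpha> r] (mod int p)"
      using Suc by (intro cong_add) simp_all
    finally show ?case by (simp add: algebra_simps)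
  qed (simp add: one)
  show "[\<alpha> (conj_by G n r) = \<alpha> r] (mod int p)" if n: "n \<in> R" and r: "r \<in> R"
  proof -
    have "[\<alpha> (n \<otimes> r \<otimes> inv n) = \<alpha> (n \<otimes> r) + \<alpha> (inv n)] (mod int p)"
      using add n r by simp
    also have "[\<alpha> (n \<otimes> r) + \<alpha> (inv n) = (\<alpha> n + \<alpha> r) + - \<alpha> n] (mod int p)"
      using add[OF n r] inv[OF n] by (rule cong_add)
    finally show ?thesis by (simp add: conj_by_def)
  qed
qed

lemma plane_coords_swap: "plane_coords p G R \<alpha> \<beta> \<Longrightarrow> plane_coords p G R \<beta> \<alpha>"
  by (auto simp: plane_coords_def)

section \<open>Matrices induced on a plane\<close>

context group
begin

lemma acts_asD:
  assumes "acts_as p G R \<alpha> \<beta> m a b c d"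
  shows "m \<in> normalizer G R" "r \<in> R \<Longrightarrow> [\<alpha> (conj_by G m r) = a * \<alpha> r + b * \<beta> r] (mod int p)"
    "r \<in> R \<Longrightarrow> [\<beta> (conj_by G m r) = c * \<alpha> r + d * \<beta> r] (mod int p)"
  using assms by (simp_all add: acts_as_def)

lemma acts_as_cong:
  assumes "acts_as p G R \<alpha> \<beta> m a b c d" "[a = a'] (mod int p)" "[b = b'] (mod int p)"
    "[c = c'] (mod int p)" "[d = d'] (mod int p)"
  shows "acts_as p G R \<alpha> \<beta> m a' b' c' d'"
proof -
  have "[s * u + t * v = s' * u + t' * v] (mod int p)"
    if "[s = s'] (mod int p)" "[t = t'] (mod int p)" for s s' t t' u v
    using that by (intro cong_add cong_mult) simp_all
  then show ?thesis
    using assms unfolding acts_as_def by (meson cong_trans)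
qed

lemma acts_as_mult:
  assumes R: "subgroup R G" and m: "acts_as p G R \<alpha> \<beta> m a b c d" and n: "acts_as p G R \<alpha> \<beta> n a' b' c' d'"
  shows "acts_as p G R \<alpha> \<beta> (m \<otimes> n) (a * a' + b * c') (a * b' + b * d') (c * a' + d * c') (c * b' + d * d')"
  unfolding acts_as_def
proof (intro conjI ballI)
  note N = acts_asD(1)[OF m] acts_asD(1)[OF n]
  show "m \<otimes> n \<in> normalizer G R"
    using subgroup.m_closed[OF subgroup_normalizer[OF R] N] .
  fix r assume r: "r \<in> R"
  note D = mem_normalizerD[OF R]
  have nr: "conj_by G n r \<in> R" using D(2)[OF N(2) r] .
  have eq: "conj_by G (m \<otimes> n) r = conj_by G m (conj_by G n r)"
    using D(1)[OF N(1)] D(1)[OF N(2)] subgroup.mem_carrier[OF R r] by (simp add: conj_by_conj_by)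
  have "[\<alpha> (conj_by G (m \<otimes> n) r) = a * (a' * \<alpha> r + b' * \<beta> r) + b * (c' * \<alpha> r + d' * \<beta> r)] (mod int p)"
    unfolding eq
    by (rule cong_trans[OF acts_asD(2)[OF m nr]]) (intro cong_add cong_mult cong_refl acts_asD[OF n] r)
  then show "[\<alpha> (conj_by G (m \<otimes> n) r) = (a * a' + b * c') * \<alpha> r + (a * b' + b * d') * \<beta> r] (mod int p)"
    by (simp add: algebra_simps)
  have "[\<beta> (conj_by G (m \<otimes> n) r) = c * (a' * \<alpha> r + b' * \<beta> r) + d * (c' * \<alpha> r + d' * \<beta> r)] (mod int p)"
    unfolding eq
    by (rule cong_trans[OF acts_asD(3)[OF m nr]]) (intro cong_add cong_mult cong_refl acts_asD[OF n] r)
  then show "[\<beta> (conj_by G (m \<otimes> n) r) = (c * a' + d * c') * \<alpha> r + (c * b' + d * d') * \<beta> r] (mod int p)"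
    by (simp add: algebra_simps)
qed

lemma acts_as_self:
  assumes pc: "plane_coords p G R \<alpha> \<beta>" and n: "n \<in> R"
  shows "acts_as p G R \<alpha> \<beta> n 1 0 0 1"
proof -
  have "subgroup R G" using pc by (simp add: plane_coords_def)
  then have "n \<in> normalizer G R" using n subgroup_subset_normalizer by blast
  then show ?thesis
    using coords_simps(5)[OF pc n] coords_simps(5)[OF plane_coords_swap[OF pc] n]
    by (simp add: acts_as_def)
qed

lemma acts_as_centralizer:
  assumes R: "subgroup R G" and c: "c \<in> centralizer G R"
  shows "acts_as p G R \<alpha> \<beta> c 1 0 0 1"
proof -
  have c': "c \<in> carrier G" "\<And>r. r \<in> R \<Longrightarrow> conj_by G c r = r"
    using c mem_centralizer_iff[OF subgroup.subset[OF R]] by auto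
  then have "conj_by G c ` R = R" by force
  then have "c \<in> normalizer G R"
    using c' by (simp add: mem_normalizer_iff subgroup.subset[OF R])
  then show ?thesis using c' by (simp add: acts_as_def)
qed

lemma acts_as_inv:
  assumes R: "subgroup R G" and m: "acts_as p G R \<alpha> \<beta> m a b c d" and det: "[a * d - b * c = 1] (mod int p)"
  shows "acts_as p G R \<alpha> \<beta> (inv m) d (- b) (- c) a"
  unfolding acts_as_def
proof (intro conjI ballI)
  note N = acts_asD(1)[OF m]
  show N': "inv m \<in> normalizer G R"
    using subgroup.m_inv_closed[OF subgroup_normalizer[OF R] N] .
  fix r assume r: "r \<in> R"
  note D = mem_normalizerD[OF R]
  define s where "s = conj_by G (inv m) r"
  have s: "s \<in> R" using D(2)[OF N' r] by (simp add: s_def)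
  have r_eq: "r = conj_by G m s"
    using D(1)[OF N] subgroup.mem_carrier[OF R r] by (simp add: s_def)
  have "[d * \<alpha> r - b * \<beta> r = d * (a * \<alpha> s + b * \<beta> s) - b * (c * \<alpha> s + d * \<beta> s)] (mod int p)"
    unfolding r_eq by (intro cong_diff cong_mult cong_refl acts_asD[OF m] s)
  also have "d * (a * \<alpha> s + b * \<beta> s) - b * (c * \<alpha> s + d * \<beta> s) = (a * d - b * c) * \<alpha> s"
    by (simp add: algebra_simps)
  also have "[(a * d - b * c) * \<alpha> s = 1 * \<alpha> s] (mod int p)"
    by (intro cong_mult det cong_refl)
  finally show "[\<alpha> (conj_by G (inv m) r) = d * \<alpha> r + - b * \<beta> r] (mod int p)"
    by (simp add: s_def cong_sym)
  have "[a * \<beta> r - c * \<alpha> r = a * (c * \<alpha> s + d * \<beta> s) - c * (a * \<alpha> s + b * \<beta> s)] (mod int p)"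
    unfolding r_eq by (intro cong_diff cong_mult cong_refl acts_asD[OF m] s)
  also have "a * (c * \<alpha> s + d * \<beta> s) - c * (a * \<alpha> s + b * \<beta> s) = (a * d - b * c) * \<beta> s"
    by (simp add: algebra_simps)
  also have "[(a * d - b * c) * \<beta> s = 1 * \<beta> s] (mod int p)"
    by (intro cong_mult det cong_refl)
  finally show "[\<beta> (conj_by G (inv m) r) = - c * \<alpha> r + a * \<beta> r] (mod int p)"
    by (simp add: s_def cong_sym algebra_simps)
qed

lemma acts_as_unipotent_pow:
  assumes R: "subgroup R G"
  shows "acts_as p G R \<alpha> \<beta> x 1 1 0 1 \<Longrightarrow> acts_as p G R \<alpha> \<beta> (x [^] (k::nat)) 1 (int k) 0 1"
    and "acts_as p G R \<alpha> \<beta> y 1 0 (- 1) 1 \<Longrightarrow> acts_as p G R \<alpha> \<beta> (y [^] (k::nat)) 1 0 (- int k) 1"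
proof -
  have one: "acts_as p G R \<alpha> \<beta> \<one> 1 0 0 1"
    by (rule acts_as_centralizer[OF R]) (use subgroup.mem_carrier[OF R] in \<open>auto simp: centralizer_def\<close>)
  show "acts_as p G R \<alpha> \<beta> x 1 1 0 1 \<Longrightarrow> acts_as p G R \<alpha> \<beta> (x [^] (k::nat)) 1 (int k) 0 1"
  proof (induction k)
    case (Suc k)
    from acts_as_mult[OF R Suc.IH[OF Suc.prems] Suc.prems] show ?case by (simp add: add.commute)
  qed (use one in simp)
  show "acts_as p G R \<alpha> \<beta> y 1 0 (- 1) 1 \<Longrightarrow> acts_as p G R \<alpha> \<beta> (y [^] (k::nat)) 1 0 (- int k) 1"
  proof (induction k)
    case (Suc k)
    from acts_as_mult[OF R Suc.IH[OF Suc.prems] Suc.prems] show ?case by (simp add: algebra_simps)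
  qed (use one in simp)
qed

text \<open>If \<open>c\<close> is invertible modulo \<open>p\<close>, the matrix is a product of an
  upper, a lower and an upper unipotent matrix. Otherwise \<open>a\<close> is invertible, and adding
  the first row to the second reduces to that case; \<open>y\<close> undoes the addition.\<close>

lemma acts_as_all_sl2:
  assumes p: "prime p" and R: "subgroup R G"
    and x: "acts_as p G R \<alpha> \<beta> x 1 1 0 1" and y: "acts_as p G R \<alpha> \<beta> y 1 0 (- 1) 1"
    and det: "[a * d - b * c = 1] (mod int p)"
  obtains m where "acts_as p G R \<alpha> \<beta> m a b c d"
proof -
  have p0: "int p > 0" using p by (simp add: prime_gt_0_nat)
  have U: "\<exists>m. acts_as p G R \<alpha> \<beta> m 1 s 0 1" for s
    using acts_as_cong[OF acts_as_unipotent_pow(1)[OF R x, of "nat (s mod int p)"], of 1 s 0 1] p0 by auto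
  have L: "\<exists>m. acts_as p G R \<alpha> \<beta> m 1 0 s 1" for s
  proof -
    have "[- int (nat (- s mod int p)) = s] (mod int p)"
      using p0 by (simp add: cong_def mod_minus_eq)
    then show ?thesis
      using acts_as_cong[OF acts_as_unipotent_pow(2)[OF R y, of "nat (- s mod int p)"], of 1 0 s 1] by auto
  qed
  have generic: "\<exists>m. acts_as p G R \<alpha> \<beta> m a b c d"
    if det: "[a * d - b * c = 1] (mod int p)" and c: "\<not> int p dvd c" for a b c d
  proof -
    have "coprime c (int p)"
      using c p by (metis coprime_commute prime_imp_coprime prime_nat_int_transfer)
    then obtain c' where c': "[c * c' = 1] (mod int p)" using cong_solve_coprime_int by blast
    \<comment> \<open>Solved from \<open>(1 s; 0 1)(1 0; c 1)(1 t; 0 1)\<close>, whose diagonal is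
      \<open>1 + sc\<close>, \<open>ct + 1\<close>; the upper right entry is then forced by the
      determinant.\<close>
    define s where "s = (a - 1) * c'"
    define t where "t = (d - 1) * c'"
    obtain m1 m2 m3 where m: "acts_as p G R \<alpha> \<beta> m1 1 s 0 1" "acts_as p G R \<alpha> \<beta> m2 1 0 c 1" "acts_as p G R \<alpha> \<beta> m3 1 t 0 1"
      using U L by blast
    have 1: "[1 + s * c = a] (mod int p)"
      using cong_add[OF cong_refl[of 1] cong_mult[OF cong_refl[of "a - 1"] c']] by (simp add: s_def algebra_simps)
    have 2: "[c * t + 1 = d] (mod int p)"
      using cong_add[OF cong_refl[of 1] cong_mult[OF cong_refl[of "d - 1"] c']] by (simp add: t_def algebra_simps)
    have "[(1 + s * c) * t + s = a * t + s] (mod int p)"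
      using 1 by (intro cong_add cong_mult cong_refl)
    also have "a * t + s = (a * d - b * c - 1) * c' + b * (c * c')"
      by (simp add: s_def t_def algebra_simps)
    also have "[\<dots> = (1 - 1) * c' + b * 1] (mod int p)"
      by (intro cong_add cong_mult cong_diff det c' cong_refl)
    finally have 3: "[(1 + s * c) * t + s = b] (mod int p)" by simp
    have "acts_as p G R \<alpha> \<beta> (m1 \<otimes> m2 \<otimes> m3) a b c d"
      using acts_as_mult[OF R acts_as_mult[OF R m(1,2)] m(3)] 1 2 3
      by (rule_tac acts_as_cong) (auto simp: algebra_simps)
    then show ?thesis by blast
  qed
  show ?thesis
  proof (cases "int p dvd c")
    case False
    then show ?thesis using generic[OF det] that by blast
  next
    case True
    have "\<not> int p dvd a"
    proof
      assume "int p dvd a"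
      with True have "int p dvd a * d - b * c" by simp
      with det have "int p dvd 1" by (metis cong_dvd_iff)
      with p show False by (simp add: prime_gt_1_nat)
    qed
    with True have "\<not> int p dvd a + c" by (simp add: dvd_add_left_iff)
    moreover have "[a * (b + d) - b * (a + c) = 1] (mod int p)"
      using det by (simp add: algebra_simps)
    ultimately obtain m where m: "acts_as p G R \<alpha> \<beta> m a b (a + c) (b + d)" using generic by blast
    obtain n where n: "acts_as p G R \<alpha> \<beta> n 1 0 (- 1) 1" using y by blast
    from acts_as_mult[OF R n m] show ?thesis using that by simp
  qed
qed

end

context finite_group_prime
begin

lemma p_subgroup_generate_p_element:
  assumes "p_element p G z"
  shows "p_subgroup p G (generate G {z})"
  using assms generate_pow_card[of z] generate_is_subgroup[of "{z}"]
  by (auto simp: p_element_def p_subgroup_def)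

text \<open>If \<open>r\<close> has order \<open>p^n m\<close> with \<open>m\<close> prime to
  \<open>p\<close>, a multiple \<open>k\<close> of \<open>m\<close> makes \<open>r^k\<close> a
  \<open>p\<close>-element. Taking \<open>k = 1\<close> modulo \<open>p\<close> preserves the
  coordinates of \<open>r\<close> and, for the prime 2, an action by \<open>-1\<close>.\<close>

lemma sylow_subgroup_contains_p_part:
  assumes N: "subgroup N G" and S: "sylow_subgroup p G N S" and r: "r \<in> N"
  obtains k g where "[k = 1] (mod p)" "g \<in> N" "conj_by G g (r [^] (k::nat)) \<in> S"
proof -
  have rG: "r \<in> carrier G" using subgroup.mem_carrier[OF N r] .
  have "ord r \<noteq> 0" using ord_ge_1[OF finite_carrier rG] by simp
  then obtain n m where nm: "ord r = p ^ n * m" "\<not> p dvd m"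
    using prime_p by (metis multiplicity_decompose' not_prime_unit)
  then have "coprime m p" using prime_p by (metis coprime_commute prime_imp_coprime_nat)
  then obtain j where j: "[m * j = 1] (mod p)" using cong_solve_coprime_nat by (metis One_nat_def)
  let ?t = "r [^] (m * j)"
  have tG: "?t \<in> carrier G" using rG by simp
  have "?t [^] (p ^ n) = (r [^] ord r) [^] j"
    using rG by (simp add: nat_pow_pow nm mult_ac)
  then have "ord ?t dvd p ^ n" using rG pow_eq_id[OF tG] by simp
  then obtain i where i: "ord ?t = p ^ i" using prime_p divides_primepow_nat by blast
  have "p_subgroup p G (generate G {?t})"
    using p_subgroup_generate_p_element i tG by (auto simp: p_element_def)
  moreover have "generate G {?t} \<subseteq> N"
    by (rule generate_subgroup_incl[OF _ N]) (use subgroup_pow_closed[OF N r] in simp)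
  ultimately obtain g where g: "g \<in> N" "conj_by G g ` generate G {?t} \<subseteq> S"
    by (rule sylow_subgroup_conj_into[OF N S])
  then have "conj_by G g ?t \<in> S" by (auto intro: generate.incl)
  with j g show ?thesis using that by blast
qed

text \<open>A Sylow subgroup of \<open>R\<close> still covers the plane, as conjugates of suitable
  powers keep their coordinates modulo \<open>p\<close>. The factors from \<open>R\<close>
  introduced by the Frattini argument act trivially on the plane, so both matrices survive.\<close>

lemma sl2_section_p_subgroup:
  assumes "sl2_section p G R"
  obtains S where "sl2_section p G S" "p_subgroup p G S"
proof -
  obtain \<alpha> \<beta> x y where pc: "plane_coords p G R \<alpha> \<beta>"
    and x: "acts_as p G R \<alpha> \<beta> x 1 1 0 1" and y: "acts_as p G R \<alpha> \<beta> y 1 0 (- 1) 1"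
    using assms by (auto simp: sl2_section_def)
  note pc' = plane_coords_swap[OF pc]
  have R: "subgroup R G" using pc by (simp add: plane_coords_def)
  obtain S where S: "sylow_subgroup p G R S" using sylow_subgroup_exists[OF R] .
  have pS: "p_subgroup p G S" and SR: "S \<subseteq> R" using S by (auto simp: sylow_subgroup_def)
  have point: "\<exists>s\<in>S. [\<alpha> s = i] (mod int p) \<and> [\<beta> s = j] (mod int p)"
    if r: "r \<in> R" "[\<alpha> r = i] (mod int p)" "[\<beta> r = j] (mod int p)" for r i j
  proof -
    obtain k g where k: "[k = 1] (mod p)" "g \<in> R" "conj_by G g (r [^] k) \<in> S"
      using sylow_subgroup_contains_p_part[OF R S r(1)] .
    have rk: "r [^] k \<in> R" using subgroup_pow_closed[OF R r(1)] .
    have k1: "[int k = 1] (mod int p)" using k(1) by (metis cong_int_iff of_nat_1)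
    have "[\<alpha> (conj_by G g (r [^] k)) = i] (mod int p)"
      using cong_trans[OF coords_simps(5)[OF pc k(2) rk]
          cong_trans[OF coords_simps(4)[OF pc r(1)] cong_mult[OF k1 r(2)]]] by simp
    moreover have "[\<beta> (conj_by G g (r [^] k)) = j] (mod int p)"
      using cong_trans[OF coords_simps(5)[OF pc' k(2) rk]
          cong_trans[OF coords_simps(4)[OF pc' r(1)] cong_mult[OF k1 r(3)]]] by simp
    ultimately show ?thesis using k by blast
  qed
  have pcS: "plane_coords p G S \<alpha> \<beta>"
    using pc point pS SR unfolding plane_coords_def p_subgroup_def by (meson subsetD)
  have "\<exists>m. acts_as p G S \<alpha> \<beta> m a b c d" if m: "acts_as p G R \<alpha> \<beta> m a b c d" for m a b c d
  proof -
    obtain n where n: "n \<in> R" "n \<otimes> m \<in> normalizer G S"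
      using frattini_argument[OF R S acts_asD(1)[OF m]] .
    have "acts_as p G R \<alpha> \<beta> (n \<otimes> m) a b c d"
      using acts_as_mult[OF R acts_as_self[OF pc n(1)] m] by simp
    then have "acts_as p G S \<alpha> \<beta> (n \<otimes> m) a b c d"
      using n SR by (auto simp: acts_as_def)
    then show ?thesis by blast
  qed
  then have "sl2_section p G S"
    using pcS x y unfolding sl2_section_def by meson
  with pS show ?thesis using that by blast
qed

text \<open>Take \<open>Q = RS\<close> with \<open>S\<close> a Sylow subgroup of \<open>C\<^sub>G(R)\<close>. The Frattini argument moves the two elements
  acting on \<open>R\<close> into \<open>N\<^sub>G(S)\<close> by factors from \<open>C\<^sub>G(R)\<close>, which do not change their action.\<close>

lemma sl2_section_p_centric:
  assumes sec: "sl2_section p G R" and pR: "p_subgroup p G R"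
  obtains Q where "p_centric p G Q" "sl2_section p (G\<lparr>carrier := normalizer G Q\<rparr>) R"
proof -
  obtain \<alpha> \<beta> x y where pc: "plane_coords p G R \<alpha> \<beta>"
    and x: "acts_as p G R \<alpha> \<beta> x 1 1 0 1" and y: "acts_as p G R \<alpha> \<beta> y 1 0 (- 1) 1"
    using sec by (auto simp: sl2_section_def)
  have R: "subgroup R G" using pc by (simp add: plane_coords_def)
  define C where "C = centralizer G R"
  have C: "subgroup C G" unfolding C_def by (rule subgroup_centralizer[OF subgroup.subset[OF R]])
  obtain S where S: "sylow_subgroup p G C S" using sylow_subgroup_exists[OF C] .
  have pS: "p_subgroup p G S" "subgroup S G" and SC: "S \<subseteq> C"
    using S by (auto simp: sylow_subgroup_def p_subgroup_def)
  have CR: "C \<subseteq> normalizer G R"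
    using acts_asD(1)[OF acts_as_centralizer[OF R]] by (auto simp: C_def)
  define Q where "Q = generate G (R \<union> S)"
  have RSG: "R \<union> S \<subseteq> carrier G" using subgroup.subset[OF R] subgroup.subset[OF pS(2)] by blast
  have subQ: "subgroup Q G" unfolding Q_def by (rule generate_is_subgroup[OF RSG])
  have RQ: "R \<subseteq> Q" and SQ: "S \<subseteq> Q" by (auto simp: Q_def intro: generate.incl)
  have pQ: "p_subgroup p G Q"
  proof -
    have "S \<subseteq> normalizer G R" using SC CR by blast
    from p_subgroup_join[OF pR pS(1) this] obtain T where T: "p_subgroup p G T" "R \<subseteq> T" "S \<subseteq> T" .
    then have "Q \<subseteq> T"
      unfolding Q_def by (intro generate_subgroup_incl) (auto simp: p_subgroup_def)
    then show ?thesis using p_subgroup_subset[OF prime_p T(1) subQ] by blast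
  qed
  have cent: "p_centric p G Q"
    unfolding p_centric_def
  proof (intro conjI allI impI pQ)
    \<comment> \<open>\<open>z\<close> lies in \<open>C\<close> and centralises \<open>S\<close>, so
      some \<open>p\<close>-subgroup \<open>T\<close> contains both. Then
      \<open>T \<inter> C\<close> is a \<open>p\<close>-subgroup of \<open>C\<close> containing the
      Sylow subgroup \<open>S\<close>, hence equal to it.\<close>
    fix z assume z: "p_element p G z \<and> z \<in> centralizer G Q"
    have zG: "z \<in> carrier G" and zQ: "\<And>q. q \<in> Q \<Longrightarrow> conj_by G z q = q"
      using z mem_centralizer_iff[OF subgroup.subset[OF subQ]] by auto
    have zC: "z \<in> C"
      using zG zQ RQ by (auto simp: C_def mem_centralizer_iff[OF subgroup.subset[OF R]])
    have "z \<in> normalizer G S"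
      using zG zQ SQ pS by (auto simp: mem_normalizer_subgroup_iff)
    then have "generate G {z} \<subseteq> normalizer G S"
      by (intro generate_subgroup_incl subgroup_normalizer pS) simp
    from p_subgroup_join[OF pS(1) p_subgroup_generate_p_element[OF conjunct1[OF z]] this]
    obtain T where T: "p_subgroup p G T" "S \<subseteq> T" "generate G {z} \<subseteq> T" .
    have zT: "z \<in> T" using T(3) by (auto intro: generate.incl)
    have "subgroup (T \<inter> C) G"
      using T C by (intro subgroups_Inter_pair) (simp_all add: p_subgroup_def)
    then have "p_subgroup p G (T \<inter> C)" using p_subgroup_subset[OF prime_p T(1)] by blast
    then have "T \<inter> C = S"
      by (rule sylow_subgroup_maximal[OF C S]) (use T SC in auto)
    then show "z \<in> Q" using zT zC SQ by blast
  qed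
  let ?N = "normalizer G Q"
  have subN: "subgroup ?N G" by (rule subgroup_normalizer[OF subQ])
  interpret N: group "G\<lparr>carrier := ?N\<rparr>" by (rule subgroup_imp_group[OF subN])
  have RN: "R \<subseteq> ?N" using RQ subgroup_subset_normalizer[OF subQ] by blast
  have "subgroup R (G\<lparr>carrier := ?N\<rparr>)" using R subN RN by (simp add: subgroup_incl)
  then have pcN: "plane_coords p (G\<lparr>carrier := ?N\<rparr>) R \<alpha> \<beta>"
    using pc by (simp add: plane_coords_def)
  have "\<exists>m. acts_as p (G\<lparr>carrier := ?N\<rparr>) R \<alpha> \<beta> m a b c d"
    if m: "acts_as p G R \<alpha> \<beta> m a b c d" for m a b c d
  proof -
    have mR: "m \<in> normalizer G R" using acts_asD(1)[OF m] .
    then have mG: "m \<in> carrier G" using normalizer_subset_carrier by blast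
    then have "m \<in> normalizer G C"
      using conj_by_centralizer[OF subgroup.subset[OF R] mR] C
      by (auto simp: mem_normalizer_subgroup_iff C_def)
    then obtain n where n: "n \<in> C" "n \<otimes> m \<in> normalizer G S"
      by (rule frattini_argument[OF C S])
    have act: "acts_as p G R \<alpha> \<beta> (n \<otimes> m) a b c d"
      using acts_as_mult[OF R acts_as_centralizer[OF R n(1)[unfolded C_def]] m] by simp
    have "n \<otimes> m \<in> normalizer G Q"
      unfolding Q_def
    proof (rule mem_normalizer_generateI[OF RSG])
      show "finite (generate G (R \<union> S))" using finite_subgroup[OF subQ] by (simp add: Q_def)
      show "n \<otimes> m \<in> carrier G" using n(2) normalizer_subset_carrier by blast
      fix d assume "d \<in> R \<union> S"
      then have "conj_by G (n \<otimes> m) d \<in> R \<union> S"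
        using mem_normalizerD(2)[OF R acts_asD(1)[OF act]]
          mem_normalizerD(2)[OF pS(2) n(2)] by blast
      then show "conj_by G (n \<otimes> m) d \<in> generate G (R \<union> S)" by (rule generate.incl)
    qed
    then have nmN: "n \<otimes> m \<in> ?N" .
    have cj: "conj_by (G\<lparr>carrier := ?N\<rparr>) (n \<otimes> m) r = conj_by G (n \<otimes> m) r" for r
      by (rule conj_by_restrict[OF subN nmN])
    have "n \<otimes> m \<in> normalizer (G\<lparr>carrier := ?N\<rparr>) R"
      using acts_asD(1)[OF act] nmN RN
      by (subst N.mem_normalizer_finite_iff)
        (auto simp: cj finite_subgroup[OF R] mem_normalizer_subgroup_iff[OF R])
    then have "acts_as p (G\<lparr>carrier := ?N\<rparr>) R \<alpha> \<beta> (n \<otimes> m) a b c d"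
      using act by (simp add: acts_as_def cj)
    then show ?thesis by blast
  qed
  then have "sl2_section p (G\<lparr>carrier := ?N\<rparr>) R"
    using pcN x y unfolding sl2_section_def by meson
  with cent show ?thesis using that by blast
qed

end

section \<open>From a plane to Qd(p)\<close>

text \<open>Arbitrary integers are accepted and reduced here, so that equality and the determinant
  condition both become congruences.\<close>

definition qd_elem :: "nat \<Rightarrow> int \<Rightarrow> int \<Rightarrow> int \<Rightarrow> int \<Rightarrow> int \<Rightarrow> int \<Rightarrow> (int \<times> int) \<times> ((int \<times> int) \<times> (int \<times> int))" where
  "qd_elem p v w a b c d =
     ((v mod int p, w mod int p), ((a mod int p, b mod int p), (c mod int p, d mod int p)))"

lemma qd_elem_eq_iff:
  "qd_elem p v w a b c d = qd_elem p v' w' a' b' c' d' \<longleftrightarrow>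
     [v = v'] (mod int p) \<and> [w = w'] (mod int p) \<and> [a = a'] (mod int p) \<and> [b = b'] (mod int p) \<and>
     [c = c'] (mod int p) \<and> [d = d'] (mod int p)"
  by (auto simp: qd_elem_def cong_def)

lemma qd_elem_mult:
  "qd_elem p v w a b c d \<otimes>\<^bsub>Qd p\<^esub> qd_elem p v' w' a' b' c' d' =
     qd_elem p (v + (a * v' + b * w')) (w + (c * v' + d * w'))
       (a * a' + b * c') (a * b' + b * d') (c * a' + d * c') (c * b' + d * d')"
proof -
  have m: "[x mod int p = x] (mod int p)" for x by simp
  show ?thesis
    by (simp add: qd_elem_def Qd_def semidirect_product_def natural_action_def SL2_def residue_ring_def
        DirProd_def Let_def mod_add_eq mod_add_right_eq mod_add_left_eq)
      (auto simp flip: cong_def intro!: cong_add cong_mult m)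
qed

lemma mem_Qd_iff:
  assumes "prime p"
  shows "((v, w), ((a, b), (c, d))) \<in> carrier (Qd p) \<longleftrightarrow>
     {v, w, a, b, c, d} \<subseteq> {0..int p - 1} \<and> [a * d - b * c = 1] (mod int p)"
proof -
  have "int p > 1" using prime_gt_1_nat[OF assms] by simp
  then interpret residues "int p" "residue_ring (int p)"
    by unfold_locales simp_all
  have "a \<otimes>\<^bsub>residue_ring (int p)\<^esub> d \<ominus>\<^bsub>residue_ring (int p)\<^esub> b \<otimes>\<^bsub>residue_ring (int p)\<^esub> c
      = (a * d - b * c) mod int p"
    by (simp add: a_minus_def res_neg_eq res_add_eq res_mult_eq mod_simps)
  then show ?thesis
    using \<open>int p > 1\<close>
    by (auto simp: Qd_def semidirect_product_def SL2_def DirProd_def Let_def res_carrier_eq res_one_eq cong_def)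
qed

lemma qd_elem_closed:
  assumes "prime p" "[a * d - b * c = 1] (mod int p)"
  shows "qd_elem p v w a b c d \<in> carrier (Qd p)"
proof -
  have "int p > 0" using assms(1) by (simp add: prime_gt_0_nat)
  then have *: "x mod int p \<in> {0..int p - 1}" for x by simp
  have "[(a mod int p) * (d mod int p) - (b mod int p) * (c mod int p) = a * d - b * c] (mod int p)"
    by (intro cong_diff cong_mult) simp_all
  then have "[(a mod int p) * (d mod int p) - (b mod int p) * (c mod int p) = 1] (mod int p)"
    using assms(2) cong_trans by blast
  with * show ?thesis by (simp add: qd_elem_def mem_Qd_iff[OF assms(1)])
qed

lemma Qd_elemE:
  assumes "prime p" "z \<in> carrier (Qd p)"
  obtains v w a b c d where "z = qd_elem p v w a b c d" "[a * d - b * c = 1] (mod int p)"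
proof -
  obtain v w a b c d where z: "z = ((v, w), ((a, b), (c, d)))"
    by (metis surj_pair)
  have "{v, w, a, b, c, d} \<subseteq> {0..int p - 1}" and det: "[a * d - b * c = 1] (mod int p)"
    using assms z mem_Qd_iff[OF assms(1)] by auto
  then have "z = qd_elem p v w a b c d" by (simp add: z qd_elem_def)
  with det show ?thesis using that by blast
qed

lemma (in group) acts_as_scalar_pow:
  assumes R: "subgroup R G" and m: "acts_as p G R \<alpha> \<beta> m (-1) 0 0 (-1)"
  shows "acts_as p G R \<alpha> \<beta> (m [^] (k::nat)) ((-1) ^ k) 0 0 ((-1) ^ k)"
proof (induction k)
  case 0
  show ?case
    using acts_as_centralizer[OF R subgroup.one_closed[OF subgroup_centralizer[OF subgroup.subset[OF R]]]]
    by simp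
next
  case (Suc k)
  from acts_as_mult[OF R Suc.IH m] show ?case by (simp add: mult.commute)
qed

text \<open>Scalar matrices are central; this later makes the elements acting as \<open>1\<close> or
  \<open>-1\<close> a normal subgroup.\<close>

lemma (in group) acts_as_conj_scalar:
  assumes R: "subgroup R G" and m: "acts_as p G R \<alpha> \<beta> m a b c d" "[a * d - b * c = 1] (mod int p)"
    and n: "acts_as p G R \<alpha> \<beta> n e 0 0 e"
  shows "acts_as p G R \<alpha> \<beta> (conj_by G m n) e 0 0 e"
proof -
  note prod = acts_as_mult[OF R acts_as_mult[OF R m(1) n] acts_as_inv[OF R m]]
  have "[e * (a * d - b * c) = e * 1] (mod int p)" using m(2) by (intro cong_mult cong_refl)
  then show ?thesis
    unfolding conj_by_def by (intro acts_as_cong[OF prod]) (simp_all add: algebra_simps)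
qed

text \<open>To split the extension, let \<open>T\<close> be a Sylow 2-subgroup of the group \<open>D\<close> of elements acting as
  \<open>1\<close> or \<open>-1\<close>. By the Frattini argument the normaliser \<open>Y\<close> of \<open>T\<close> still induces all of \<open>SL\<^sub>2(p)\<close>,
  while an element of \<open>R\<close> normalising \<open>T\<close> is fixed, modulo the kernel of the coordinates, by an
  element acting as \<open>-1\<close>, so its coordinates vanish. Hence \<open>RY\<close> maps onto \<open>Qd(p)\<close>.\<close>

theorem (in finite_group_prime) involves_Qd_of_sl2_section:
  assumes "odd p" and sec: "sl2_section p G R"
  shows "involves G (Qd p)"
proof -
  obtain \<alpha> \<beta> x y where pc: "plane_coords p G R \<alpha> \<beta>"
    and x: "acts_as p G R \<alpha> \<beta> x 1 1 0 1" and y: "acts_as p G R \<alpha> \<beta> y 1 0 (- 1) 1"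
    using sec by (auto simp: sl2_section_def)
  note pc' = plane_coords_swap[OF pc]
  have R: "subgroup R G" using pc by (simp add: plane_coords_def)
  have RG: "r \<in> R \<Longrightarrow> r \<in> carrier G" for r using subgroup.mem_carrier[OF R] .
  \<comment> \<open>The Sylow and Frattini lemmas are needed for the prime 2 in the same
    group.\<close>
  interpret G2: finite_group_prime G 2
    by unfold_locales (use finite_carrier in simp_all)
  let ?acts = "acts_as p G R \<alpha> \<beta>"
  have actsG: "m \<in> carrier G" if "?acts m a b c d" for m a b c d
    using acts_asD(1)[OF that] normalizer_subset_carrier by blast
  define M where "M = {m. \<exists>a b c d. ?acts m a b c d \<and> [a * d - b * c = 1] (mod int p)}"
  have one: "?acts \<one> 1 0 0 1"
    by (rule acts_as_self[OF pc subgroup.one_closed[OF R]])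
  have subM: "subgroup M G"
  proof (rule subgroupI)
    show "M \<subseteq> carrier G" using actsG by (auto simp: M_def)
    show "M \<noteq> {}" using one by (force simp: M_def)
  next
    fix m assume "m \<in> M"
    then obtain a b c d where m: "?acts m a b c d" "[a * d - b * c = 1] (mod int p)" by (auto simp: M_def)
    have "[d * a - - b * - c = 1] (mod int p)" using m(2) by (simp add: mult.commute)
    with acts_as_inv[OF R m] show "inv m \<in> M" unfolding M_def by blast
  next
    fix m n assume "m \<in> M" "n \<in> M"
    then obtain a b c d a' b' c' d' where m: "?acts m a b c d" "[a * d - b * c = 1] (mod int p)"
      and n: "?acts n a' b' c' d'" "[a' * d' - b' * c' = 1] (mod int p)"
      by (auto simp: M_def)
    have "[(a * d - b * c) * (a' * d' - b' * c') = 1 * 1] (mod int p)"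
      using m(2) n(2) by (rule cong_mult)
    then have "[(a * a' + b * c') * (c * b' + d * d') - (a * b' + b * d') * (c * a' + d * c') = 1] (mod int p)"
      by (simp add: algebra_simps)
    with acts_as_mult[OF R m(1) n(1)] show "m \<otimes> n \<in> M" unfolding M_def by blast
  qed
  have MR: "M \<subseteq> normalizer G R" using acts_asD(1) by (auto simp: M_def)
  define D where "D = {m. \<exists>e\<in>{1, -1}. ?acts m e 0 0 e}"
  have subD: "subgroup D G"
  proof (rule subgroupI)
    show "D \<subseteq> carrier G" using actsG by (auto simp: D_def)
    show "D \<noteq> {}" using one by (auto simp: D_def)
  next
    fix m assume "m \<in> D"
    then obtain e where e: "e \<in> {1, -1}" "?acts m e 0 0 e" by (auto simp: D_def)
    then have "?acts (inv m) e (- 0) (- 0) e" by (intro acts_as_inv[OF R]) auto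
    with e show "inv m \<in> D" by (auto simp: D_def)
  next
    fix m n assume "m \<in> D" "n \<in> D"
    then obtain e e' where e: "e \<in> {1, -1}" "?acts m e 0 0 e" and e': "e' \<in> {1, -1}" "?acts n e' 0 0 e'"
      by (auto simp: D_def)
    have "?acts (m \<otimes> n) (e * e') 0 0 (e * e')" using acts_as_mult[OF R e(2) e'(2)] by simp
    moreover have "e * e' \<in> {1, -1}" using e(1) e'(1) by auto
    ultimately show "m \<otimes> n \<in> D" unfolding D_def by blast
  qed
  have DM: "D \<subseteq> M" unfolding D_def M_def by force
  have MD: "M \<subseteq> normalizer G D"
  proof
    fix m assume m: "m \<in> M"
    then have "conj_by G m n \<in> D" if "n \<in> D" for n
      using that acts_as_conj_scalar[OF R] unfolding M_def D_def by blast
    then show "m \<in> normalizer G D"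
      using m subgroup.mem_carrier[OF subM] by (simp add: mem_normalizer_subgroup_iff[OF subD])
  qed
  have realize: "\<exists>m. ?acts m a b c d" if "[a * d - b * c = 1] (mod int p)" for a b c d
    using acts_as_all_sl2[OF prime_p R x y that] by blast
  obtain T where T: "sylow_subgroup 2 G D T" using G2.sylow_subgroup_exists[OF subD] .
  have TD: "T \<subseteq> D" and subT: "subgroup T G" and T2: "\<exists>n. card T = 2 ^ n"
    using T by (auto simp: sylow_subgroup_def p_subgroup_def)
  obtain d0 where d0: "?acts d0 (-1) 0 0 (-1)" using realize[of "-1" "-1" 0 0] by auto
  have d0D: "d0 \<in> D" using d0 by (auto simp: D_def)
  \<comment> \<open>The odd power of \<open>d0\<close> still acts as \<open>-1\<close>, and so does
    its conjugate \<open>t\<close>, now inside \<open>T\<close>.\<close>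
  obtain k g where k: "[k = 1] (mod 2)" "g \<in> D" "conj_by G g (d0 [^] (k::nat)) \<in> T"
    using G2.sylow_subgroup_contains_p_part[OF subD T d0D] .
  define t where "t = conj_by G g (d0 [^] k)"
  have tT: "t \<in> T" using k(3) by (simp add: t_def)
  have t: "?acts t (-1) 0 0 (-1)"
  proof -
    have "odd k" using k(1) by (simp add: cong_def odd_iff_mod_2_eq_one)
    then have "?acts (d0 [^] k) (-1) 0 0 (-1)" using acts_as_scalar_pow[OF R d0, of k] by simp
    moreover obtain a b c d where "?acts g a b c d" "[a * d - b * c = 1] (mod int p)"
      using k(2) DM by (auto simp: M_def)
    ultimately show ?thesis unfolding t_def by (intro acts_as_conj_scalar[OF R])
  qed
  define Y where "Y = M \<inter> normalizer G T"
  have subY: "subgroup Y G"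
    unfolding Y_def by (intro subgroups_Inter_pair subM subgroup_normalizer subT)
  have YG: "m \<in> Y \<Longrightarrow> m \<in> carrier G" for m using subgroup.mem_carrier[OF subY] .
  have tY: "t \<in> Y"
    using tT TD DM subgroup_subset_normalizer[OF subT] by (auto simp: Y_def)
  have cover: "\<exists>m\<in>Y. ?acts m a b c d" if det: "[a * d - b * c = 1] (mod int p)" for a b c d
  proof -
    obtain m where m: "?acts m a b c d" using realize[OF det] by blast
    then have mM: "m \<in> M" using det by (auto simp: M_def)
    then obtain n where n: "n \<in> D" "n \<otimes> m \<in> normalizer G T"
      using MD G2.frattini_argument[OF subD T] by blast
    have nmY: "n \<otimes> m \<in> Y"
      using n mM DM subgroup.m_closed[OF subM] by (auto simp: Y_def)
    \<comment> \<open>The Frattini factor \<open>n\<close> acts as a sign; if it is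
      \<open>-1\<close>, multiplying by \<open>t\<close>, which also lies in \<open>Y\<close>,
      removes it.\<close>
    obtain e where e: "e \<in> {1, -1}" "?acts n e 0 0 e" using n by (auto simp: D_def)
    have nm: "?acts (n \<otimes> m) (e * a) (e * b) (e * c) (e * d)"
      using acts_as_mult[OF R e(2) m] by simp
    show ?thesis
    proof (cases "e = 1")
      case True
      with nm nmY show ?thesis by auto
    next
      case False
      with e have "e = -1" by simp
      then have "?acts (t \<otimes> (n \<otimes> m)) a b c d"
        using acts_as_mult[OF R t nm] by simp
      moreover have "t \<otimes> (n \<otimes> m) \<in> Y" using subgroup.m_closed[OF subY tY nmY] .
      ultimately show ?thesis by blast
    qed
  qed
  have normR: "conj_by G m r \<in> R" if "m \<in> Y" "r \<in> R" for m r
    using that MR mem_normalizerD(2)[OF R] by (auto simp: Y_def)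
  have zero_of: "int p dvd \<gamma> r" if pg: "plane_coords p G R \<gamma> \<delta>" and r: "r \<in> R" "r \<in> Y"
    and tg: "\<And>r. r \<in> R \<Longrightarrow> [\<gamma> (conj_by G t r) = - \<gamma> r] (mod int p)" for \<gamma> \<delta> r
  proof -
    \<comment> \<open>The commutator of \<open>r\<close> and \<open>t\<close> lies in
      \<open>R\<close> and, as \<open>r\<close> normalises \<open>T\<close>, also in
      \<open>T\<close>. Its coordinate is twice that of \<open>r\<close> and is killed by a power of
      2, so it vanishes modulo the odd prime \<open>p\<close>.\<close>
    define c where "c = r \<otimes> conj_by G t (inv r)"
    have ir: "inv r \<in> R" using subgroup.m_inv_closed[OF R r(1)] .
    have cR: "c \<in> R" unfolding c_def by (intro subgroup.m_closed[OF R r(1)] normR tY ir)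
    have tG: "t \<in> carrier G" using YG[OF tY] .
    have "c = conj_by G r t \<otimes> inv t"
      using RG[OF r(1)] tG by (simp add: c_def conj_by_def m_assoc)
    moreover have "conj_by G r t \<in> T"
      using r(2) tT mem_normalizerD(2)[OF subT] by (auto simp: Y_def)
    ultimately have cT: "c \<in> T" using subgroup_mult_inv_closed[OF subT _ tT] by simp
    obtain n where n: "card T = 2 ^ n" using T2 by blast
    have "c [^] ((2::nat) ^ n) = \<one>" using subgroup_pow_card[OF subT cT] n by simp
    then have "[int (2 ^ n) * \<gamma> c = 0] (mod int p)"
      using coords_simps(4)[OF pg cR, of "2 ^ n"] coords_simps(2)[OF pg] by (simp add: cong_def)
    moreover have "[\<gamma> c = 2 * \<gamma> r] (mod int p)"
    proof -
      have "[\<gamma> c = \<gamma> r + \<gamma> (conj_by G t (inv r))] (mod int p)"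
        unfolding c_def by (intro coords_simps(1)[OF pg] r normR tY ir)
      also have "[\<gamma> r + \<gamma> (conj_by G t (inv r)) = \<gamma> r + - (- \<gamma> r)] (mod int p)"
        using cong_trans[OF tg[OF ir] cong_uminus[OF coords_simps(3)[OF pg r(1)]]]
        by (intro cong_add cong_refl)
      finally show ?thesis by simp
    qed
    ultimately have "[int (2 ^ n) * (2 * \<gamma> r) = 0] (mod int p)"
      by (meson cong_mult cong_refl cong_sym cong_trans)
    then have "int p dvd 2 ^ Suc n * \<gamma> r" by (simp add: cong_0_iff mult_ac)
    moreover have "coprime (int p) (2 ^ Suc n)" using \<open>odd p\<close> by simp
    ultimately show ?thesis by (simp add: coprime_dvd_mult_right_iff)
  qed
  have RY: "int p dvd \<alpha> r" "int p dvd \<beta> r" if "r \<in> R" "r \<in> Y" for r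
    using zero_of[OF pc that] zero_of[OF pc' that] acts_asD(2,3)[OF t] by auto
  define P where "P = {r \<otimes> m | r m. r \<in> R \<and> m \<in> Y}"
  have mult: "(r \<otimes> m) \<otimes> (r' \<otimes> m') = (r \<otimes> conj_by G m r') \<otimes> (m \<otimes> m')"
    if "r \<in> R" "m \<in> Y" "r' \<in> R" "m' \<in> Y" for r m r' m'
    using that RG YG by (simp add: conj_by_def m_assoc) (simp add: m_assoc[symmetric])
  have mult_cl: "r \<otimes> conj_by G m r' \<in> R" "m \<otimes> m' \<in> Y"
    if "r \<in> R" "m \<in> Y" "r' \<in> R" "m' \<in> Y" for r m r' m'
    using that normR subgroup.m_closed[OF R] subgroup.m_closed[OF subY] by auto
  have subP: "subgroup P G"
  proof (rule subgroupI)
    show "P \<subseteq> carrier G" using RG YG by (auto simp: P_def)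
    show "P \<noteq> {}" using subgroup.one_closed[OF R] subgroup.one_closed[OF subY] by (auto simp: P_def)
  next
    fix g assume "g \<in> P"
    then obtain r m where g: "r \<in> R" "m \<in> Y" "g = r \<otimes> m" by (auto simp: P_def)
    have im: "inv m \<in> Y" "inv r \<in> R"
      using g subgroup.m_inv_closed[OF subY] subgroup.m_inv_closed[OF R] by auto
    have "inv g = conj_by G (inv m) (inv r) \<otimes> inv m"
      using g RG YG by (simp add: inv_mult_group conj_by_def m_assoc)
    with im normR show "inv g \<in> P" unfolding P_def by blast
  next
    fix g h assume "g \<in> P" "h \<in> P"
    then obtain r m r' m' where g: "r \<in> R" "m \<in> Y" "g = r \<otimes> m" and h: "r' \<in> R" "m' \<in> Y" "h = r' \<otimes> m'"
      unfolding P_def by blast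
    show "g \<otimes> h \<in> P"
      unfolding g(3) h(3) mult[OF g(1,2) h(1,2)] P_def using mult_cl[OF g(1,2) h(1,2)] by blast
  qed
  obtain r1 where r1: "r1 \<in> R" "[\<alpha> r1 = 1] (mod int p)" "[\<beta> r1 = 0] (mod int p)"
    using pc by (auto simp: plane_coords_def)
  obtain r2 where r2: "r2 \<in> R" "[\<alpha> r2 = 0] (mod int p)" "[\<beta> r2 = 1] (mod int p)"
    using pc by (auto simp: plane_coords_def)
  \<comment> \<open>A factorisation \<open>g = r m\<close> is not unique, but two choices of
    \<open>r\<close> differ by an element of both \<open>R\<close> and \<open>Y\<close>, whose
    coordinates vanish by \<open>RY\<close>. The matrix is read off from the images of
    \<open>r1\<close> and \<open>r2\<close>, which represent the unit vectors.\<close>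
  define rp where "rp = (\<lambda>g. SOME r. r \<in> R \<and> inv r \<otimes> g \<in> Y)"
  define \<Theta> where "\<Theta> = (\<lambda>g. qd_elem p (\<alpha> (rp g)) (\<beta> (rp g))
    (\<alpha> (conj_by G g r1)) (\<alpha> (conj_by G g r2)) (\<beta> (conj_by G g r1)) (\<beta> (conj_by G g r2)))"
  have \<Theta>: "\<Theta> (r \<otimes> m) = qd_elem p (\<alpha> r) (\<beta> r) a b c d"
    if r: "r \<in> R" and m: "m \<in> Y" "?acts m a b c d" for r m a b c d
  proof -
    let ?s = "rp (r \<otimes> m)"
    have "r \<in> R \<and> inv r \<otimes> (r \<otimes> m) \<in> Y" using r m RG YG by (simp add: m_assoc[symmetric])
    then have s: "?s \<in> R" "inv ?s \<otimes> (r \<otimes> m) \<in> Y"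
      unfolding rp_def using someI[of "\<lambda>s. s \<in> R \<and> inv s \<otimes> (r \<otimes> m) \<in> Y" r] by auto
    have "inv ?s \<otimes> r = inv ?s \<otimes> (r \<otimes> m) \<otimes> inv m"
      using s r m RG YG by (simp add: m_assoc)
    then have "inv ?s \<otimes> r \<in> Y" using subgroup_mult_inv_closed[OF subY s(2) m(1)] by simp
    moreover have sR: "inv ?s \<in> R" using subgroup.m_inv_closed[OF R s(1)] .
    then have "inv ?s \<otimes> r \<in> R" using r subgroup.m_closed[OF R] by blast
    ultimately have z: "int p dvd \<alpha> (inv ?s \<otimes> r)" "int p dvd \<beta> (inv ?s \<otimes> r)" using RY by auto
    have "[\<gamma> ?s = \<gamma> r] (mod int p)"
      if pg: "plane_coords p G R \<gamma> \<delta>" and z: "int p dvd \<gamma> (inv ?s \<otimes> r)" for \<gamma> \<delta>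
    proof -
      have "[0 = \<gamma> (inv ?s \<otimes> r)] (mod int p)" using z by (metis cong_0_iff cong_sym)
      also have "[\<gamma> (inv ?s \<otimes> r) = \<gamma> (inv ?s) + \<gamma> r] (mod int p)"
        by (rule coords_simps(1)[OF pg sR r])
      also have "[\<gamma> (inv ?s) + \<gamma> r = - \<gamma> ?s + \<gamma> r] (mod int p)"
        by (intro cong_add coords_simps(3)[OF pg s(1)] cong_refl)
      finally show ?thesis by (simp add: cong_iff_dvd_diff dvd_diff_commute)
    qed
    from this[OF pc z(1)] this[OF pc' z(2)]
    have 1: "[\<alpha> ?s = \<alpha> r] (mod int p)" "[\<beta> ?s = \<beta> r] (mod int p)" by auto
    have act: "?acts (r \<otimes> m) a b c d"
      using acts_as_mult[OF R acts_as_self[OF pc r] m(2)] by simp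
    have entry: "[i * \<alpha> s + j * \<beta> s = i * u + j * v] (mod int p)"
      if "[\<alpha> s = u] (mod int p)" "[\<beta> s = v] (mod int p)" for i j s u v
      using that by (intro cong_add cong_mult cong_refl)
    have 2: "[\<alpha> (conj_by G (r \<otimes> m) r1) = a] (mod int p)" "[\<alpha> (conj_by G (r \<otimes> m) r2) = b] (mod int p)"
      "[\<beta> (conj_by G (r \<otimes> m) r1) = c] (mod int p)" "[\<beta> (conj_by G (r \<otimes> m) r2) = d] (mod int p)"
      using cong_trans[OF acts_asD(2)[OF act r1(1)] entry[OF r1(2,3)]]
        cong_trans[OF acts_asD(2)[OF act r2(1)] entry[OF r2(2,3)]]
        cong_trans[OF acts_asD(3)[OF act r1(1)] entry[OF r1(2,3)]]
        cong_trans[OF acts_asD(3)[OF act r2(1)] entry[OF r2(2,3)]]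
      by simp_all
    show ?thesis unfolding \<Theta>_def qd_elem_eq_iff using 1 2 by simp
  qed
  have decomp: "\<exists>r m a b c d. r \<in> R \<and> m \<in> Y \<and> g = r \<otimes> m \<and> ?acts m a b c d \<and> [a * d - b * c = 1] (mod int p)"
    if "g \<in> P" for g
    using that by (auto simp: P_def Y_def M_def) blast
  have hom: "\<Theta> \<in> hom (G\<lparr>carrier := P\<rparr>) (Qd p)"
  proof (rule homI)
    fix g assume "g \<in> carrier (G\<lparr>carrier := P\<rparr>)"
    then obtain r m a b c d where g: "r \<in> R" "m \<in> Y" "g = r \<otimes> m" "?acts m a b c d" "[a * d - b * c = 1] (mod int p)"
      using decomp by fastforce
    show "\<Theta> g \<in> carrier (Qd p)"
      unfolding g(3) \<Theta>[OF g(1,2,4)] by (rule qd_elem_closed[OF prime_p g(5)])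
  next
    fix g g' assume "g \<in> carrier (G\<lparr>carrier := P\<rparr>)" "g' \<in> carrier (G\<lparr>carrier := P\<rparr>)"
    then have "g \<in> P" "g' \<in> P" by simp_all
    from decomp[OF this(1)] obtain r m a b c d
      where g: "r \<in> R" "m \<in> Y" "g = r \<otimes> m" "?acts m a b c d" by blast
    from decomp[OF \<open>g' \<in> P\<close>] obtain r' m' a' b' c' d'
      where g': "r' \<in> R" "m' \<in> Y" "g' = r' \<otimes> m'" "?acts m' a' b' c' d'" by blast
    have "\<Theta> (g \<otimes> g') = qd_elem p (\<alpha> (r \<otimes> conj_by G m r')) (\<beta> (r \<otimes> conj_by G m r'))
       (a * a' + b * c') (a * b' + b * d') (c * a' + d * c') (c * b' + d * d')"
      unfolding g(3) g'(3) mult[OF g(1,2) g'(1,2)]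
      by (rule \<Theta>[OF mult_cl[OF g(1,2) g'(1,2)] acts_as_mult[OF R g(4) g'(4)]])
    also have "\<dots> = qd_elem p (\<alpha> r + (a * \<alpha> r' + b * \<beta> r')) (\<beta> r + (c * \<alpha> r' + d * \<beta> r'))
       (a * a' + b * c') (a * b' + b * d') (c * a' + d * c') (c * b' + d * d')"
      unfolding qd_elem_eq_iff
      using cong_trans[OF coords_simps(1)[OF pc g(1) normR[OF g(2) g'(1)]]
          cong_add[OF cong_refl acts_asD(2)[OF g(4) g'(1)]]]
        cong_trans[OF coords_simps(1)[OF pc' g(1) normR[OF g(2) g'(1)]]
          cong_add[OF cong_refl acts_asD(3)[OF g(4) g'(1)]]]
      by simp
    also have "\<dots> = \<Theta> g \<otimes>\<^bsub>Qd p\<^esub> \<Theta> g'"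
      unfolding g(3) g'(3) \<Theta>[OF g(1,2,4)] \<Theta>[OF g'(1,2,4)] by (rule qd_elem_mult[symmetric])
    finally show "\<Theta> (g \<otimes>\<^bsub>G\<lparr>carrier := P\<rparr>\<^esub> g') = \<Theta> g \<otimes>\<^bsub>Qd p\<^esub> \<Theta> g'" by simp
  qed
  have surj: "\<Theta> ` P = carrier (Qd p)"
  proof
    show "\<Theta> ` P \<subseteq> carrier (Qd p)" using hom by (auto simp: hom_def)
    show "carrier (Qd p) \<subseteq> \<Theta> ` P"
    proof
      fix z assume "z \<in> carrier (Qd p)"
      then obtain v w a b c d where z: "z = qd_elem p v w a b c d" "[a * d - b * c = 1] (mod int p)"
        using Qd_elemE[OF prime_p] by metis
      obtain m where m: "m \<in> Y" "?acts m a b c d" using cover[OF z(2)] by blast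
      have p0: "int p > 0" using prime_p by (simp add: prime_gt_0_nat)
      let ?i = "nat (v mod int p)" and ?j = "nat (w mod int p)"
      have ij: "[int ?i = v] (mod int p)" "[int ?j = w] (mod int p)" using p0 by (simp_all add: cong_def)
      let ?r = "r1 [^] ?i \<otimes> r2 [^] ?j"
      have pows: "r1 [^] ?i \<in> R" "r2 [^] ?j \<in> R" using r1 r2 subgroup_pow_closed[OF R] by auto
      then have rR: "?r \<in> R" using subgroup.m_closed[OF R] by blast
      have coord: "[\<gamma> ?r = v * s + w * s'] (mod int p)"
        if pg: "plane_coords p G R \<gamma> \<delta>" and "[\<gamma> r1 = s] (mod int p)" "[\<gamma> r2 = s'] (mod int p)" for \<gamma> \<delta> s s'
        by (rule cong_trans[OF coords_simps(1)[OF pg pows]])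
          (intro cong_add cong_trans[OF coords_simps(4)[OF pg r1(1)]] cong_trans[OF coords_simps(4)[OF pg r2(1)]]
            cong_mult ij that)
      have "\<Theta> (?r \<otimes> m) = z"
        unfolding \<Theta>[OF rR m] z(1) qd_elem_eq_iff
        using coord[OF pc r1(2) r2(2)] coord[OF pc' r1(3) r2(3)] by simp
      moreover have "?r \<otimes> m \<in> P" using rR m by (auto simp: P_def)
      ultimately show "z \<in> \<Theta> ` P" by blast
    qed
  qed
  interpret P: group "G\<lparr>carrier := P\<rparr>" by (rule subgroup_imp_group[OF subP])
  have one_Qd: "\<one>\<^bsub>Qd p\<^esub> = qd_elem p 0 0 1 0 0 1"
    using prime_p prime_gt_1_nat[OF prime_p]
    by (simp add: Qd_def semidirect_product_def SL2_def residue_ring_def DirProd_def qd_elem_def Let_def)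
  have "\<Theta> (\<one> \<otimes> \<one>) = qd_elem p (\<alpha> \<one>) (\<beta> \<one>) 1 0 0 1"
    by (rule \<Theta>[OF subgroup.one_closed[OF R] subgroup.one_closed[OF subY] one])
  then have "\<Theta> \<one> = \<one>\<^bsub>Qd p\<^esub>"
    using coords_simps(2)[OF pc] coords_simps(2)[OF pc'] by (simp add: one_Qd qd_elem_eq_iff)
  \<comment> \<open>The group axioms for \<open>Qd p\<close> are inherited from \<open>P\<close>
    through the surjection.\<close>
  then have "group (Qd p)"
    using P.hom_imp_img_group[OF hom] surj by simp
  then interpret \<Theta>: group_hom "G\<lparr>carrier := P\<rparr>" "Qd p" \<Theta>
    by (simp add: group_hom_def group_hom_axioms_def P.is_group hom)
  show ?thesis
    unfolding involves_def section_of_def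
    using subP \<Theta>.normal_kernel \<Theta>.FactGroup_iso surj by auto
qed

section \<open>Instability of \<open>Qd(p)\<close>\<close>

context finite_group_prime
begin

lemma p_core_normal: "p_core p G \<lhd> G"
  unfolding p_core_def
proof (rule normal_generateI)
  show "\<Union>{N. N \<lhd> G \<and> p_subgroup p G N} \<subseteq> carrier G"
    using subgroup.subset by (fastforce simp: p_subgroup_def)
next
  fix h g assume "h \<in> \<Union>{N. N \<lhd> G \<and> p_subgroup p G N}" "g \<in> carrier G"
  then show "g \<otimes> h \<otimes> inv g \<in> \<Union>{N. N \<lhd> G \<and> p_subgroup p G N}"
    using normal_invE(2) by blast
qed

text \<open>The transvection \<open>x\<close> acts quadratically on the plane. If its coset lay in the \<open>p\<close>-core of
  \<open>SL\<^sub>2(p)\<close>, so would that of \<open>t = x l\<^sup>2\<close> for the conjugate \<open>l\<close> of \<open>x\<close>; but \<open>t\<close> has trace 0, so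
  \<open>t\<^sup>2 = -1\<close>.\<close>

theorem not_p_stable_of_iso_Qd:
  assumes "odd p" and "G \<cong> Qd p"
  shows "\<not> p_stable p G"
proof
  assume stable: "p_stable p G"
  obtain \<phi> where \<phi>: "\<phi> \<in> hom G (Qd p)" "bij_betw \<phi> (carrier G) (carrier (Qd p))"
    using assms(2) by (auto simp: is_iso_def iso_def)
  \<comment> \<open>Elements of \<open>G\<close> are named by their images in \<open>Qd p\<close>;
    with \<open>el_mult\<close> and \<open>el_eq\<close> the computations in \<open>G\<close> become
    matrix arithmetic.\<close>
  define el where "el = (\<lambda>v w a b c d. inv_into (carrier G) \<phi> (qd_elem p v w a b c d))"
  have el: "el v w a b c d \<in> carrier G" "\<phi> (el v w a b c d) = qd_elem p v w a b c d"
    if "[a * d - b * c = 1] (mod int p)" for v w a b c d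
    using qd_elem_closed[OF prime_p that, of v w] \<phi>(2)
    by (auto simp: el_def bij_betw_def inv_into_into f_inv_into_f)
  have el_eq: "el v w a b c d = el v' w' a' b' c' d' \<longleftrightarrow> qd_elem p v w a b c d = qd_elem p v' w' a' b' c' d'"
    if det: "[a * d - b * c = 1] (mod int p)" "[a' * d' - b' * c' = 1] (mod int p)" for v w a b c d v' w' a' b' c' d'
  proof
    assume "el v w a b c d = el v' w' a' b' c' d'"
    then have "\<phi> (el v w a b c d) = \<phi> (el v' w' a' b' c' d')" by simp
    then show "qd_elem p v w a b c d = qd_elem p v' w' a' b' c' d'"
      by (simp only: el(2)[OF det(1)] el(2)[OF det(2)])
  qed (simp only: el_def)
  have el_mult: "el v w a b c d \<otimes> el v' w' a' b' c' d' =
      el (v + (a * v' + b * w')) (w + (c * v' + d * w')) (a * a' + b * c') (a * b' + b * d') (c * a' + d * c') (c * b' + d * d')"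
    if d: "[a * d - b * c = 1] (mod int p)" "[a' * d' - b' * c' = 1] (mod int p)" for v w a b c d v' w' a' b' c' d'
  proof -
    have "\<phi> (el v w a b c d \<otimes> el v' w' a' b' c' d') = qd_elem p v w a b c d \<otimes>\<^bsub>Qd p\<^esub> qd_elem p v' w' a' b' c' d'"
      using hom_mult[OF \<phi>(1)] el d by simp
    then have "inv_into (carrier G) \<phi> (qd_elem p v w a b c d \<otimes>\<^bsub>Qd p\<^esub> qd_elem p v' w' a' b' c' d')
        = el v w a b c d \<otimes> el v' w' a' b' c' d'"
      using el(1)[OF d(1)] el(1)[OF d(2)] \<phi>(2) by (metis bij_betw_def inv_into_f_f m_closed)
    then show ?thesis by (simp add: qd_elem_mult el_def)
  qed
  have elE: "\<exists>v w a b c d. g = el v w a b c d \<and> [a * d - b * c = 1] (mod int p)" if "g \<in> carrier G" for g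
  proof -
    have "\<phi> g \<in> carrier (Qd p)" using that \<phi>(2) by (auto simp: bij_betw_def)
    then obtain v w a b c d where "\<phi> g = qd_elem p v w a b c d" "[a * d - b * c = 1] (mod int p)"
      using Qd_elemE[OF prime_p] by metis
    moreover from this have "g = el v w a b c d"
      using that \<phi>(2) by (simp add: el_def flip: \<open>\<phi> g = _\<close>) (simp add: bij_betw_def)
    ultimately show ?thesis by blast
  qed
  have one: "el 0 0 1 0 0 1 = \<one>"
    using el_mult[of 1 1 0 0 1 1 0 0 0 0 0 0] el(1)[of 1 1 0 0 0 0] by simp
  define tr where "tr = (\<lambda>v w. el v w 1 0 0 1)"
  have trG: "tr v w \<in> carrier G" for v w using el(1)[of 1 1 0 0] by (simp add: tr_def)
  have tr_mult: "tr v w \<otimes> tr v' w' = tr (v + v') (w + w')" for v w v' w'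
    using el_mult[of 1 1 0 0 1 1 0 0] by (simp add: tr_def)
  have tr_inv: "inv (tr v w) = tr (- v) (- w)" for v w
    by (rule inv_equality) (simp_all add: tr_mult trG, simp add: tr_def one)
  have tr_eq: "tr v w = tr v' w' \<longleftrightarrow> [v = v'] (mod int p) \<and> [w = w'] (mod int p)" for v w v' w'
    by (simp add: tr_def el_eq qd_elem_eq_iff)
  define V where "V = {tr v w | v w. True}"
  have subV: "subgroup V G"
    by (rule subgroupI) (force simp: V_def trG tr_inv tr_mult)+
  have conj_tr: "conj_by G (el v w a b c d) (tr v' w') = tr (a * v' + b * w') (c * v' + d * w')"
    if "[a * d - b * c = 1] (mod int p)" for v w a b c d v' w'
    using that el(1)[OF that] trG by (simp add: conj_by_eq_iff) (simp add: tr_def el_mult add.commute)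
  have p0: "int p > 0" using prime_p by (simp add: prime_gt_0_nat)
  have pV: "p_subgroup p G V"
  proof -
    let ?I = "{0..<int p} \<times> {0..<int p}"
    have "V = (\<lambda>(v, w). tr v w) ` ?I"
    proof
      show "V \<subseteq> (\<lambda>(v, w). tr v w) ` ?I"
      proof
        fix g assume "g \<in> V"
        then obtain v w where "g = tr v w" by (auto simp: V_def)
        then have "g = (\<lambda>(v, w). tr v w) (v mod int p, w mod int p)" by (simp add: tr_eq)
        moreover have "(v mod int p, w mod int p) \<in> ?I" using p0 by simp
        ultimately show "g \<in> (\<lambda>(v, w). tr v w) ` ?I" by blast
      qed
    qed (auto simp: V_def)
    moreover have "inj_on (\<lambda>(v, w). tr v w) ?I"
      by (auto simp: inj_on_def tr_eq cong_def)
    ultimately have "card V = p ^ 2"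
      by (simp add: card_image card_cartesian_product power2_eq_square)
    with subV show ?thesis by (auto simp: p_subgroup_def)
  qed
  have normV: "normalizer G V = carrier G"
  proof
    show "carrier G \<subseteq> normalizer G V"
    proof
      fix g assume g: "g \<in> carrier G"
      obtain v w a b c d where "g = el v w a b c d" "[a * d - b * c = 1] (mod int p)"
        using elE[OF g] by blast
      then have "conj_by G g (tr v' w') \<in> V" for v' w'
        unfolding V_def using conj_tr by blast
      then have "conj_by G g h \<in> V" if "h \<in> V" for h
        using that by (auto simp: V_def)
      with g show "g \<in> normalizer G V" by (simp add: mem_normalizer_subgroup_iff[OF subV])
    qed
  qed (rule normalizer_subset_carrier)
  \<comment> \<open>\<open>g\<close> is the Weyl element carrying the upper transvection
    \<open>x\<close> to the lower one \<open>l\<close>, and \<open>s\<close> is \<open>-1\<close>;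
    all have translation part 0.\<close>
  define x where "x = el 0 0 1 1 0 1"
  define g where "g = el 0 0 0 1 (- 1) 0"
  define l where "l = el 0 0 1 0 (- 1) 1"
  define s where "s = el 0 0 (- 1) 0 0 (- 1)"
  have xG: "x \<in> carrier G" and gG: "g \<in> carrier G" and lG: "l \<in> carrier G" and sG: "s \<in> carrier G"
    by (simp_all add: x_def g_def l_def s_def el)
  have xinv: "inv x = el 0 0 1 (- 1) 0 1"
    by (rule inv_equality) (use xG in \<open>simp_all add: x_def el_mult one el\<close>)
  have comm: "commutator G (tr v w) x = tr (- w) 0" for v w
    unfolding commutator_def tr_inv xinv by (simp add: x_def tr_def el_mult)
  have quad: "\<forall>a\<in>V. commutator G (commutator G a x) x = \<one>"
    by (auto simp: V_def comm) (simp add: tr_def one)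
  define C where "C = centralizer G V"
  have subC: "subgroup C G" unfolding C_def by (rule subgroup_centralizer[OF subgroup.subset[OF subV]])
  have "carrier G \<subseteq> normalizer G C"
    using conj_by_centralizer[OF subgroup.subset[OF subV]] subC
    by (auto simp: normV C_def mem_normalizer_subgroup_iff)
  then have norm: "C \<lhd> G\<lparr>carrier := carrier G\<rparr>"
    by (intro normal_restrictI subgroup_self subC subgroup.subset)
  let ?Y = "G\<lparr>carrier := carrier G\<rparr> Mod C"
  define \<pi> where "\<pi> = (\<lambda>g. C #> g)"
  interpret Y: finite_group_prime ?Y p by (rule group_hom_Mod(3)[OF subgroup_self norm])
  interpret \<pi>: group_hom "G\<lparr>carrier := carrier G\<rparr>" ?Y \<pi>
    unfolding \<pi>_def by (rule group_hom_Mod(1)[OF subgroup_self norm])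
  have \<pi>1: "\<pi> h = \<one>\<^bsub>?Y\<^esub> \<longleftrightarrow> h \<in> C" if "h \<in> carrier G" for h
    using group_hom_Mod(4)[OF subgroup_self norm that] by (simp add: \<pi>_def)
  have x_core: "\<pi> x \<in> p_core p ?Y"
    using stable pV xG quad unfolding p_stable_def \<pi>_def C_def
    by (metis normV)
  have core: "subgroup (p_core p ?Y) ?Y" using Y.p_core_normal by (rule normal_imp_subgroup)
  have "conj_by G g x = l"
    using gG xG lG by (simp add: conj_by_eq_iff) (simp add: g_def x_def l_def el_mult)
  then have "\<pi> l = conj_by ?Y (\<pi> g) (\<pi> x)"
    using \<pi>.hom_conj_by[of g x] gG xG conj_by_restrict[OF subgroup_self gG, of x] by simp
  then have l_core: "\<pi> l \<in> p_core p ?Y"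
    using Y.normal_invE(2)[OF Y.p_core_normal \<pi>.hom_closed x_core, of g] gG by (simp add: conj_by_def)
  define t where "t = x \<otimes> (l \<otimes> l)"
  have tG: "t \<in> carrier G" using xG lG by (simp add: t_def)
  have "\<pi> t = \<pi> x \<otimes>\<^bsub>?Y\<^esub> (\<pi> l \<otimes>\<^bsub>?Y\<^esub> \<pi> l)"
    using \<pi>.hom_mult[of x "l \<otimes> l"] \<pi>.hom_mult[of l l] xG lG by (simp add: t_def)
  then have "\<pi> t \<in> p_core p ?Y"
    using subgroup.m_closed[OF core x_core subgroup.m_closed[OF core l_core l_core]] by simp
  then obtain n where n: "\<pi> t [^]\<^bsub>?Y\<^esub> (p ^ n) = \<one>\<^bsub>?Y\<^esub>" by (rule Y.mem_p_core_pow_eq_one)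
  then have "\<pi> (t [^] (p ^ n)) = \<one>\<^bsub>?Y\<^esub>"
    using \<pi>.hom_nat_pow[of t "p ^ n"] tG by (simp add: nat_pow_consistent[symmetric])
  then have tC: "t [^] (p ^ n) \<in> C" using \<pi>1 tG by simp
  have tt: "t \<otimes> t = s"
    by (simp add: t_def x_def l_def s_def el_mult)
  have ss: "s \<otimes> s = \<one>" by (simp add: s_def el_mult one)
  \<comment> \<open>Since \<open>s\<close> has square 1 and \<open>p^n\<close> is odd, the square of
    \<open>t^(p^n)\<close> is \<open>s^(p^n) = s\<close>. So \<open>s\<close> would centralise the
    plane, giving \<open>-1 = 1\<close> modulo \<open>p\<close>.\<close>
  have "odd (p ^ n)" using \<open>odd p\<close> by simp
  then obtain k where k: "p ^ n = 2 * k + 1" using oddE by blast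
  have "t [^] (p ^ n) \<otimes> t [^] (p ^ n) = (t \<otimes> t) [^] (p ^ n)"
    using tG by (simp add: pow_mult_distrib)
  also have "\<dots> = (s \<otimes> s) [^] k \<otimes> s"
    using sG by (simp add: tt k nat_pow_mult[symmetric] pow_mult_distrib mult_2)
  also have "\<dots> = s" using sG by (simp add: ss)
  finally have "s \<in> C" using subgroup.m_closed[OF subC tC tC] by simp
  then have "conj_by G s (tr 1 0) = tr 1 0"
    using mem_centralizer_iff[OF subgroup.subset[OF subV]] by (auto simp: C_def V_def)
  then have "tr (- 1) 0 = tr 1 0" using conj_tr[of "- 1" "- 1" 0 0 0 0 1 0] by (simp add: s_def)
  then have "int p dvd 2" by (simp add: tr_eq cong_iff_dvd_diff)
  then have "p dvd 2" by presburger
  with prime_p \<open>odd p\<close> show False by (metis dvd_refl primes_dvd_imp_eq two_is_prime_nat)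
qed

end

theorem corollary8p12:
  fixes G :: "('a, 'b) monoid_scheme" and p :: nat
  assumes "prime p" and "odd p"
    and "group G" and "finite (carrier G)"
  shows "(\<forall>H K. section_of G H K \<longrightarrow> p_stable p (G\<lparr>carrier := H\<rparr> Mod K)) \<longleftrightarrow>
         (\<forall>Q. p_centric p G Q \<longrightarrow>
              \<not> involves (G\<lparr>carrier := normalizer G Q\<rparr>) (Qd p))"
proof -
  interpret group G by fact
  interpret finite_group_prime G p
    by unfold_locales (use assms in auto)
  show ?thesis
  proof (intro iffI allI impI notI)
    fix Q
    assume stable: "\<forall>H K. section_of G H K \<longrightarrow> p_stable p (G\<lparr>carrier := H\<rparr> Mod K)"
      and Q: "p_centric p G Q" and inv: "involves (G\<lparr>carrier := normalizer G Q\<rparr>) (Qd p)"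
    let ?N = "normalizer G Q"
    have subN: "subgroup ?N G"
      using Q by (intro subgroup_normalizer) (simp add: p_centric_def p_subgroup_def)
    obtain H K where HN: "subgroup H (G\<lparr>carrier := ?N\<rparr>)" and K: "K \<lhd> G\<lparr>carrier := H\<rparr>"
      and iso: "(G\<lparr>carrier := H\<rparr> Mod K) \<cong> Qd p"
      using inv by (auto simp: involves_def section_of_def)
    \<comment> \<open>A section of the normalizer is also a section of \<open>G\<close>, so the
      stability assumption applies to it.\<close>
    have H: "subgroup H G" using incl_subgroup[OF subN HN] .
    interpret Y: finite_group_prime "G\<lparr>carrier := H\<rparr> Mod K" p
      by (rule group_hom_Mod(3)[OF H K])
    have "p_stable p (G\<lparr>carrier := H\<rparr> Mod K)"
      using stable H K by (simp add: section_of_def)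
    with Y.not_p_stable_of_iso_Qd[OF \<open>odd p\<close> iso] show False ..
  next
    fix H K
    assume not_inv: "\<forall>Q. p_centric p G Q \<longrightarrow> \<not> involves (G\<lparr>carrier := normalizer G Q\<rparr>) (Qd p)"
      and "section_of G H K"
    then have H: "subgroup H G" and K: "K \<lhd> G\<lparr>carrier := H\<rparr>" by (simp_all add: section_of_def)
    interpret Y: finite_group_prime "G\<lparr>carrier := H\<rparr> Mod K" p
      by (rule group_hom_Mod(3)[OF H K])
    show "p_stable p (G\<lparr>carrier := H\<rparr> Mod K)"
    proof (rule ccontr)
      assume "\<not> p_stable p (G\<lparr>carrier := H\<rparr> Mod K)"
      from Y.sl2_section_of_not_p_stable[OF \<open>odd p\<close> this]
      obtain R where "sl2_section p (G\<lparr>carrier := H\<rparr> Mod K) R" .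
      from sl2_section_lift[OF H group_hom_Mod(1)[OF H K] group_hom_Mod(2)[OF H K] this]
      obtain S where S: "sl2_section p G S" "p_subgroup p G S"
        by (rule sl2_section_p_subgroup)
      obtain Q where Q: "p_centric p G Q" "sl2_section p (G\<lparr>carrier := normalizer G Q\<rparr>) S"
        by (rule sl2_section_p_centric[OF S])
      have subN: "subgroup (normalizer G Q) G"
        using Q by (intro subgroup_normalizer) (simp add: p_centric_def p_subgroup_def)
      interpret N: finite_group_prime "G\<lparr>carrier := normalizer G Q\<rparr>" p
        using subgroup_imp_group[OF subN] finite_subgroup[OF subN] prime_p
        by (simp add: finite_group_prime_def finite_group_prime_axioms_def)
      show False
        using N.involves_Qd_of_sl2_section[OF \<open>odd p\<close> Q(2)] not_inv Q(1) by blast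
    qed
  qed
qed

end
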